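(* Let $\omega\in\mathscr P_E(\mathbf R^{2d})$, and let $\Phi_k$ and $\Psi_k$, $k=1,2$, be quasi-Young functions such that $$\lim_{t\to0^+}\frac{\Psi_k(t)}{\Phi_k(t)}$$ exist and are finite, $k=1,2$. Then the following is true: (1) $\ell^{\Phi_1,\Phi_2}_{(\omega)}(\mathbf Z^{2d})$ is continuously embedded in $\ell^{\Psi_1,\Psi_2}_{(\omega)}(\mathbf Z^{2d})$; (2) $M^{\Phi_1,\Phi_2}_{(\omega)}(\mathbf R^d)$ is continuously embedded in $M^{\Psi_1,\Psi_2}_{(\omega)}(\mathbf R^d)$.
   Context: Weights: a weight on $\mathbf R^n$ is a positive $\omega\in L^\infty_{loc}$ with $1/\omega\in L^\infty_{loc}$; $\mathscr P_E(\mathbf R^n)$ is the set of moderate weights, i.e. weights $\omega$ for which there is a positive weight $v$ with $\omega(x+y)\lesssim\omega(x)v(y)$ for all $x,y\in\mathbf R^n$. $A\lesssim B$ means $A\le cB$ with a constant $c>0$. Young functions: a Young function is a convex $\Phi_0:[0,\infty)\to[0,\infty]$ with $\Phi_0(0)=0$, $\lim_{t\to\infty}\Phi_0(t)=\infty$; a quasi-Young function of order $r_0\in(0,1]$ is $\Phi(t)=\Phi_0(t^{r_0})$ with $\Phi_0$ Young; a quasi-Young function is one of some order $r_0\in(0,1]$. Orlicz quasi-norms: for a measure $\mu$, $\|f\|_{L^\Phi(\mu)}=\inf\{\lambda>0:\int\Phi(|f|/\lambda)\,d\mu\le1\}$, and $\|F\|_{L^{\Phi_1,\Phi_2}_{(\omega)}(\mu\otimes\mu)}=\big\|\,\xi\mapsto\|F(\cdot,\xi)\omega(\cdot,\xi)\|_{L^{\Phi_1}(\mu)}\big\|_{L^{\Phi_2}(\mu)}$.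 $L^{\Phi_1,\Phi_2}_{(\omega)}(\mathbf R^{2d})$ uses Lebesgue measure on $\mathbf R^d$; $\ell^{\Phi_1,\Phi_2}_{(\omega)}(\mathbf Z^{2d})$ uses counting measure on $\mathbf Z^d$. Modulation spaces: with $\phi_0(x)=\pi^{-d/4}e^{-|x|^2/2}$, $M^{\Phi_1,\Phi_2}_{(\omega)}(\mathbf R^d)=\{f\in\mathcal H'_\flat(\mathbf R^d):\|f\|_{M^{\Phi_1,\Phi_2}_{(\omega)}}:=\|V_{\phi_0}f\|_{L^{\Phi_1,\Phi_2}_{(\omega)}}<\infty\}$, where $V_{\phi_0}f(x,\xi)=(2\pi)^{-d/2}(f,e^{i\langle\cdot,\xi\rangle}\phi_0(\cdot-x))$. Here $\mathcal H'_\flat(\mathbf R^d)$ is the space of formal Hermite series $\sum_\alpha c(\alpha)h_\alpha$ with $|c(\alpha)|\lesssim r^{|\alpha|}\alpha!^{1/2}$ for every $r>0$ ($h_\alpha$ the $L^2$-normalized Hermite functions), dual via the extended $L^2$-form to the space $\mathcal H_\flat(\mathbf R^d)$ of Hermite series with $|c(\alpha)|\lesssim r^{|\alpha|}\alpha!^{-1/2}$ for some $r>0$. *)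

theory Defs
  imports "HOL-Analysis.Analysis"
begin

section \<open>Weights\<close>

definition L_infinity_loc :: "('a::euclidean_space \<Rightarrow> real) \<Rightarrow> bool" where
  "L_infinity_loc f \<longleftrightarrow> f \<in> borel_measurable lebesgue \<and>
     (\<forall>K. compact K \<longrightarrow> (\<exists>C. AE x in lebesgue. x \<in> K \<longrightarrow> \<bar>f x\<bar> \<le> C))"

definition weight :: "('a::euclidean_space \<Rightarrow> real) \<Rightarrow> bool" where
  "weight \<omega> \<longleftrightarrow> (\<forall>x. \<omega> x > 0) \<and> L_infinity_loc \<omega> \<and> L_infinity_loc (\<lambda>x. 1 / \<omega> x)"

definition moderate_weight :: "('a::euclidean_space \<Rightarrow> real) \<Rightarrow> bool" where
  "moderate_weight \<omega> \<longleftrightarrow> weight \<omega> \<and>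
     (\<exists>v. weight v \<and> (\<exists>c>0. \<forall>x y. \<omega> (x + y) \<le> c * (\<omega> x * v y)))"


section \<open>Young functions\<close>

text \<open>A function from \<open>[0,\<infinity>)\<close> to \<open>[0,\<infinity>]\<close> is represented by a function of type
  \<^typ>\<open>real \<Rightarrow> ennreal\<close>; its values at negative arguments are never used. Convexity is
  spelled out because \<^const>\<open>convex_on\<close> does not cover the codomain \<^typ>\<open>ennreal\<close>.
  Quotients \<open>\<Psi>(t) / \<Phi>(t)\<close> of such functions follow the conventions of \<^typ>\<open>ennreal\<close>:
  \<open>a / 0 = \<infinity>\<close> for \<open>a > 0\<close>, \<open>0 / 0 = 0\<close> and \<open>\<infinity> / \<infinity> = 0\<close>. So a finite limit at \<open>0+\<close> always
  gives \<open>\<Psi> \<le> C \<Phi>\<close> near \<open>0\<close>, also where \<open>\<Phi>\<close> is \<open>0\<close> or \<open>\<infinity>\<close>.\<close>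

definition young :: "(real \<Rightarrow> ennreal) \<Rightarrow> bool" where
  "young \<Phi>0 \<longleftrightarrow>
     (\<forall>s\<ge>0. \<forall>t\<ge>0. \<forall>u\<ge>0. \<forall>v\<ge>0. u + v = 1 \<longrightarrow>
        \<Phi>0 (u * s + v * t) \<le> ennreal u * \<Phi>0 s + ennreal v * \<Phi>0 t) \<and>
     \<Phi>0 0 = 0 \<and> (\<Phi>0 \<longlongrightarrow> \<infinity>) at_top"

definition quasi_young_of_order :: "real \<Rightarrow> (real \<Rightarrow> ennreal) \<Rightarrow> bool" where
  "quasi_young_of_order r0 \<Phi> \<longleftrightarrow> 0 < r0 \<and> r0 \<le> 1 \<and>
     (\<exists>\<Phi>0. young \<Phi>0 \<and> (\<forall>t\<ge>0. \<Phi> t = \<Phi>0 (t powr r0)))"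

definition quasi_young :: "(real \<Rightarrow> ennreal) \<Rightarrow> bool" where
  "quasi_young \<Phi> \<longleftrightarrow> (\<exists>r0. quasi_young_of_order r0 \<Phi>)"


section \<open>Orlicz quasi-norms\<close>

text \<open>In the mixed quasi-norm the outer quasi-norm is applied to a function with values in
  \<open>[0,\<infinity>]\<close>. Hence \<open>\<Phi>\<close> is extended by \<open>\<Phi>(\<infinity>) = \<infinity>\<close>, its limit at infinity, and the
  quasi-norm is defined for nonnegative extended functions, to be applied to \<open>|f|\<close>.
  It is \<open>\<infinity>\<close> if no \<open>\<lambda>\<close> is admissible.\<close>

definition ext_young :: "(real \<Rightarrow> ennreal) \<Rightarrow> ennreal \<Rightarrow> ennreal" where
  "ext_young \<Phi> t = (if t = \<infinity> then \<infinity> else \<Phi> (enn2real t))"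

definition orlicz_norm :: "'a measure \<Rightarrow> (real \<Rightarrow> ennreal) \<Rightarrow> ('a \<Rightarrow> ennreal) \<Rightarrow> ennreal" where
  "orlicz_norm \<mu> \<Phi> g =
     Inf {ennreal l | l. l > 0 \<and> (\<integral>\<^sup>+ x. ext_young \<Phi> (g x / ennreal l) \<partial>\<mu>) \<le> 1}"

definition mixed_orlicz_norm ::
  "'a measure \<Rightarrow> (real \<Rightarrow> ennreal) \<Rightarrow> (real \<Rightarrow> ennreal) \<Rightarrow> ('a \<times> 'a \<Rightarrow> real) \<Rightarrow>
   ('a \<times> 'a \<Rightarrow> complex) \<Rightarrow> ennreal" where
  "mixed_orlicz_norm \<mu> \<Phi>1 \<Phi>2 \<omega> F =
     orlicz_norm \<mu> \<Phi>2
       (\<lambda>\<xi>. orlicz_norm \<mu> \<Phi>1 (\<lambda>x. ennreal (norm (F (x, \<xi>)) * \<omega> (x, \<xi>))))"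


section \<open>Discrete spaces\<close>

definition lattice_point :: "int ^ 'd \<Rightarrow> real ^ 'd" where
  "lattice_point k = (\<chi> i. real_of_int (k $ i))"

definition ell_norm ::
  "(real \<Rightarrow> ennreal) \<Rightarrow> (real \<Rightarrow> ennreal) \<Rightarrow> ((real ^ 'd) \<times> (real ^ 'd) \<Rightarrow> real) \<Rightarrow>
   ((int ^ 'd) \<times> (int ^ 'd) \<Rightarrow> complex) \<Rightarrow> ennreal" where
  "ell_norm \<Phi>1 \<Phi>2 \<omega> =
     mixed_orlicz_norm (count_space UNIV) \<Phi>1 \<Phi>2
       (\<lambda>(j, k). \<omega> (lattice_point j, lattice_point k))"

definition ell_space ::
  "(real \<Rightarrow> ennreal) \<Rightarrow> (real \<Rightarrow> ennreal) \<Rightarrow> ((real ^ 'd) \<times> (real ^ 'd) \<Rightarrow> real) \<Rightarrow>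
   ((int ^ 'd) \<times> (int ^ 'd) \<Rightarrow> complex) set" where
  "ell_space \<Phi>1 \<Phi>2 \<omega> = {a. ell_norm \<Phi>1 \<Phi>2 \<omega> a < \<infinity>}"


section \<open>Hermite series\<close>

text \<open>The \<open>L\<^sup>2\<close>-normalized Hermite functions on the line, by the Rodrigues formula, and their
  tensor products.\<close>

definition hermite_fun1 :: "nat \<Rightarrow> real \<Rightarrow> real" where
  "hermite_fun1 n t =
     pi powr (- 1 / 4) * (- 1) ^ n / sqrt (2 ^ n * fact n) *
     exp (t\<^sup>2 / 2) * (deriv ^^ n) (\<lambda>s. exp (- s\<^sup>2)) t"

definition hermite_fun :: "nat ^ 'd \<Rightarrow> real ^ 'd \<Rightarrow> real" where
  "hermite_fun \<alpha> x = (\<Prod>i\<in>UNIV. hermite_fun1 (\<alpha> $ i) (x $ i))"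

definition mi_length :: "nat ^ 'd \<Rightarrow> nat" where
  "mi_length \<alpha> = (\<Sum>i\<in>UNIV. \<alpha> $ i)"

definition mi_fact :: "nat ^ 'd \<Rightarrow> real" where
  "mi_fact \<alpha> = (\<Prod>i\<in>UNIV. fact (\<alpha> $ i))"

text \<open>A formal Hermite series \<open>\<Sum>\<^sub>\<alpha> c(\<alpha>) h\<^sub>\<alpha>\<close> is identified with its coefficient family \<open>c\<close>.\<close>

definition H_flat_dual :: "(nat ^ 'd \<Rightarrow> complex) set" where
  "H_flat_dual =
     {c. \<forall>r>0. \<exists>C>0. \<forall>\<alpha>. norm (c \<alpha>) \<le> C * (r ^ mi_length \<alpha> * sqrt (mi_fact \<alpha>))}"

definition hermite_coeff :: "(real ^ 'd \<Rightarrow> complex) \<Rightarrow> nat ^ 'd \<Rightarrow> complex" where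
  "hermite_coeff \<psi> \<alpha> = (LINT y|lebesgue. \<psi> y * complex_of_real (hermite_fun \<alpha> y))"

text \<open>The extension of the sesquilinear \<open>L\<^sup>2\<close>-form \<open>(f, \<psi>)\<close> to \<open>f\<close> in \<^const>\<open>H_flat_dual\<close> and
  functions \<open>\<psi>\<close> whose Hermite coefficients are \<open>O(r\<^bsup>|\<alpha>|\<^esup> \<alpha>!\<^bsup>-1/2\<^esup>)\<close> for some \<open>r > 0\<close>; the
  sum then converges absolutely. Time-frequency shifts of the Gaussian are such functions.\<close>

definition hermite_pairing :: "(nat ^ 'd \<Rightarrow> complex) \<Rightarrow> (real ^ 'd \<Rightarrow> complex) \<Rightarrow> complex" where
  "hermite_pairing f \<psi> = (\<Sum>\<^sub>\<infinity>\<alpha>. f \<alpha> * cnj (hermite_coeff \<psi> \<alpha>))"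


section \<open>Modulation spaces\<close>

definition gauss_window :: "real ^ 'd \<Rightarrow> real" where
  "gauss_window x = pi powr (- real CARD('d) / 4) * exp (- (norm x)\<^sup>2 / 2)"

definition stft :: "(nat ^ 'd \<Rightarrow> complex) \<Rightarrow> (real ^ 'd) \<times> (real ^ 'd) \<Rightarrow> complex" where
  "stft f = (\<lambda>(x, \<xi>). complex_of_real ((2 * pi) powr (- real CARD('d) / 2)) *
     hermite_pairing f
       (\<lambda>y. exp (\<i> * complex_of_real (y \<bullet> \<xi>)) * complex_of_real (gauss_window (y - x))))"

definition modulation_norm ::
  "(real \<Rightarrow> ennreal) \<Rightarrow> (real \<Rightarrow> ennreal) \<Rightarrow> ((real ^ 'd) \<times> (real ^ 'd) \<Rightarrow> real) \<Rightarrow>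
   (nat ^ 'd \<Rightarrow> complex) \<Rightarrow> ennreal" where
  "modulation_norm \<Phi>1 \<Phi>2 \<omega> f = mixed_orlicz_norm lebesgue \<Phi>1 \<Phi>2 \<omega> (stft f)"

definition modulation_space ::
  "(real \<Rightarrow> ennreal) \<Rightarrow> (real \<Rightarrow> ennreal) \<Rightarrow> ((real ^ 'd) \<times> (real ^ 'd) \<Rightarrow> real) \<Rightarrow>
   (nat ^ 'd \<Rightarrow> complex) set" where
  "modulation_space \<Phi>1 \<Phi>2 \<omega> = {f \<in> H_flat_dual. modulation_norm \<Phi>1 \<Phi>2 \<omega> f < \<infinity>}"


section \<open>Continuous embeddings\<close>

text \<open>The vector topology of a quasi-normed space \<open>(X, N)\<close>. Quasi-norm balls need not be open.\<close>

definition quasinorm_topology :: "'a::minus set \<Rightarrow> ('a \<Rightarrow> ennreal) \<Rightarrow> 'a topology" where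
  "quasinorm_topology X N =
     topology (\<lambda>U. U \<subseteq> X \<and> (\<forall>f\<in>U. \<exists>\<epsilon>>0. \<forall>g\<in>X. N (g - f) < \<epsilon> \<longrightarrow> g \<in> U))"

lemma openin_quasinorm_topology:
  "openin (quasinorm_topology X N) U \<longleftrightarrow>
     U \<subseteq> X \<and> (\<forall>f\<in>U. \<exists>\<epsilon>>0. \<forall>g\<in>X. N (g - f) < \<epsilon> \<longrightarrow> g \<in> U)"
proof -
  let ?P = "\<lambda>U. U \<subseteq> X \<and> (\<forall>f\<in>U. \<exists>\<epsilon>>0. \<forall>g\<in>X. N (g - f) < \<epsilon> \<longrightarrow> g \<in> U)"
  have "istopology ?P"
    unfolding istopology_def
  proof (intro conjI allI impI)
    fix S T assume S: "?P S" and T: "?P T"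
    show "S \<inter> T \<subseteq> X" using S by blast
    show "\<forall>f\<in>S \<inter> T. \<exists>\<epsilon>>0. \<forall>g\<in>X. N (g - f) < \<epsilon> \<longrightarrow> g \<in> S \<inter> T"
    proof
      fix f assume f: "f \<in> S \<inter> T"
      obtain a where a: "a > 0" "\<forall>g\<in>X. N (g - f) < a \<longrightarrow> g \<in> S" using S f by blast
      obtain b where b: "b > 0" "\<forall>g\<in>X. N (g - f) < b \<longrightarrow> g \<in> T" using T f by blast
      show "\<exists>\<epsilon>>0. \<forall>g\<in>X. N (g - f) < \<epsilon> \<longrightarrow> g \<in> S \<inter> T"
        using a b by (intro exI[of _ "min a b"]) auto
    qed
  next
    fix \<K> assume K: "\<forall>S\<in>\<K>. ?P S"
    show "\<Union>\<K> \<subseteq> X" using K by blast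
    show "\<forall>f\<in>\<Union>\<K>. \<exists>\<epsilon>>0. \<forall>g\<in>X. N (g - f) < \<epsilon> \<longrightarrow> g \<in> \<Union>\<K>" using K by (meson UnionE UnionI)
  qed
  then show ?thesis
    by (simp add: quasinorm_topology_def topology_inverse')
qed

lemma topspace_quasinorm_topology [simp]: "topspace (quasinorm_topology X N) = X"
proof
  show "topspace (quasinorm_topology X N) \<subseteq> X"
    using openin_topspace openin_quasinorm_topology by blast
  have "openin (quasinorm_topology X N) X"
    by (auto simp: openin_quasinorm_topology intro: exI[of _ "1::ennreal"])
  then show "X \<subseteq> topspace (quasinorm_topology X N)"
    by (rule openin_subset)
qed

definition continuously_embedded ::
  "'a::minus set \<Rightarrow> ('a \<Rightarrow> ennreal) \<Rightarrow> 'a set \<Rightarrow> ('a \<Rightarrow> ennreal) \<Rightarrow> bool" where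
  "continuously_embedded X N\<^sub>X Y N\<^sub>Y \<longleftrightarrow>
     X \<subseteq> Y \<and> continuous_map (quasinorm_topology X N\<^sub>X) (quasinorm_topology Y N\<^sub>Y) (\<lambda>f. f)"

end

theory Submission
  imports Defs "HOL-Complex_Analysis.Complex_Analysis" "HOL-Probability.Characteristic_Functions"
    "HOL-Real_Asymp.Real_Asymp"
begin

text \<open>The finite limit at \<open>0+\<close> gives \<open>\<Psi> \<le> C \<Phi>\<close> near \<open>0\<close>, so \<open>L\<^sup>\<Phi>\<close> controls \<open>L\<^sup>\<Psi>\<close> on functions whose
  sup norm is bounded by their \<open>L\<^sup>\<Phi>\<close> norm. For sequences this bound is trivial. For the short-time
  Fourier transform it comes from analyticity: with a Gaussian window, \<open>V f\<close> is a Gaussian times the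
  Bargmann transform of \<open>f\<close>, an entire function. The mean value property along complex lines, averaged
  over rotations, bounds \<open>|V f|\<close> by its means over small balls, and an argument of Fefferman and Stein
  passes to \<open>|V f|\<^sup>p\<close> for \<open>0 < p \<le> 1\<close>. A moderate weight is comparable to a constant on
  unit balls and may be taken Borel, so \<open>|V f \<omega>|\<^sup>p\<close> has the same property. Taking \<open>p\<close> at most the orders
  of \<open>\<Phi>\<^sub>1\<close> and \<open>\<Phi>\<^sub>2\<close> turns both into functions with \<open>E (s t) \<le> s E t\<close> for \<open>s \<le> 1\<close>; this weak
  convexity suffices for a Jensen inequality up to a factor \<open>2\<close>, which bounds the sup norms and carries
  the averages through the two iterated norms.\<close>

section \<open>Star-shaped gauges and Luxemburg norms\<close>

text \<open>The mean value property couples both variables: an inner norm at frequency \<xi> is not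
  controlled by the inner norm at \<xi> itself, only by an average of inner norms over frequencies
  within distance 1. Minkowski's inequality is the classical tool for the norm of an average. Its
  place is taken here by Jensen's inequality for a measure on a product of two unit balls, whose
  density in the outer variable is proportional to the inner norm itself. The inequality rests on
  \<open>E t / t\<close> being increasing, which is what \<open>E (s * t) \<le> s * E t\<close>
  expresses; this form makes sense also where \<open>E\<close> is 0 or \<infinity>. The growth
  clause serves the comparison of the two gauges. Domination is known only near 0, but a bound
  \<open>E t \<le> b\<close> confines t to a bounded interval, and contracting that interval into
  the neighbourhood of 0 costs just a constant. For counting measure b = 1, because points have mass
  one; for Lebesgue measure b is the reciprocal volume of the unit ball, because Jensen bounds
  \<open>E\<close> by a mean over that ball.\<close>

definition star_gauge :: "(ennreal \<Rightarrow> ennreal) \<Rightarrow> bool" where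
  "star_gauge E \<longleftrightarrow> E 0 = 0 \<and> (\<forall>s t. s \<le> 1 \<longrightarrow> E (s * t) \<le> s * E t) \<and>
     (\<forall>b<\<infinity>. \<exists>T<\<infinity>. \<forall>t. E t \<le> b \<longrightarrow> t \<le> T)"

definition lux_norm :: "'a measure \<Rightarrow> (ennreal \<Rightarrow> ennreal) \<Rightarrow> ('a \<Rightarrow> ennreal) \<Rightarrow> ennreal" where
  "lux_norm \<mu> E g = Inf {ennreal l | l. l > 0 \<and> (\<integral>\<^sup>+ x. E (g x / ennreal l) \<partial>\<mu>) \<le> 1}"

lemma orlicz_norm_eq_lux_norm: "orlicz_norm \<mu> \<Phi> = lux_norm \<mu> (ext_young \<Phi>)"
  by (simp add: orlicz_norm_def lux_norm_def fun_eq_iff)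

lemma star_gauge_zero: "star_gauge E \<Longrightarrow> E 0 = 0"
  by (simp add: star_gauge_def)

lemma star_gauge_scale: "star_gauge E \<Longrightarrow> s \<le> 1 \<Longrightarrow> E (s * t) \<le> s * E t"
  by (simp add: star_gauge_def)

lemma star_gauge_bounded:
  assumes "star_gauge E" "b < \<infinity>"
  obtains T where "T > 0" "T < \<infinity>" "\<And>t. E t \<le> b \<Longrightarrow> t \<le> T"
proof -
  obtain T where T: "T < \<infinity>" "\<And>t. E t \<le> b \<Longrightarrow> t \<le> T"
    using assms unfolding star_gauge_def by blast
  show thesis
  proof (rule that[of "T + 1"])
    show "T + 1 > 0" by (simp add: zero_less_iff_neq_zero)
    show "T + 1 < \<infinity>" using T(1) by (simp add: less_top[symmetric])
    show "t \<le> T + 1" if "E t \<le> b" for t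
      using T(2)[OF that] by (rule order_trans) simp
  qed
qed

lemma star_gauge_top: "star_gauge E \<Longrightarrow> E \<infinity> = \<infinity>"
proof (rule ccontr)
  assume "star_gauge E" "E \<infinity> \<noteq> \<infinity>"
  then have "star_gauge E" "E \<infinity> < \<infinity>" by (simp_all add: less_top)
  then obtain T where "T < \<infinity>" "\<And>t. E t \<le> E \<infinity> \<Longrightarrow> t \<le> T"
    using star_gauge_bounded by blast
  from this(1) this(2)[of \<infinity>] show False by simp
qed

text \<open>For 0 < t < \<infinity> write s = (s / t) t: the star shape multiplies
  \<open>E t\<close> by a factor at most 1.\<close>

lemma star_gauge_mono: "star_gauge E \<Longrightarrow> mono E"
proof (rule monoI)
  fix s t :: ennreal assume E: "star_gauge E" and st: "s \<le> t"
  consider "t = \<infinity>" | "t = 0" | "t \<noteq> \<infinity>" "t \<noteq> 0" by blast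
  then show "E s \<le> E t"
  proof cases
    case 1 then show ?thesis using star_gauge_top[OF E] by simp
  next
    case 2 then show ?thesis using st by simp
  next
    case 3
    have le: "s / t \<le> 1"
      using st 3 by (simp add: divide_le_posI_ennreal zero_less_iff_neq_zero)
    have "E s = E (s / t * t)"
      using 3 mult_divide_eq_ennreal[of t s] by (simp add: mult.commute ennreal_times_divide)
    also have "\<dots> \<le> s / t * E t" by (rule star_gauge_scale[OF E le])
    also have "\<dots> \<le> 1 * E t" by (rule mult_right_mono[OF le]) simp
    finally show ?thesis by simp
  qed
qed

text \<open>By monotonicity a superlevel set is an up-set of the extended half-line, hence a closed
  or open ray from its infimum.\<close>

lemma star_gauge_measurable:
  assumes "star_gauge E"
  shows "E \<in> borel_measurable borel"
proof (rule borel_measurableI_greater)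
  fix y
  define S where "S = {t. y < E t}"
  have up: "t' \<in> S" if "t \<in> S" "t \<le> t'" for t t'
    using that monoD[OF star_gauge_mono[OF assms], of t t'] by (auto simp: S_def)
  have "S = {Inf S..} \<or> S = {Inf S<..}"
  proof (cases "Inf S \<in> S")
    case True
    then show ?thesis using up by (auto intro: Inf_lower)
  next
    case False
    have "t \<in> S" if "t > Inf S" for t
      using that up by (meson Inf_less_iff less_imp_le)
    moreover have "t > Inf S" if "t \<in> S" for t
      using that False by (metis Inf_lower order_less_le)
    ultimately show ?thesis by auto
  qed
  then have "S \<in> sets borel" by (metis atLeast_borel greaterThan_borel)
  then show "{x \<in> space borel. y < E x} \<in> sets borel" by (simp add: S_def)
qed

text \<open>A bound on \<open>E t\<close> bounds t, so a fixed contraction s moves all such t into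
  the region where \<open>F\<close> is dominated by \<open>L * E\<close>; the star shape then trades
  a small s against the constant L.\<close>

lemma star_gauge_compare:
  assumes E: "star_gauge E" and "b < \<infinity>" "L < \<infinity>" "0 < t0"
    and near: "\<And>t. t \<le> t0 \<Longrightarrow> F t \<le> L * E t"
  shows "\<exists>s>0. \<forall>t. E t \<le> b \<longrightarrow> F (ennreal s * t) \<le> E t"
proof -
  obtain T where T: "T > 0" "T < \<infinity>" "\<And>t. E t \<le> b \<Longrightarrow> t \<le> T"
    using star_gauge_bounded[OF E \<open>b < \<infinity>\<close>] by blast
  obtain t1 where t1: "0 < t1" "ennreal t1 \<le> t0"
    using \<open>0 < t0\<close> by (cases t0) (auto intro: that[of 1])
  define T' L' where "T' = enn2real T" and "L' = enn2real L"
  have TL: "T = ennreal T'" "L = ennreal L'" "T' > 0" "L' \<ge> 0"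
    using T(1,2) \<open>L < \<infinity>\<close> by (auto simp: T'_def L'_def enn2real_positive_iff)
  \<comment> \<open>The bound 1 permits the star-shape inequality, t1 / T' brings s t below t0, and
    1 / (L' + 1) gives L' s \<le> 1, with the added 1 covering L' = 0.\<close>
  define s where "s = min 1 (min (t1 / T') (1 / (L' + 1)))"
  have s: "s > 0" "s \<le> 1" "s * T' \<le> t1" "L' * s \<le> 1"
  proof -
    show "s > 0" "s \<le> 1" using TL t1 by (auto simp: s_def)
    have "s \<le> t1 / T'" by (simp add: s_def)
    then show "s * T' \<le> t1" using TL by (simp add: field_simps)
    have "s \<le> 1 / (L' + 1)" by (simp add: s_def)
    then have "s * (L' + 1) \<le> 1" using TL by (simp add: field_simps)
    then show "L' * s \<le> 1" using \<open>s > 0\<close> by (simp add: algebra_simps)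
  qed
  show ?thesis
  proof (intro exI[of _ s] conjI allI impI)
    fix t assume t: "E t \<le> b"
    have "ennreal s * t \<le> ennreal s * ennreal T'"
      using T(3)[OF t] TL by (intro mult_left_mono) auto
    also have "\<dots> = ennreal (s * T')" using s by (simp add: ennreal_mult')
    also have "\<dots> \<le> t0" using t1 s by (meson ennreal_leI order_trans)
    finally have "F (ennreal s * t) \<le> L * E (ennreal s * t)" by (rule near)
    also have "\<dots> \<le> L * (ennreal s * E t)"
      using s by (intro mult_left_mono star_gauge_scale[OF E]) auto
    also have "\<dots> = ennreal (L' * s) * E t"
      using TL s by (simp add: ennreal_mult mult.assoc)
    also have "\<dots> \<le> 1 * E t"
      using s by (intro mult_right_mono) auto
    finally show "F (ennreal s * t) \<le> E t" by simp
  qed (use s in auto)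
qed

section \<open>Elementary properties of the Luxemburg norm\<close>

lemma divide_ennreal_antimono:
  assumes "0 < l" "l \<le> q"
  shows "t / ennreal q \<le> t / ennreal l"
  using assms unfolding divide_ennreal_def
  by (intro mult_left_mono) (auto simp: inverse_ennreal intro!: ennreal_leI le_imp_inverse_le)

lemma lux_norm_le:
  assumes "l > 0" "(\<integral>\<^sup>+ x. E (g x / ennreal l) \<partial>\<mu>) \<le> 1"
  shows "lux_norm \<mu> E g \<le> ennreal l"
  unfolding lux_norm_def by (rule Inf_lower) (use assms in auto)

text \<open>Norm estimates are always proved through this rule: it suffices to treat one admissible
  l at a time, whether or not the infimum is attained.\<close>

lemma le_cmult_lux_norm:
  assumes "K > 0"
    and "\<And>l. l > 0 \<Longrightarrow> (\<integral>\<^sup>+ x. E (g x / ennreal l) \<partial>\<mu>) \<le> 1 \<Longrightarrow> N \<le> ennreal (K * l)"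
  shows "N \<le> ennreal K * lux_norm \<mu> E g"
proof -
  have "N / ennreal K \<le> lux_norm \<mu> E g"
    unfolding lux_norm_def
  proof (rule Inf_greatest, clarsimp)
    fix l :: real assume l: "0 < l" "(\<integral>\<^sup>+ x. E (g x / ennreal l) \<partial>\<mu>) \<le> 1"
    have "N \<le> ennreal (K * l)" using assms(2) l by blast
    then show "N / ennreal K \<le> ennreal l"
      using \<open>K > 0\<close> l by (intro divide_le_posI_ennreal) (auto simp: ennreal_mult mult.commute)
  qed
  then have "ennreal K * (N / ennreal K) \<le> ennreal K * lux_norm \<mu> E g"
    by (rule mult_left_mono) simp
  then show ?thesis
    using \<open>K > 0\<close> mult_divide_eq_ennreal[of "ennreal K" N]
    by (simp add: ennreal_times_divide mult.commute[of "ennreal K"])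
qed

lemma lux_norm_mono_fun:
  assumes "mono E" "\<And>x. x \<in> space \<mu> \<Longrightarrow> g x \<le> h x"
  shows "lux_norm \<mu> E g \<le> lux_norm \<mu> E h"
proof -
  have "lux_norm \<mu> E g \<le> ennreal 1 * lux_norm \<mu> E h"
  proof (rule le_cmult_lux_norm)
    fix l :: real assume l: "l > 0" "(\<integral>\<^sup>+ x. E (h x / ennreal l) \<partial>\<mu>) \<le> 1"
    have "(\<integral>\<^sup>+ x. E (g x / ennreal l) \<partial>\<mu>) \<le> (\<integral>\<^sup>+ x. E (h x / ennreal l) \<partial>\<mu>)"
      by (intro nn_integral_mono monoD[OF assms(1)] divide_right_mono_ennreal assms(2))
    then show "lux_norm \<mu> E g \<le> ennreal (1 * l)"
      using l by (auto intro!: lux_norm_le)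
  qed simp
  then show ?thesis by simp
qed

lemma ennreal_mult_divide_mult:
  assumes "K > 0" "l > 0"
  shows "ennreal K * t / ennreal (K * l) = t / ennreal l"
proof -
  have "ennreal (K * l) = ennreal K * ennreal l"
    using assms by (simp add: ennreal_mult)
  then show ?thesis
    using assms by (cases t) (auto simp: ennreal_mult[symmetric] divide_ennreal ennreal_top_mult ennreal_mult_top ennreal_top_divide)
qed

lemma lux_norm_cmult_le:
  assumes "K > 0"
  shows "lux_norm \<mu> E (\<lambda>x. ennreal K * g x) \<le> ennreal K * lux_norm \<mu> E g"
  using assms
  by (intro le_cmult_lux_norm lux_norm_le) (auto simp: ennreal_mult_divide_mult)

text \<open>Every point has mass one, so an admissible l already forces
  \<open>E (g x / l) \<le> 1\<close> at each point, and the gauges can be compared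
  pointwise.\<close>

lemma lux_norm_count_space_le:
  assumes "s > 0" and s: "\<And>t. E t \<le> 1 \<Longrightarrow> F (ennreal s * t) \<le> E t"
  shows "lux_norm (count_space A) F g \<le> ennreal (1 / s) * lux_norm (count_space A) E g"
proof (rule le_cmult_lux_norm)
  fix l :: real assume l: "l > 0" "(\<integral>\<^sup>+ x. E (g x / ennreal l) \<partial>count_space A) \<le> 1"
  have "F (g x / ennreal (1 / s * l)) \<le> E (g x / ennreal l)" if "x \<in> A" for x
  proof -
    have "E (g x / ennreal l) \<le> 1"
      using nn_integral_ge_point[OF that, of "\<lambda>x. E (g x / ennreal l)"] l(2) by (rule order_trans)
    moreover have "g x / ennreal (1 / s * l) = ennreal s * (g x / ennreal l)"
      using ennreal_mult_divide_mult[of s "1 / s * l" "g x"] \<open>s > 0\<close> l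
      by (simp add: ennreal_times_divide)
    ultimately show ?thesis using s by metis
  qed
  then have "(\<integral>\<^sup>+ x. F (g x / ennreal (1 / s * l)) \<partial>count_space A)
      \<le> (\<integral>\<^sup>+ x. E (g x / ennreal l) \<partial>count_space A)"
    by (intro nn_integral_mono) simp
  then show "lux_norm (count_space A) F g \<le> ennreal (1 / s * l)"
    using l \<open>s > 0\<close> by (intro lux_norm_le) auto
qed (use assms in auto)

text \<open>A substitute for a supporting line at a. For t \<le> a the term a c suffices; for t > a
  the star shape gives \<open>E a \<le> (a / t) * E t\<close>, so a \<open>E t\<close> suffices.
  Adding both terms avoids the case distinction under the integral.\<close>

lemma star_gauge_jensen:
  assumes E: "star_gauge E" and a: "0 < a" and c: "ennreal c \<le> E (ennreal a)"
  shows "ennreal c * t \<le> ennreal a * (E t + ennreal c)"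
proof -
  consider "t = \<infinity>" | "t \<le> ennreal a" | r where "t = ennreal r" "a < r"
    using a by (cases t) (fastforce simp: ennreal_le_iff not_le)+
  then show ?thesis
  proof cases
    case 1 then show ?thesis using star_gauge_top[OF E] a by (simp add: ennreal_mult_top)
  next
    case 2
    have "ennreal c * t \<le> ennreal a * ennreal c"
      by (subst mult.commute[of "ennreal a"]) (intro mult_left_mono 2, simp)
    also have "\<dots> \<le> ennreal a * (E t + ennreal c)"
      by (intro mult_left_mono) auto
    finally show ?thesis .
  next
    case 3
    have "E (ennreal a) = E (ennreal (a / r) * ennreal r)"
      using a 3 by (simp flip: ennreal_mult)
    also have "\<dots> \<le> ennreal (a / r) * E t"
      unfolding 3(1) using a 3 by (intro star_gauge_scale[OF E]) auto
    finally have "ennreal c \<le> ennreal (a / r) * E t" using c by (rule order_trans[rotated])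
    then have "ennreal c * ennreal r \<le> ennreal (a / r) * E t * ennreal r"
      by (rule mult_right_mono) simp
    also have "\<dots> = ennreal (a / r * r) * E t"
      using a 3 by (subst ennreal_mult) (auto simp: mult_ac)
    also have "a / r * r = a" using a 3 by simp
    also have "ennreal a * E t \<le> ennreal a * (E t + ennreal c)"
      by (intro mult_left_mono) auto
    finally show ?thesis using 3 by simp
  qed
qed

text \<open>Integrating the pointwise bound turns the hypothesis into 2 a c m \<le> a (I + c m) with
  I the integral of \<open>E (t x)\<close>, that is c m \<le> I. The factor 2 pays for the summand c
  m that the pointwise bound gives away.\<close>

lemma star_gauge_jensen_integral:
  assumes E: "star_gauge E" and [measurable]: "t \<in> borel_measurable M"
    and m: "m = emeasure M (space M)" "0 < m" "m < \<infinity>"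
    and a: "0 \<le> a" "2 * m * ennreal a \<le> (\<integral>\<^sup>+ x. t x \<partial>M)"
  shows "E (ennreal a) * m \<le> (\<integral>\<^sup>+ x. E (t x) \<partial>M)"
proof (cases "a = 0")
  case True
  then show ?thesis using star_gauge_zero[OF E] by simp
next
  case False
  then have a0: "a > 0" using a by simp
  have [measurable]: "E \<in> borel_measurable borel" by (rule star_gauge_measurable[OF E])
  define I where "I = (\<integral>\<^sup>+ x. E (t x) \<partial>M)"
  \<comment> \<open>A finite c below \<open>E a\<close> is used because c m has to be cancelled. If
    \<open>E a\<close> is infinite, c runs through the natural numbers instead.\<close>
  have *: "ennreal c * m \<le> I" if c: "ennreal c \<le> E (ennreal a)" for c
  proof -
    have "ennreal a * (2 * (ennreal c * m)) = ennreal c * (2 * m * ennreal a)"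
      by (simp add: mult_ac)
    also have "\<dots> \<le> ennreal c * (\<integral>\<^sup>+ x. t x \<partial>M)"
      by (intro mult_left_mono a) auto
    also have "\<dots> = (\<integral>\<^sup>+ x. ennreal c * t x \<partial>M)"
      by (simp add: nn_integral_cmult)
    also have "\<dots> \<le> (\<integral>\<^sup>+ x. ennreal a * (E (t x) + ennreal c) \<partial>M)"
      by (intro nn_integral_mono star_gauge_jensen E a0 c)
    also have "\<dots> = ennreal a * (I + ennreal c * m)"
      by (simp add: nn_integral_cmult nn_integral_add I_def m)
    finally have "ennreal c * m + ennreal c * m \<le> I + ennreal c * m"
      using a0 by (subst (asm) ennreal_mult_le_mult_iff) (auto simp: mult_2)
    then show ?thesis
      using m by (auto simp: ennreal_add_left_cancel_le add.commute[of I] ennreal_mult_eq_top_iff)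
  qed
  show ?thesis
  proof (cases "E (ennreal a)")
    case (real r)
    then show ?thesis using *[of r] by (simp add: I_def)
  next
    case top
    have "of_nat n * m \<le> I" for n
      using *[of "real n"] top by (simp add: ennreal_of_nat_eq_real_of_nat)
    then have "(SUP n. of_nat n * m) \<le> I" by (intro SUP_least)
    then have "\<infinity> * m \<le> I"
      by (simp add: SUP_mult_right_ennreal[symmetric] ennreal_SUP_of_nat_eq_top)
    then show ?thesis using m top by (simp add: I_def ennreal_top_mult)
  qed
qed

text \<open>The indicator of the unit ball as a symmetric kernel: centre and point play equal roles
  under Fubini, and one measurability rule covers both.\<close>

definition near_ind :: "'a::euclidean_space \<Rightarrow> 'a \<Rightarrow> ennreal" where
  "near_ind x y = (if dist x y < 1 then 1 else 0)"

lemma near_ind_measurable [measurable]: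
  assumes [measurable]: "f \<in> M \<rightarrow>\<^sub>M borel" "g \<in> M \<rightarrow>\<^sub>M borel"
  shows "(\<lambda>z. near_ind (f z) (g z)) \<in> borel_measurable M"
  unfolding near_ind_def by measurable

definition unit_vol :: "'a::euclidean_space itself \<Rightarrow> ennreal" where
  "unit_vol _ = emeasure lborel (ball (0::'a) 1)"

lemma unit_vol_bounds: "0 < unit_vol TYPE('a::euclidean_space)" "unit_vol TYPE('a) < \<infinity>"
  unfolding unit_vol_def
  using emeasure_lborel_ball_finite by (auto simp: emeasure_ball)

lemma nn_integral_near_ind: "(\<integral>\<^sup>+ y. near_ind x y \<partial>lborel) = unit_vol TYPE('a)"
  for x :: "'a::euclidean_space"
proof -
  have "(\<integral>\<^sup>+ y. near_ind x y \<partial>lborel) = (\<integral>\<^sup>+ y. indicator (ball x 1) y \<partial>lborel)"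
    by (intro nn_integral_cong) (simp add: near_ind_def indicator_def)
  also have "\<dots> = unit_vol TYPE('a)"
    by (simp add: unit_vol_def emeasure_ball)
  finally show ?thesis .
qed

lemma near_ind_commute: "near_ind x y = near_ind y x"
  by (simp add: near_ind_def dist_commute)

text \<open>By symmetry of the kernel each y is counted once for every centre x in the unit ball
  around y.\<close>

lemma nn_integral_near_average:
  fixes h :: "'a::euclidean_space \<Rightarrow> ennreal"
  assumes [measurable]: "h \<in> borel_measurable borel"
  shows "(\<integral>\<^sup>+ x. \<integral>\<^sup>+ y. near_ind x y * h y \<partial>lborel \<partial>lborel) = unit_vol TYPE('a) * (\<integral>\<^sup>+ y. h y \<partial>lborel)"
proof -
  have "(\<integral>\<^sup>+ x. \<integral>\<^sup>+ y. near_ind x y * h y \<partial>lborel \<partial>lborel)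
      = (\<integral>\<^sup>+ y. \<integral>\<^sup>+ x. near_ind x y * h y \<partial>lborel \<partial>lborel)"
    by (rule lborel_pair.Fubini') measurable
  also have "\<dots> = (\<integral>\<^sup>+ y. unit_vol TYPE('a) * h y \<partial>lborel)"
  proof (rule nn_integral_cong)
    fix y :: 'a
    show "(\<integral>\<^sup>+ x. near_ind x y * h y \<partial>lborel) = unit_vol TYPE('a) * h y"
      by (subst nn_integral_multc) (auto simp: nn_integral_near_ind near_ind_commute[of _ y])
  qed
  also have "\<dots> = unit_vol TYPE('a) * (\<integral>\<^sup>+ y. h y \<partial>lborel)"
    by (rule nn_integral_cmult) simp
  finally show ?thesis .
qed

text \<open>Admissibility of l is inherited by larger numbers, so the norm is below c exactly when
  some rational l below c is admissible; this is a countable union of sets that are measurable by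
  Fubini.\<close>

lemma lux_norm_measurable:
  assumes E: "star_gauge E" and [measurable]: "case_prod v \<in> borel_measurable (borel \<Otimes>\<^sub>M borel)"
  shows "(\<lambda>\<eta>::'a::euclidean_space. lux_norm lborel E (\<lambda>x::'b::euclidean_space. v x \<eta>)) \<in> borel_measurable borel"
proof (rule borel_measurableI_less)
  fix c :: ennreal
  have [measurable]: "E \<in> borel_measurable borel" by (rule star_gauge_measurable[OF E])
  define A where "A l = {\<eta> \<in> space borel. (\<integral>\<^sup>+ x. E (v x \<eta> / ennreal l) \<partial>lborel) \<le> 1}" for l
  have [measurable]: "A l \<in> sets borel" for l
    unfolding A_def by measurable
  have "{\<eta> \<in> space borel. lux_norm lborel E (\<lambda>x. v x \<eta>) < c}
      = (\<Union>l \<in> {l \<in> \<rat>. 0 < l \<and> ennreal l < c}. A l)" (is "?L = ?R")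
  proof (intro equalityI subsetI)
    fix \<eta> assume "\<eta> \<in> ?R"
    then show "\<eta> \<in> ?L"
      by (auto simp: A_def intro: le_less_trans[OF lux_norm_le])
  next
    fix \<eta> assume "\<eta> \<in> ?L"
    then obtain l where l: "0 < l" "ennreal l < c" "(\<integral>\<^sup>+ x. E (v x \<eta> / ennreal l) \<partial>lborel) \<le> 1"
      by (auto simp: lux_norm_def Inf_less_iff)
    have "\<exists>q\<in>\<rat>. l < q \<and> ennreal q < c"
    proof (cases c)
      case (real r)
      then have "l < r" using l by (simp add: ennreal_less_iff)
      then obtain q where "q \<in> \<rat>" "l < q" "q < r" using Rats_dense_in_real by blast
      then show ?thesis using real l by (auto simp: ennreal_less_iff)
    next
      case top
      then show ?thesis using Rats_dense_in_real[of l "l + 1"] by auto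
    qed
    then obtain q where q: "q \<in> \<rat>" "l < q" "ennreal q < c" by blast
    have "(\<integral>\<^sup>+ x. E (v x \<eta> / ennreal q) \<partial>lborel) \<le> (\<integral>\<^sup>+ x. E (v x \<eta> / ennreal l) \<partial>lborel)"
      using q l by (intro nn_integral_mono monoD[OF star_gauge_mono[OF E]] divide_ennreal_antimono) auto
    then show "\<eta> \<in> ?R" using q l by (auto simp: A_def)
  qed
  moreover have "countable {l \<in> \<rat>. 0 < l \<and> ennreal l < c}"
    by (rule countable_subset[OF _ countable_rat]) auto
  ultimately show "{\<eta> \<in> space borel. lux_norm lborel E (\<lambda>x. v x \<eta>) < c} \<in> sets borel"
    by (auto intro!: sets.countable_UN'')
qed

section \<open>Averaging over unit balls\<close>

text \<open>The function \<kappa> is half the mean of \<open>N\<close> over the unit ball; the half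
  absorbs the factor 2 of the weak Jensen inequality. Jensen on one ball gives the pointwise bound,
  and integrating it over all centres gives the second claim.\<close>

lemma star_gauge_average:
  fixes N :: "'a::euclidean_space \<Rightarrow> ennreal"
  assumes E: "star_gauge E" and [measurable]: "N \<in> borel_measurable borel"
    and le1: "(\<integral>\<^sup>+ \<xi>. E (N \<xi>) \<partial>lborel) \<le> 1"
    and \<kappa>: "\<And>\<xi>. \<kappa> \<xi> = (\<integral>\<^sup>+ \<eta>. near_ind \<xi> \<eta> * N \<eta> \<partial>lborel) / (2 * unit_vol TYPE('a))"
  shows "E (\<kappa> \<xi>) \<le> 1 / unit_vol TYPE('a)" "(\<integral>\<^sup>+ \<xi>. E (\<kappa> \<xi>) \<partial>lborel) \<le> 1"
proof -
  let ?m = "unit_vol TYPE('a)"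
  note m = unit_vol_bounds[where 'a='a]
  have m2: "2 * ?m \<noteq> 0" "2 * ?m \<noteq> \<infinity>" using m by (auto simp: ennreal_mult_eq_top_iff)
  have [measurable]: "E \<in> borel_measurable borel" by (rule star_gauge_measurable[OF E])
  have jensen: "E (ennreal a) * ?m \<le> (\<integral>\<^sup>+ \<eta>. near_ind \<xi> \<eta> * E (N \<eta>) \<partial>lborel)"
    if "a \<ge> 0" "2 * ?m * ennreal a \<le> (\<integral>\<^sup>+ \<eta>. near_ind \<xi> \<eta> * N \<eta> \<partial>lborel)" for a \<xi>
  proof -
    let ?\<nu> = "density lborel (near_ind \<xi>)"
    have "E (ennreal a) * ?m \<le> (\<integral>\<^sup>+ \<eta>. E (N \<eta>) \<partial>?\<nu>)"
    proof (rule star_gauge_jensen_integral[OF E])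
      show "?m = emeasure ?\<nu> (space ?\<nu>)"
        by (simp add: emeasure_density nn_integral_near_ind)
    qed (use that m in \<open>auto simp: nn_integral_density\<close>)
    then show ?thesis by (simp add: nn_integral_density)
  qed
  have ball_le: "(\<integral>\<^sup>+ \<eta>. near_ind \<xi> \<eta> * E (N \<eta>) \<partial>lborel) \<le> 1" for \<xi>
    by (rule order_trans[OF nn_integral_mono le1]) (simp add: near_ind_def)
  have to_m: "a \<le> 1 / ?m" if "a * ?m \<le> 1" for a
  proof -
    have "a = a * ?m / ?m" using m by (simp add: mult_divide_eq_ennreal)
    also have "\<dots> \<le> 1 / ?m" using that by (rule divide_right_mono_ennreal)
    finally show ?thesis .
  qed
  \<comment> \<open>An infinite mean would make Jensen applicable to every real a, so
    \<open>E\<close> would stay bounded on the whole half-line, against the growth clause.\<close>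
  have fin: "\<kappa> \<xi> \<noteq> \<infinity>" for \<xi>
  proof
    assume "\<kappa> \<xi> = \<infinity>"
    then have inf: "(\<integral>\<^sup>+ \<eta>. near_ind \<xi> \<eta> * N \<eta> \<partial>lborel) = \<infinity>"
      using m2 by (simp add: \<kappa> ennreal_divide_eq_top_iff)
    have "E (ennreal a) \<le> 1 / ?m" if "a \<ge> 0" for a
      using jensen[OF that, of \<xi>] ball_le[of \<xi>] inf by (intro to_m) (auto intro: order_trans)
    moreover have "1 / ?m < \<infinity>"
      using m by (simp add: less_top[symmetric] ennreal_divide_eq_top_iff)
    ultimately obtain T where T: "T < \<infinity>" "\<And>a. a \<ge> 0 \<Longrightarrow> ennreal a \<le> T"
      using star_gauge_bounded[OF E] by metis
    from T(2)[of "enn2real T + 1"] T(1) show False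
      by (cases T) (auto simp: ennreal_le_iff)
  qed
  have main: "E (\<kappa> \<xi>) * ?m \<le> (\<integral>\<^sup>+ \<eta>. near_ind \<xi> \<eta> * E (N \<eta>) \<partial>lborel)" for \<xi>
  proof -
    have eq: "\<kappa> \<xi> = ennreal (enn2real (\<kappa> \<xi>))" using fin by (simp add: less_top)
    have "2 * ?m * \<kappa> \<xi> = (\<integral>\<^sup>+ \<eta>. near_ind \<xi> \<eta> * N \<eta> \<partial>lborel)"
      using m2 mult_divide_eq_ennreal[of "2 * ?m"] by (simp add: \<kappa> ennreal_times_divide mult.commute[of "2 * ?m"])
    then show ?thesis using jensen[of "enn2real (\<kappa> \<xi>)" \<xi>] eq by simp
  qed
  show "E (\<kappa> \<xi>) \<le> 1 / ?m"
    by (rule to_m) (rule order_trans[OF main ball_le])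
  have [measurable]: "\<kappa> \<in> borel_measurable borel"
    unfolding \<kappa>[abs_def] by measurable
  have "(\<integral>\<^sup>+ \<xi>. E (\<kappa> \<xi>) \<partial>lborel) * ?m = (\<integral>\<^sup>+ \<xi>. E (\<kappa> \<xi>) * ?m \<partial>lborel)"
    by (simp add: nn_integral_multc)
  also have "\<dots> \<le> (\<integral>\<^sup>+ \<xi>. \<integral>\<^sup>+ \<eta>. near_ind \<xi> \<eta> * E (N \<eta>) \<partial>lborel \<partial>lborel)"
    by (intro nn_integral_mono main)
  also have "\<dots> = ?m * (\<integral>\<^sup>+ \<eta>. E (N \<eta>) \<partial>lborel)"
    by (rule nn_integral_near_average) simp
  also have "\<dots> \<le> ?m * 1" by (intro mult_left_mono le1) simp
  finally have "(\<integral>\<^sup>+ \<xi>. E (\<kappa> \<xi>) \<partial>lborel) * ?m / ?m \<le> ?m / ?m"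
    by (intro divide_right_mono_ennreal) simp
  then show "(\<integral>\<^sup>+ \<xi>. E (\<kappa> \<xi>) \<partial>lborel) \<le> 1"
    using m by (simp add: mult_divide_eq_ennreal)
qed

lemma lux_norm_zero:
  assumes "E 0 = 0" "\<And>x. x \<in> space M \<Longrightarrow> g x = 0"
  shows "lux_norm M E g = 0"
proof -
  have "lux_norm M E g \<le> 0 + ennreal l" if "l > 0" for l
  proof -
    have "(\<integral>\<^sup>+ x. E (g x / ennreal l) \<partial>M) = (\<integral>\<^sup>+ x. 0 \<partial>M)"
      using assms by (intro nn_integral_cong) simp
    then show ?thesis using that by (auto intro: lux_norm_le)
  qed
  then have "lux_norm M E g \<le> 0" by (rule ennreal_le_epsilon)
  then show ?thesis by simp
qed

text \<open>The strict inequality provides an admissible number below l even if the norm is not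
  attained.\<close>

lemma lux_norm_admissible:
  assumes E: "star_gauge E" and "lux_norm M E g < ennreal l"
  shows "(\<integral>\<^sup>+ x. E (g x / ennreal l) \<partial>M) \<le> 1"
proof -
  obtain k where k: "0 < k" "ennreal k < ennreal l" "(\<integral>\<^sup>+ x. E (g x / ennreal k) \<partial>M) \<le> 1"
    using assms(2) by (auto simp: lux_norm_def Inf_less_iff)
  then have "k < l" by (simp add: ennreal_less_iff)
  have "(\<integral>\<^sup>+ x. E (g x / ennreal l) \<partial>M) \<le> (\<integral>\<^sup>+ x. E (g x / ennreal k) \<partial>M)"
    using k \<open>k < l\<close> by (intro nn_integral_mono monoD[OF star_gauge_mono[OF E]] divide_ennreal_antimono) auto
  then show ?thesis using k(3) by (rule order_trans)
qed

text \<open>If the norm is 0, every positive number is admissible, and the star shape gives an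
  integral of \<open>E (k * g x)\<close> of at most s for all small s. Hence
  \<open>E (k * g x) = 0\<close> almost everywhere for all k at once, so all multiples of
  \<open>g x\<close> lie below one finite T.\<close>

lemma lux_norm_zero_imp_AE:
  assumes E: "star_gauge E" and [measurable]: "g \<in> borel_measurable M"
    and zero: "lux_norm M E g = 0"
  shows "AE x in M. g x = 0"
proof -
  have [measurable]: "E \<in> borel_measurable borel" by (rule star_gauge_measurable[OF E])
  have int: "(\<integral>\<^sup>+ x. E (ennreal k * g x) \<partial>M) \<le> ennreal s" if k: "k > 0" and s: "0 < s" "s \<le> 1" for k s
  proof -
    have scale: "ennreal k * g x = ennreal s * (g x / ennreal (s / k))" for x
    proof -
      have "g x / ennreal (s / k) = g x * ennreal (k / s)"
        using k s by (simp add: divide_ennreal_def inverse_ennreal)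
      moreover have "ennreal s * ennreal (k / s) = ennreal k"
        using k s by (simp flip: ennreal_mult)
      ultimately have "ennreal k * g x = ennreal s * ennreal (k / s) * g x" by simp
      also have "\<dots> = ennreal s * (g x * ennreal (k / s))" by (simp add: mult_ac)
      finally show ?thesis using \<open>g x / ennreal (s / k) = g x * ennreal (k / s)\<close> by simp
    qed
    have "(\<integral>\<^sup>+ x. E (ennreal k * g x) \<partial>M) \<le> (\<integral>\<^sup>+ x. ennreal s * E (g x / ennreal (s / k)) \<partial>M)"
      unfolding scale using s by (intro nn_integral_mono star_gauge_scale[OF E]) simp
    also have "\<dots> = ennreal s * (\<integral>\<^sup>+ x. E (g x / ennreal (s / k)) \<partial>M)"
      by (rule nn_integral_cmult) simp
    also have "\<dots> \<le> ennreal s * 1"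
      using k s by (intro mult_left_mono lux_norm_admissible[OF E]) (simp_all add: zero)
    finally show ?thesis by simp
  qed
  have "AE x in M. E (ennreal k * g x) = 0" if k: "k > 0" for k
  proof -
    have "(\<integral>\<^sup>+ x. E (ennreal k * g x) \<partial>M) \<le> 0"
    proof (rule ennreal_le_epsilon)
      fix e :: real assume "e > 0"
      then have "(\<integral>\<^sup>+ x. E (ennreal k * g x) \<partial>M) \<le> ennreal (min e 1)" by (intro int k) auto
      also have "\<dots> \<le> ennreal e" by (intro ennreal_leI) simp
      finally show "(\<integral>\<^sup>+ x. E (ennreal k * g x) \<partial>M) \<le> 0 + ennreal e" by simp
    qed
    then have "(\<integral>\<^sup>+ x. E (ennreal k * g x) \<partial>M) = 0" by simp
    then show ?thesis by (subst (asm) nn_integral_0_iff_AE) auto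
  qed
  then have ae: "AE x in M. \<forall>n. E (ennreal (real (Suc n)) * g x) = 0"
    by (simp add: AE_all_countable del: of_nat_Suc)
  obtain T where T: "T < \<infinity>" "\<And>t. E t \<le> 0 \<Longrightarrow> t \<le> T"
    using star_gauge_bounded[OF E, of 0] by auto
  from ae show ?thesis
  proof eventually_elim
    case (elim x)
    have le: "of_nat n * g x \<le> T" for n
    proof (cases n)
      case (Suc k)
      then have "E (of_nat n * g x) = 0"
        using elim(1)[rule_format, of k] by (simp add: ennreal_of_nat_eq_real_of_nat)
      then show ?thesis by (intro T(2)) simp
    qed simp
    have "(SUP n. of_nat n * g x) \<le> T" by (intro SUP_least le)
    then have "\<infinity> * g x \<le> T"
      by (simp add: SUP_mult_right_ennreal[symmetric] ennreal_SUP_of_nat_eq_top)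
    then show ?case using T(1) by (auto simp: ennreal_top_mult top_unique split: if_splits)
  qed
qed

context
  fixes E F :: "ennreal \<Rightarrow> ennreal" and v :: "'a::euclidean_space \<Rightarrow> 'b::euclidean_space \<Rightarrow> real"
    and C s :: real
  assumes E: "star_gauge E" and F0: "F 0 = 0"
    and meas: "case_prod v \<in> borel_measurable (borel \<Otimes>\<^sub>M borel)"
    and nonneg: "\<And>x \<xi>. 0 \<le> v x \<xi>"
    and C: "C > 0" and s: "s > 0"
    and mean: "\<And>x \<xi>. ennreal (v x \<xi>) \<le> ennreal C *
        (\<integral>\<^sup>+ \<eta>. near_ind \<xi> \<eta> * (\<integral>\<^sup>+ y. near_ind x y * ennreal (v y \<eta>) \<partial>lborel) \<partial>lborel)"
    and compare: "\<And>t. E t \<le> 1 / unit_vol TYPE('a) \<Longrightarrow> F (ennreal s * t) \<le> E t"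
begin

text \<open>With \<open>N \<eta>\<close> the inner norm at \<eta>, write v = q t, where q is
  proportional to \<open>N\<close> and each slice \<open>t _ \<eta>\<close> has
  \<open>E\<close>-integral at most 1. Jensen is applied to t for the measure with density q on the
  product of the unit balls around x and \<xi>, so that the weight q on the slices also bounds the
  resulting integrals of \<open>E\<close>.\<close>

lemma inner_lux_norm_le_average:
  "lux_norm lborel F (\<lambda>x. ennreal (v x \<xi>)) \<le> ennreal (4 * C * measure lborel (ball (0::'a) 1) / s) *
     (\<integral>\<^sup>+ \<eta>. near_ind \<xi> \<eta> * lux_norm lborel E (\<lambda>x. ennreal (v x \<eta>)) \<partial>lborel)"
proof -
  note meas [measurable]
  have [measurable]: "E \<in> borel_measurable borel" by (rule star_gauge_measurable[OF E])
  define N where "N \<eta> = lux_norm lborel E (\<lambda>x. ennreal (v x \<eta>))" for \<eta>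
  have [measurable]: "N \<in> borel_measurable borel"
    unfolding N_def[abs_def] by (rule lux_norm_measurable[OF E]) measurable
  define \<kappa> where "\<kappa> = (\<integral>\<^sup>+ \<eta>. near_ind \<xi> \<eta> * N \<eta> \<partial>lborel)"
  define \<mu> where "\<mu> = measure lborel (ball (0::'a) 1)"
  have \<mu>: "unit_vol TYPE('a) = ennreal \<mu>" "\<mu> > 0"
    unfolding unit_vol_def \<mu>_def using unit_vol_bounds[where 'a='a]
    by (auto simp: unit_vol_def emeasure_eq_ennreal_measure less_top)
  have vm: "(\<lambda>y. v y \<eta>) \<in> borel_measurable borel" for \<eta> by measurable
  consider "\<kappa> = \<infinity>" | "\<kappa> = 0" | k where "\<kappa> = ennreal k" "k > 0"
    by (cases \<kappa>) force+
  then have "lux_norm lborel F (\<lambda>x. ennreal (v x \<xi>)) \<le> ennreal (4 * C * \<mu> / s) * \<kappa>"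
  proof cases
    case 1
    then show ?thesis using C s \<mu> by (simp add: ennreal_mult_top)
  next
    \<comment> \<open>A vanishing average means that \<open>v _ \<eta>\<close> is null almost
      everywhere for almost every \<eta> near \<xi>; the mean value inequality then upgrades this to
      \<open>v x \<xi> = 0\<close> at every x.\<close>
    case 2
    have ae: "AE \<eta> in lborel. near_ind \<xi> \<eta> * N \<eta> = 0"
      using 2 unfolding \<kappa>_def by (subst (asm) nn_integral_0_iff_AE) auto
    have "v x \<xi> = 0" for x
    proof -
      have "AE \<eta> in lborel. near_ind \<xi> \<eta> * (\<integral>\<^sup>+ y. near_ind x y * ennreal (v y \<eta>) \<partial>lborel) = 0"
        using ae
      proof eventually_elim
        case (elim \<eta>)
        have "(\<integral>\<^sup>+ y. near_ind x y * ennreal (v y \<eta>) \<partial>lborel) = 0" if "N \<eta> = 0"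
        proof -
          have "AE y in lborel. ennreal (v y \<eta>) = 0"
            using that by (intro lux_norm_zero_imp_AE[OF E]) (simp_all add: N_def vm)
          then have "AE y in lborel. near_ind x y * ennreal (v y \<eta>) = 0" by eventually_elim simp
          then show ?thesis by (subst nn_integral_0_iff_AE) (use vm in auto)
        qed
        then show ?case using elim by auto
      qed
      then have "(\<integral>\<^sup>+ \<eta>. near_ind \<xi> \<eta> * (\<integral>\<^sup>+ y. near_ind x y * ennreal (v y \<eta>) \<partial>lborel) \<partial>lborel) = 0"
        by (subst nn_integral_0_iff_AE) auto
      then show ?thesis using mean[of x \<xi>] nonneg[of x \<xi>] by (simp add: ennreal_eq_0_iff)
    qed
    then show ?thesis by (simp add: lux_norm_zero F0)
  next
    case 3
    \<comment> \<open>Doubling puts q strictly above \<open>N\<close> wherever \<open>N\<close> is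
      positive and finite, which makes q an admissible number there.\<close>
    define q where "q \<eta> = 2 * N \<eta>" for \<eta>
    define t where "t y \<eta> = ennreal (v y \<eta>) / q \<eta>" for y \<eta>
    have [measurable]: "q \<in> borel_measurable borel" unfolding q_def[abs_def] by measurable
    have [measurable]: "case_prod t \<in> borel_measurable (borel \<Otimes>\<^sub>M borel)"
      unfolding t_def[abs_def] by measurable
    define Q where "Q = ennreal (2 * k)"
    have q_int: "(\<integral>\<^sup>+ \<eta>. near_ind \<xi> \<eta> * q \<eta> \<partial>lborel) = Q"
    proof -
      have "(\<integral>\<^sup>+ \<eta>. near_ind \<xi> \<eta> * q \<eta> \<partial>lborel) = (\<integral>\<^sup>+ \<eta>. 2 * (near_ind \<xi> \<eta> * N \<eta>) \<partial>lborel)"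
        by (simp add: q_def mult_ac)
      also have "\<dots> = 2 * \<kappa>" unfolding \<kappa>_def by (rule nn_integral_cmult) simp
      finally show ?thesis using 3 by (simp add: Q_def ennreal_mult)
    qed
    have N_fin: "AE \<eta> in lborel. near_ind \<xi> \<eta> * N \<eta> \<noteq> \<infinity>"
      using 3 by (intro nn_integral_PInf_AE) (auto simp: \<kappa>_def[symmetric])
    have E_le: "q \<eta> * (\<integral>\<^sup>+ y. E (t y \<eta>) \<partial>lborel) \<le> q \<eta>" for \<eta>
    proof -
      consider "N \<eta> = 0" | "N \<eta> = \<infinity>" | r where "N \<eta> = ennreal r" "r > 0" by (cases "N \<eta>") force+
      then show ?thesis
      proof cases
        case 3
        then have "q \<eta> = ennreal (2 * r)" by (simp add: q_def ennreal_mult)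
        then have "(\<integral>\<^sup>+ y. E (t y \<eta>) \<partial>lborel) \<le> 1"
          unfolding t_def using 3
          by (auto intro!: lux_norm_admissible[OF E] simp: N_def ennreal_less_iff)
        then show ?thesis using mult_left_mono[of _ 1 "q \<eta>"] by simp
      qed (auto simp: q_def t_def star_gauge_zero[OF E] ennreal_mult_top)
    qed
    \<comment> \<open>The identity v = q t breaks down where \<open>N\<close> is 0 or \<infinity>.
      In the first case the slice is null almost everywhere, the second concerns only a null set of
      \<eta> near \<xi>; hence an inequality for almost every \<eta>.\<close>
    have le_qt: "AE \<eta> in lborel. near_ind \<xi> \<eta> * (\<integral>\<^sup>+ y. near_ind x y * ennreal (v y \<eta>) \<partial>lborel)
        \<le> near_ind \<xi> \<eta> * (\<integral>\<^sup>+ y. near_ind x y * (q \<eta> * t y \<eta>) \<partial>lborel)" for x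
      using N_fin
    proof eventually_elim
      case (elim \<eta>)
      consider "near_ind \<xi> \<eta> = 0" | "N \<eta> = 0" | r where "N \<eta> = ennreal r" "r > 0"
        using elim by (cases "N \<eta>") (force simp: near_ind_def split: if_splits)+
      then show ?case
      proof cases
        case 2
        have "AE y in lborel. ennreal (v y \<eta>) = 0"
          using 2 by (intro lux_norm_zero_imp_AE[OF E]) (simp_all add: N_def vm)
        then have "AE y in lborel. near_ind x y * ennreal (v y \<eta>) = 0" by eventually_elim simp
        then have "(\<integral>\<^sup>+ y. near_ind x y * ennreal (v y \<eta>) \<partial>lborel) = 0"
          by (subst nn_integral_0_iff_AE) (use vm in auto)
        then show ?thesis by simp
      next
        case 3
        then have "q \<eta> = ennreal (2 * r)" by (simp add: q_def ennreal_mult)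
        then have "q \<eta> * t y \<eta> = ennreal (v y \<eta>)" for y
          using 3 nonneg by (simp add: t_def divide_ennreal flip: ennreal_mult)
        then show ?thesis by simp
      qed simp
    qed
    \<comment> \<open>The Jensen measure has mass \<mu> Q = 2 \<mu> k, so 4 C \<mu> k is C times
      twice that mass, exactly what the hypothesis of the Jensen inequality asks for.\<close>
    define a where "a x = v x \<xi> / (4 * C * \<mu> * k)" for x
    have a: "a x \<ge> 0" for x using nonneg C \<mu> 3 by (simp add: a_def)
    define W where "W x = (\<integral>\<^sup>+ \<eta>. near_ind \<xi> \<eta> * (q \<eta> * (\<integral>\<^sup>+ y. near_ind x y * E (t y \<eta>) \<partial>lborel)) \<partial>lborel)" for x
    have jensen: "E (ennreal (a x)) * (ennreal \<mu> * Q) \<le> W x" for x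
    proof -
      let ?w = "\<lambda>z. near_ind \<xi> (snd z) * q (snd z) * near_ind x (fst z)"
      let ?\<nu> = "density (lborel \<Otimes>\<^sub>M lborel) ?w"
      have split: "(\<integral>\<^sup>+ z. g (fst z) (snd z) \<partial>?\<nu>) = (\<integral>\<^sup>+ \<eta>. near_ind \<xi> \<eta> * (q \<eta> * (\<integral>\<^sup>+ y. near_ind x y * g y \<eta> \<partial>lborel)) \<partial>lborel)"
        if [measurable]: "case_prod g \<in> borel_measurable (borel \<Otimes>\<^sub>M borel)" for g
      proof -
        have "(\<integral>\<^sup>+ z. g (fst z) (snd z) \<partial>?\<nu>) = (\<integral>\<^sup>+ z. ?w z * g (fst z) (snd z) \<partial>(lborel \<Otimes>\<^sub>M lborel))"
          by (rule nn_integral_density) measurable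
        also have "\<dots> = (\<integral>\<^sup>+ \<eta>. \<integral>\<^sup>+ y. ?w (y, \<eta>) * g y \<eta> \<partial>lborel \<partial>lborel)"
          by (subst lborel_pair.nn_integral_snd[symmetric]) auto
        also have "\<dots> = (\<integral>\<^sup>+ \<eta>. near_ind \<xi> \<eta> * (q \<eta> * (\<integral>\<^sup>+ y. near_ind x y * g y \<eta> \<partial>lborel)) \<partial>lborel)"
        proof (rule nn_integral_cong)
          fix \<eta>
          have [measurable]: "(\<lambda>y. g y \<eta>) \<in> borel_measurable borel" by measurable
          show "(\<integral>\<^sup>+ y. ?w (y, \<eta>) * g y \<eta> \<partial>lborel) = near_ind \<xi> \<eta> * (q \<eta> * (\<integral>\<^sup>+ y. near_ind x y * g y \<eta> \<partial>lborel))"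
            by (simp add: mult.assoc nn_integral_cmult)
        qed
        finally show ?thesis .
      qed
      have "E (ennreal (a x)) * (ennreal \<mu> * Q) \<le> (\<integral>\<^sup>+ z. E (t (fst z) (snd z)) \<partial>?\<nu>)"
      proof (rule star_gauge_jensen_integral[OF E])
        have "emeasure ?\<nu> (space ?\<nu>) = (\<integral>\<^sup>+ z. 1 \<partial>?\<nu>)" by (simp add: nn_integral_const)
        also have "\<dots> = (\<integral>\<^sup>+ \<eta>. near_ind \<xi> \<eta> * q \<eta> * ennreal \<mu> \<partial>lborel)"
          by (subst split) (auto simp: nn_integral_near_ind \<mu> mult_ac)
        also have "\<dots> = Q * ennreal \<mu>"
          by (simp add: nn_integral_multc q_int)
        finally show "ennreal \<mu> * Q = emeasure ?\<nu> (space ?\<nu>)" by (simp add: mult.commute)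
        show "0 < ennreal \<mu> * Q" "ennreal \<mu> * Q < \<infinity>"
          using \<mu> 3 by (auto simp: Q_def simp flip: ennreal_mult)
        have "ennreal C * (2 * (ennreal \<mu> * Q) * ennreal (a x)) = ennreal (v x \<xi>)"
          using C \<mu> 3 nonneg[of x \<xi>] a[of x]
          by (simp add: Q_def a_def ennreal_mult[symmetric] flip: ennreal_numeral)
        also have "\<dots> \<le> ennreal C * (\<integral>\<^sup>+ \<eta>. near_ind \<xi> \<eta> * (\<integral>\<^sup>+ y. near_ind x y * ennreal (v y \<eta>) \<partial>lborel) \<partial>lborel)"
          by (rule mean)
        also have "\<dots> \<le> ennreal C * (\<integral>\<^sup>+ \<eta>. near_ind \<xi> \<eta> * (\<integral>\<^sup>+ y. near_ind x y * (q \<eta> * t y \<eta>) \<partial>lborel) \<partial>lborel)"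
          by (intro mult_left_mono nn_integral_mono_AE le_qt) simp
        also have "(\<integral>\<^sup>+ \<eta>. near_ind \<xi> \<eta> * (\<integral>\<^sup>+ y. near_ind x y * (q \<eta> * t y \<eta>) \<partial>lborel) \<partial>lborel)
            = (\<integral>\<^sup>+ \<eta>. near_ind \<xi> \<eta> * (q \<eta> * (\<integral>\<^sup>+ y. near_ind x y * t y \<eta> \<partial>lborel)) \<partial>lborel)"
          by (simp add: nn_integral_cmult mult.left_commute[of _ "q _"])
        also have "\<dots> = (\<integral>\<^sup>+ z. t (fst z) (snd z) \<partial>?\<nu>)" by (subst split) auto
        finally show "2 * (ennreal \<mu> * Q) * ennreal (a x) \<le> (\<integral>\<^sup>+ z. t (fst z) (snd z) \<partial>?\<nu>)"
          using C by (simp add: ennreal_mult_le_mult_iff)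
      qed (use a in auto)
      then show ?thesis by (subst (asm) split) (auto simp: W_def)
    qed
    have cancel: "b \<le> c" if "b * (ennreal \<mu> * Q) \<le> c * (ennreal \<mu> * Q)" for b c
      using that \<mu> 3 by (auto simp: Q_def ennreal_mult_le_mult_iff mult.commute[of _ "_ * _"] ennreal_mult_eq_top_iff)
    \<comment> \<open>Extending the slice integrals from the unit ball to the whole space costs
      nothing, since they are at most 1. Dividing by \<mu> Q yields the pointwise bound at which
      \<open>compare\<close> applies.\<close>
    have W_le: "W x \<le> Q" for x
    proof -
      have "W x \<le> (\<integral>\<^sup>+ \<eta>. near_ind \<xi> \<eta> * (q \<eta> * (\<integral>\<^sup>+ y. E (t y \<eta>) \<partial>lborel)) \<partial>lborel)"
        unfolding W_def by (intro nn_integral_mono mult_left_mono) (auto simp: near_ind_def)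
      also have "\<dots> \<le> (\<integral>\<^sup>+ \<eta>. near_ind \<xi> \<eta> * q \<eta> \<partial>lborel)"
        by (intro nn_integral_mono mult_left_mono E_le) auto
      finally show ?thesis by (simp add: q_int)
    qed
    have "E (ennreal (a x)) \<le> 1 / unit_vol TYPE('a)" for x
    proof (rule cancel)
      have "1 / ennreal \<mu> * (ennreal \<mu> * Q) = Q"
        using \<mu> by (simp add: divide_ennreal_def inverse_ennreal mult.assoc[symmetric] flip: ennreal_mult)
      then show "E (ennreal (a x)) * (ennreal \<mu> * Q) \<le> 1 / unit_vol TYPE('a) * (ennreal \<mu> * Q)"
        using jensen[of x] W_le[of x] \<mu> by simp
    qed
    then have F_le: "F (ennreal s * ennreal (a x)) \<le> E (ennreal (a x))" for x by (rule compare)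
    have "(\<integral>\<^sup>+ x. E (ennreal (a x)) \<partial>lborel) \<le> 1"
    proof (rule cancel)
      have [measurable]: "a \<in> borel_measurable borel" unfolding a_def[abs_def] by measurable
      have [measurable]: "(\<lambda>x. near_ind x y * E (t y \<eta>)) \<in> borel_measurable borel" for y \<eta> by measurable
      have "(\<integral>\<^sup>+ x. E (ennreal (a x)) \<partial>lborel) * (ennreal \<mu> * Q) = (\<integral>\<^sup>+ x. E (ennreal (a x)) * (ennreal \<mu> * Q) \<partial>lborel)"
        by (simp add: nn_integral_multc)
      also have "\<dots> \<le> (\<integral>\<^sup>+ x. W x \<partial>lborel)" by (intro nn_integral_mono jensen)
      also have "\<dots> = (\<integral>\<^sup>+ \<eta>. \<integral>\<^sup>+ x. near_ind \<xi> \<eta> * (q \<eta> * (\<integral>\<^sup>+ y. near_ind x y * E (t y \<eta>) \<partial>lborel)) \<partial>lborel \<partial>lborel)"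
        unfolding W_def by (rule lborel_pair.Fubini') measurable
      also have "\<dots> = (\<integral>\<^sup>+ \<eta>. ennreal \<mu> * (near_ind \<xi> \<eta> * (q \<eta> * (\<integral>\<^sup>+ y. E (t y \<eta>) \<partial>lborel))) \<partial>lborel)"
      proof (rule nn_integral_cong)
        fix \<eta>
        have [measurable]: "(\<lambda>y. E (t y \<eta>)) \<in> borel_measurable borel" by measurable
        show "(\<integral>\<^sup>+ x. near_ind \<xi> \<eta> * (q \<eta> * (\<integral>\<^sup>+ y. near_ind x y * E (t y \<eta>) \<partial>lborel)) \<partial>lborel)
            = ennreal \<mu> * (near_ind \<xi> \<eta> * (q \<eta> * (\<integral>\<^sup>+ y. E (t y \<eta>) \<partial>lborel)))"
          by (simp add: nn_integral_cmult nn_integral_near_average \<mu> mult_ac)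
      qed
      also have "\<dots> \<le> (\<integral>\<^sup>+ \<eta>. ennreal \<mu> * (near_ind \<xi> \<eta> * q \<eta>) \<partial>lborel)"
        by (intro nn_integral_mono mult_left_mono E_le) auto
      also have "\<dots> = ennreal \<mu> * Q" by (simp add: nn_integral_cmult q_int)
      finally show "(\<integral>\<^sup>+ x. E (ennreal (a x)) \<partial>lborel) * (ennreal \<mu> * Q) \<le> 1 * (ennreal \<mu> * Q)" by simp
    qed
    then have F1: "(\<integral>\<^sup>+ x. F (ennreal s * ennreal (a x)) \<partial>lborel) \<le> 1"
      by (rule order_trans[OF nn_integral_mono[OF F_le]])
    have "lux_norm lborel F (\<lambda>x. ennreal (v x \<xi>)) \<le> ennreal (4 * C * \<mu> / s * k)"
    proof (rule lux_norm_le)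
      have "ennreal s * ennreal (a x) = ennreal (v x \<xi>) / ennreal (4 * C * \<mu> / s * k)" for x
        using s C \<mu> 3 nonneg[of x \<xi>] a[of x]
        by (simp add: a_def divide_ennreal field_simps flip: ennreal_mult)
      then show "(\<integral>\<^sup>+ x. F (ennreal (v x \<xi>) / ennreal (4 * C * \<mu> / s * k)) \<partial>lborel) \<le> 1"
        using F1 by simp
    qed (use s C \<mu> 3 in auto)
    also have "\<dots> = ennreal (4 * C * \<mu> / s) * \<kappa>"
      using s C \<mu> 3 by (subst ennreal_mult) auto
    finally show ?thesis .
  qed
  then show ?thesis by (simp add: \<kappa>_def N_def \<mu>_def)
qed

end

section \<open>Mixed norms and change of exponent\<close>

text \<open>The inner estimate reduces the left side to the outer norm of unit-ball averages of the
  inner \<open>E1\<close> norms. A second Jensen argument, now in the outer variable alone, removes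
  the average. Each of the two stages contributes one factor of the constant.\<close>

lemma mixed_lux_norm_le:
  fixes v :: "'a::euclidean_space \<Rightarrow> 'b::euclidean_space \<Rightarrow> real"
  assumes E1: "star_gauge E1" and F1: "F1 0 = 0" and E2: "star_gauge E2" and F2: "mono F2"
    and meas: "case_prod v \<in> borel_measurable (borel \<Otimes>\<^sub>M borel)"
    and nonneg: "\<And>x \<xi>. 0 \<le> v x \<xi>"
    and C: "C > 0" and s1: "s1 > 0" and s2: "s2 > 0"
    and mean: "\<And>x \<xi>. ennreal (v x \<xi>) \<le> ennreal C *
        (\<integral>\<^sup>+ \<eta>. near_ind \<xi> \<eta> * (\<integral>\<^sup>+ y. near_ind x y * ennreal (v y \<eta>) \<partial>lborel) \<partial>lborel)"
    and compare1: "\<And>t. E1 t \<le> 1 / unit_vol TYPE('a) \<Longrightarrow> F1 (ennreal s1 * t) \<le> E1 t"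
    and compare2: "\<And>t. E2 t \<le> 1 / unit_vol TYPE('b) \<Longrightarrow> F2 (ennreal s2 * t) \<le> E2 t"
  shows "lux_norm lborel F2 (\<lambda>\<xi>. lux_norm lborel F1 (\<lambda>x. ennreal (v x \<xi>)))
    \<le> ennreal (4 * C * measure lborel (ball (0::'a) 1) / s1 * (2 * measure lborel (ball (0::'b) 1) / s2)) *
      lux_norm lborel E2 (\<lambda>\<xi>. lux_norm lborel E1 (\<lambda>x. ennreal (v x \<xi>)))"
proof -
  define K where "K = 4 * C * measure lborel (ball (0::'a) 1) / s1"
  define \<mu> where "\<mu> = measure lborel (ball (0::'b) 1)"
  have \<mu>: "unit_vol TYPE('b) = ennreal \<mu>" "\<mu> > 0"
    unfolding unit_vol_def \<mu>_def using unit_vol_bounds[where 'a='b]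
    by (auto simp: unit_vol_def emeasure_eq_ennreal_measure less_top)
  have K: "K > 0" using C s1 content_ball_pos[of 1 "0::'a"] by (simp add: K_def)
  define N where "N \<eta> = lux_norm lborel E1 (\<lambda>x. ennreal (v x \<eta>))" for \<eta>
  note meas [measurable]
  have N_meas [measurable]: "N \<in> borel_measurable borel"
    unfolding N_def[abs_def] by (rule lux_norm_measurable[OF E1]) measurable
  define \<kappa> where "\<kappa> \<xi> = (\<integral>\<^sup>+ \<eta>. near_ind \<xi> \<eta> * N \<eta> \<partial>lborel)" for \<xi>
  have "lux_norm lborel F2 (\<lambda>\<xi>. lux_norm lborel F1 (\<lambda>x. ennreal (v x \<xi>)))
      \<le> lux_norm lborel F2 (\<lambda>\<xi>. ennreal K * \<kappa> \<xi>)"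
  proof (rule lux_norm_mono_fun[OF F2])
    fix \<xi>
    show "lux_norm lborel F1 (\<lambda>x. ennreal (v x \<xi>)) \<le> ennreal K * \<kappa> \<xi>"
      unfolding K_def \<kappa>_def N_def
      by (rule inner_lux_norm_le_average[OF E1 F1 meas nonneg C s1 mean compare1])
  qed
  also have "\<dots> \<le> ennreal K * lux_norm lborel F2 \<kappa>" by (rule lux_norm_cmult_le[OF K])
  also have "lux_norm lborel F2 \<kappa> \<le> ennreal (2 * \<mu> / s2) * lux_norm lborel E2 N"
  proof (rule le_cmult_lux_norm)
    fix l :: real assume l: "l > 0" "(\<integral>\<^sup>+ \<xi>. E2 (N \<xi> / ennreal l) \<partial>lborel) \<le> 1"
    \<comment> \<open>This is \<kappa> divided by 2 \<mu> l, the normalisation of the averaging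
      lemma; hence 2 \<mu> l / s2 becomes admissible for \<kappa>.\<close>
    define \<kappa>' where "\<kappa>' \<xi> = (\<integral>\<^sup>+ \<eta>. near_ind \<xi> \<eta> * (N \<eta> / ennreal l) \<partial>lborel) / (2 * unit_vol TYPE('b))" for \<xi>
    have meas': "(\<lambda>\<xi>. N \<xi> / ennreal l) \<in> borel_measurable borel" by measurable
    note avg = star_gauge_average[OF E2 meas' l(2) \<kappa>'_def]
    have "(\<integral>\<^sup>+ \<xi>. F2 (ennreal s2 * \<kappa>' \<xi>) \<partial>lborel) \<le> 1"
      by (rule order_trans[OF nn_integral_mono avg(2)]) (rule compare2[OF avg(1)])
    moreover have "ennreal s2 * \<kappa>' \<xi> = \<kappa> \<xi> / ennreal (2 * \<mu> / s2 * l)" for \<xi>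
    proof -
      have "\<kappa>' \<xi> = \<kappa> \<xi> * ennreal (1 / l) * ennreal (1 / (2 * \<mu>))"
      proof -
        have "(\<integral>\<^sup>+ \<eta>. near_ind \<xi> \<eta> * (N \<eta> / ennreal l) \<partial>lborel)
            = (\<integral>\<^sup>+ \<eta>. near_ind \<xi> \<eta> * N \<eta> * ennreal (1 / l) \<partial>lborel)"
          using l by (simp add: divide_ennreal_def inverse_ennreal inverse_eq_divide mult.assoc)
        also have "\<dots> = \<kappa> \<xi> * ennreal (1 / l)" unfolding \<kappa>_def by (rule nn_integral_multc) measurable
        finally have "\<kappa>' \<xi> = \<kappa> \<xi> * ennreal (1 / l) / ennreal (2 * \<mu>)"
          using \<mu> by (simp add: \<kappa>'_def ennreal_mult)
        then show ?thesis using \<mu> by (simp add: divide_ennreal_def inverse_ennreal inverse_eq_divide)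
      qed
      then have "ennreal s2 * \<kappa>' \<xi> = \<kappa> \<xi> * (ennreal s2 * ennreal (1 / l) * ennreal (1 / (2 * \<mu>)))"
        by (simp add: mult_ac)
      also have "ennreal s2 * ennreal (1 / l) * ennreal (1 / (2 * \<mu>)) = ennreal (inverse (2 * \<mu> / s2 * l))"
        using s2 \<mu> l by (simp add: field_simps flip: ennreal_mult)
      finally show ?thesis using s2 \<mu> l by (simp add: divide_ennreal_def inverse_ennreal)
    qed
    ultimately show "lux_norm lborel F2 \<kappa> \<le> ennreal (2 * \<mu> / s2 * l)"
      using s2 \<mu> l by (intro lux_norm_le) auto
  qed (use \<mu> s2 in auto)
  finally have "lux_norm lborel F2 (\<lambda>\<xi>. lux_norm lborel F1 (\<lambda>x. ennreal (v x \<xi>)))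
      \<le> ennreal K * (ennreal (2 * \<mu> / s2) * lux_norm lborel E2 N)"
    by (simp add: mult_left_mono)
  also have "\<dots> = ennreal (K * (2 * \<mu> / s2)) * lux_norm lborel E2 N"
    using K \<mu> s2 by (subst ennreal_mult) (auto simp: mult.assoc)
  finally show ?thesis by (simp only: N_def[abs_def] K_def \<mu>_def)
qed

section \<open>Powers on the extended half-line\<close>

definition epow :: "real \<Rightarrow> ennreal \<Rightarrow> ennreal" where
  "epow p t = (if t = \<infinity> then \<infinity> else ennreal (enn2real t powr p))"

lemma epow_ennreal [simp]: "0 \<le> x \<Longrightarrow> epow p (ennreal x) = ennreal (x powr p)"
  by (simp add: epow_def)

lemma epow_top [simp]: "epow p top = top"
  by (simp add: epow_def)

lemma epow_zero [simp]: "epow p 0 = 0"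
  by (simp add: epow_def)

lemma epow_mono: "0 \<le> p \<Longrightarrow> s \<le> t \<Longrightarrow> epow p s \<le> epow p t"
  by (cases s; cases t) (auto simp: ennreal_le_iff top_unique intro!: ennreal_leI powr_mono2)

lemma epow_epow: "0 < p \<Longrightarrow> 0 < q \<Longrightarrow> p * q = 1 \<Longrightarrow> epow p (epow q t) = t"
  by (cases t) (auto simp: powr_powr mult.commute)

lemma epow_mult:
  assumes p: "0 < p"
  shows "epow p (s * t) = epow p s * epow p t"
proof (cases "s = \<infinity> \<or> t = \<infinity>")
  case False
  then obtain a b where "s = ennreal a" "t = ennreal b" "0 \<le> a" "0 \<le> b"
    by (cases s; cases t) auto
  then show ?thesis by (simp add: powr_mult flip: ennreal_mult)
next
  case True
  have nz: "epow p u = 0 \<longleftrightarrow> u = 0" for u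
    by (cases u) auto
  from True show ?thesis
    by (cases "s = 0"; cases "t = 0") (auto simp: ennreal_mult_top ennreal_top_mult nz)
qed

lemma epow_divide:
  assumes "0 < p" "0 < l"
  shows "epow p (t / ennreal l) = epow p t / ennreal (l powr p)"
proof -
  have "inverse l powr p = inverse (l powr p)"
    using assms by (simp add: powr_def ln_inverse exp_minus)
  then show ?thesis using assms by (simp add: divide_ennreal_def inverse_ennreal epow_mult)
qed

text \<open>The numbers admissible for the p-th power of g and the modified gauge are exactly the
  p-th powers of those admissible for g and \<open>E\<close>.\<close>

lemma lux_norm_epow:
  assumes p: "0 < p"
  shows "lux_norm \<mu> (\<lambda>t. E (epow (1 / p) t)) (\<lambda>x. epow p (g x)) = epow p (lux_norm \<mu> E g)"
proof (rule antisym)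
  let ?L = "lux_norm \<mu> (\<lambda>t. E (epow (1 / p) t)) (\<lambda>x. epow p (g x))"
  have "epow (1 / p) ?L \<le> ennreal 1 * lux_norm \<mu> E g"
  proof (rule le_cmult_lux_norm)
    fix l :: real assume l: "l > 0" "(\<integral>\<^sup>+ x. E (g x / ennreal l) \<partial>\<mu>) \<le> 1"
    have "epow (1 / p) (epow p (g x) / ennreal (l powr p)) = g x / ennreal l" for x
      using p l by (simp add: epow_divide epow_epow powr_powr)
    then have "?L \<le> ennreal (l powr p)"
      using l by (intro lux_norm_le) auto
    then have "epow (1 / p) ?L \<le> epow (1 / p) (ennreal (l powr p))"
      using p by (intro epow_mono) auto
    then show "epow (1 / p) ?L \<le> ennreal (1 * l)" using p l by (simp add: powr_powr)
  qed simp
  then have "epow p (epow (1 / p) ?L) \<le> epow p (lux_norm \<mu> E g)"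
    using p by (intro epow_mono) auto
  then show "?L \<le> epow p (lux_norm \<mu> E g)" using p by (simp add: epow_epow)
  have "epow p (lux_norm \<mu> E g) \<le> ennreal 1 * ?L"
  proof (rule le_cmult_lux_norm)
    fix l :: real assume l: "l > 0" "(\<integral>\<^sup>+ x. E (epow (1 / p) (epow p (g x) / ennreal l)) \<partial>\<mu>) \<le> 1"
    have "epow (1 / p) (epow p (g x) / ennreal l) = g x / ennreal (l powr (1 / p))" for x
      using p l by (simp add: epow_divide epow_epow)
    then have "lux_norm \<mu> E g \<le> ennreal (l powr (1 / p))"
      using l by (intro lux_norm_le) auto
    then have "epow p (lux_norm \<mu> E g) \<le> epow p (ennreal (l powr (1 / p)))"
      using p by (intro epow_mono) auto
    then show "epow p (lux_norm \<mu> E g) \<le> ennreal (1 * l)" using p l by (simp add: powr_powr)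
  qed simp
  then show "epow p (lux_norm \<mu> E g) \<le> ?L" by simp
qed

section \<open>Quasi-Young functions as gauges\<close>

lemma young_scale:
  assumes "young \<Phi>" "0 \<le> s" "s \<le> 1" "0 \<le> t"
  shows "\<Phi> (s * t) \<le> ennreal s * \<Phi> t"
proof -
  have "\<forall>s\<ge>0. \<forall>t\<ge>0. \<forall>u\<ge>0. \<forall>v\<ge>0. u + v = 1 \<longrightarrow>
      \<Phi> (u * s + v * t) \<le> ennreal u * \<Phi> s + ennreal v * \<Phi> t"
    using assms(1) unfolding young_def by blast
  from this[rule_format, of t 0 s "1 - s"]
  have "\<Phi> (s * t + (1 - s) * 0) \<le> ennreal s * \<Phi> t + ennreal (1 - s) * \<Phi> 0"
    using assms(2-) by simp
  then show ?thesis using assms by (simp add: young_def)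
qed

lemma quasi_young_of_order_zero: "quasi_young_of_order r \<Phi> \<Longrightarrow> \<Phi> 0 = 0"
  by (auto simp: quasi_young_of_order_def young_def)

text \<open>The gauge is x -> \<Phi>0 (x^(r/p)) on finite x. Since r / p \<ge> 1, a factor s \<le> 1
  leaves the power as s^(r/p) \<le> s, and convexity with \<Phi>0 0 = 0 takes it outside. Growth
  comes from the limit of \<Phi>0 at infinity.\<close>

lemma star_gauge_quasi_young:
  assumes q: "quasi_young_of_order r \<Phi>" and p: "0 < p" "p \<le> r"
  shows "star_gauge (\<lambda>t. ext_young \<Phi> (epow (1 / p) t))"
  unfolding star_gauge_def
proof (intro conjI allI impI)
  obtain \<Phi>0 where y: "young \<Phi>0" and \<Phi>: "\<And>t. t \<ge> 0 \<Longrightarrow> \<Phi> t = \<Phi>0 (t powr r)" and r: "r > 0"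
    using q unfolding quasi_young_of_order_def by auto
  show "ext_young \<Phi> (epow (1 / p) 0) = 0"
    using quasi_young_of_order_zero[OF q] by (simp add: ext_young_def)
  have val: "ext_young \<Phi> (epow (1 / p) (ennreal x)) = \<Phi>0 (x powr (r / p))" if "x \<ge> 0" for x
    using that by (simp add: ext_young_def \<Phi> powr_powr)
  show "ext_young \<Phi> (epow (1 / p) (s * t)) \<le> s * ext_young \<Phi> (epow (1 / p) t)" if s1: "s \<le> 1" for s t :: ennreal
  proof -
    obtain s' where s: "s = ennreal s'" "0 \<le> s'" "s' \<le> 1"
      using s1 by (cases s) (auto simp: top_unique)
    show ?thesis
    proof (cases t)
      case (real x)
      have "s' powr (r / p) \<le> s' powr 1"
      proof (cases "s' = 0")
        case False
        then show ?thesis using s p by (intro powr_mono') auto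
      qed simp
      then have le: "s' powr (r / p) \<le> s'" using s by simp
      have "ext_young \<Phi> (epow (1 / p) (s * t)) = \<Phi>0 (s' powr (r / p) * x powr (r / p))"
        using real s val[of "s' * x"] by (simp add: ennreal_mult powr_mult)
      also have "\<dots> \<le> ennreal (s' powr (r / p)) * \<Phi>0 (x powr (r / p))"
        using le s by (intro young_scale[OF y]) auto
      also have "\<dots> \<le> s * \<Phi>0 (x powr (r / p))"
        unfolding s(1) by (intro mult_right_mono ennreal_leI le) auto
      finally show ?thesis using real val[of x] by simp
    next
      case top
      then show ?thesis
        using s quasi_young_of_order_zero[OF q]
        by (cases "s' = 0") (auto simp: ext_young_def ennreal_mult_top)
    qed
  qed
  show "\<exists>T<\<infinity>. \<forall>t. ext_young \<Phi> (epow (1 / p) t) \<le> b \<longrightarrow> t \<le> T" if b: "b < \<infinity>" for b :: ennreal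
  proof -
    have "eventually (\<lambda>x. b < \<Phi>0 x) at_top"
      using y b unfolding young_def by (intro order_tendstoD(1)) auto
    then obtain X where X: "\<And>x. x \<ge> X \<Longrightarrow> b < \<Phi>0 x" by (auto simp: eventually_at_top_linorder)
    define T where "T = max X 0 powr (p / r)"
    show ?thesis
    proof (intro exI[of _ "ennreal T"] conjI allI impI)
      fix t assume t: "ext_young \<Phi> (epow (1 / p) t) \<le> b"
      show "t \<le> ennreal T"
      proof (cases t)
        case (real x)
        then have "\<Phi>0 (x powr (r / p)) \<le> b" using t val[of x] by simp
        then have "\<not> X \<le> x powr (r / p)" using X[of "x powr (r / p)"] by (auto dest: leD)
        then have "(x powr (r / p)) powr (p / r) \<le> T"
          unfolding T_def using p r by (intro powr_mono2) auto
        then show ?thesis using real p r by (simp add: powr_powr ennreal_leI)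
      next
        case top
        then show ?thesis using t b by (simp add: ext_young_def top_unique)
      qed
    qed simp
  qed
qed

text \<open>At p = r the gauge of the preceding lemma is monotone, and \<Phi> is that gauge composed
  with the r-th power.\<close>

lemma quasi_young_of_order_mono:
  assumes q: "quasi_young_of_order r \<Phi>"
  shows "mono (ext_young \<Phi>)"
proof -
  have r: "r > 0" using q by (simp add: quasi_young_of_order_def)
  have "ext_young \<Phi> t = ext_young \<Phi> (epow (1 / r) (epow r t))" for t
    using r by (simp add: epow_epow)
  then show ?thesis
    using monoD[OF star_gauge_mono[OF star_gauge_quasi_young[OF q r order_refl]] epow_mono[of r]] r
    by (intro monoI) simp
qed

lemma quasi_young_compare_near_zero:
  assumes "quasi_young_of_order r \<Psi>" and p: "0 < p"
    and lim: "\<exists>L<\<infinity>. ((\<lambda>t. \<Psi> t / \<Phi> t) \<longlongrightarrow> L) (at_right 0)"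
  shows "\<exists>L<\<infinity>. \<exists>t0>0. \<forall>t\<le>t0. ext_young \<Psi> (epow (1 / p) t) \<le> L * ext_young \<Phi> (epow (1 / p) t)"
proof -
  obtain L where L: "L < \<infinity>" "((\<lambda>t. \<Psi> t / \<Phi> t) \<longlongrightarrow> L) (at_right 0)" using lim by auto
  then have "L < L + 1" by (cases L) (auto simp: ennreal_less_iff simp flip: ennreal_1 ennreal_plus)
  then have "eventually (\<lambda>t. \<Psi> t / \<Phi> t < L + 1) (at_right 0)" using L(2) by (rule order_tendstoD(2)[rotated])
  then obtain \<delta> where \<delta>: "\<delta> > 0" "\<And>t. 0 < t \<Longrightarrow> t < \<delta> \<Longrightarrow> \<Psi> t / \<Phi> t < L + 1"
    by (auto simp: eventually_at_right_field)
  have le: "\<Psi> t \<le> (L + 1) * \<Phi> t" if "0 \<le> t" "t < \<delta>" for t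
  proof (cases "t = 0")
    case True
    then show ?thesis using quasi_young_of_order_zero[OF assms(1)] by simp
  next
    case False
    then have *: "\<Psi> t / \<Phi> t < L + 1" using that \<delta> by simp
    \<comment> \<open>If \<Phi> t = 0, a finite quotient forces \<Psi> t = 0. If \<Phi> t =
      \<infinity>, the right side is \<infinity> because L + 1 is nonzero even when L = 0.\<close>
    consider "\<Phi> t = 0" | "\<Phi> t = \<infinity>" | "\<Phi> t \<noteq> 0" "\<Phi> t \<noteq> \<infinity>" by blast
    then show ?thesis
    proof cases
      case 1
      then show ?thesis using * by (simp split: if_splits)
    next
      case 2
      then show ?thesis by (simp add: ennreal_mult_top)
    next
      case 3
      then have "\<Psi> t = \<Psi> t / \<Phi> t * \<Phi> t"
        using mult_divide_eq_ennreal[of "\<Phi> t" "\<Psi> t"] by (simp add: mult.commute ennreal_times_divide)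
      also have "\<dots> \<le> (L + 1) * \<Phi> t" using * by (intro mult_right_mono) auto
      finally show ?thesis .
    qed
  qed
  have "\<forall>t\<le>ennreal ((\<delta> / 2) powr p). ext_young \<Psi> (epow (1 / p) t) \<le> (L + 1) * ext_young \<Phi> (epow (1 / p) t)"
  proof (intro allI impI)
    fix t assume t: "t \<le> ennreal ((\<delta> / 2) powr p)"
    then obtain x where x: "t = ennreal x" "x \<ge> 0" "x \<le> (\<delta> / 2) powr p"
      by (cases t) (auto simp: top_unique)
    have "x powr (1 / p) \<le> ((\<delta> / 2) powr p) powr (1 / p)" using x p by (intro powr_mono2) auto
    then have "x powr (1 / p) < \<delta>" using \<delta> p by (simp add: powr_powr)
    then show "ext_young \<Psi> (epow (1 / p) t) \<le> (L + 1) * ext_young \<Phi> (epow (1 / p) t)"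
      using le[of "x powr (1 / p)"] x by (simp add: ext_young_def)
  qed
  moreover have "L + 1 < \<infinity>" using L by simp
  moreover have "0 < ennreal ((\<delta> / 2) powr p)" using \<delta> by simp
  ultimately show ?thesis by blast
qed

section \<open>Embeddings and moderate weights\<close>

text \<open>The estimate is assumed on the whole ambient set H, also where N is infinite. It
  therefore applies directly to a difference g - f, which is all that the neighbourhoods of f
  involve.\<close>

lemma continuously_embeddedI:
  assumes K: "K > 0" and diff: "\<And>f g. f \<in> H \<Longrightarrow> g \<in> H \<Longrightarrow> g - f \<in> H"
    and le: "\<And>f. f \<in> H \<Longrightarrow> N' f \<le> ennreal K * N f"
  shows "continuously_embedded {f \<in> H. N f < \<infinity>} N {f \<in> H. N' f < \<infinity>} N'"
proof -
  let ?X = "{f \<in> H. N f < \<infinity>}" and ?Y = "{f \<in> H. N' f < \<infinity>}"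
  have sub: "?X \<subseteq> ?Y"
  proof clarsimp
    fix f assume "f \<in> H" "N f < top"
    then have "ennreal K * N f < top" using K by (simp add: ennreal_mult_less_top)
    then show "N' f < top" using le[OF \<open>f \<in> H\<close>] by (rule le_less_trans[rotated])
  qed
  have "openin (quasinorm_topology ?X N) {f \<in> ?X. f \<in> U}" if U: "openin (quasinorm_topology ?Y N') U" for U
    unfolding openin_quasinorm_topology
  proof (intro conjI ballI)
    fix f assume f: "f \<in> {f \<in> ?X. f \<in> U}"
    then obtain \<epsilon> where \<epsilon>: "\<epsilon> > 0" "\<And>g. g \<in> ?Y \<Longrightarrow> N' (g - f) < \<epsilon> \<Longrightarrow> g \<in> U"
      using U unfolding openin_quasinorm_topology by blast
    show "\<exists>\<delta>>0. \<forall>g\<in>?X. N (g - f) < \<delta> \<longrightarrow> g \<in> {f \<in> ?X. f \<in> U}"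
    proof (intro exI[of _ "\<epsilon> / ennreal K"] conjI ballI impI)
      show "0 < \<epsilon> / ennreal K" using \<epsilon> by (simp add: ennreal_zero_less_divide)
      fix g assume g: "g \<in> ?X" and "N (g - f) < \<epsilon> / ennreal K"
      then have "ennreal K * N (g - f) < ennreal K * (\<epsilon> / ennreal K)"
        using K by (intro ennreal_mult_strict_left_mono) auto
      also have "\<dots> = \<epsilon>"
        using K mult_divide_eq_ennreal[of "ennreal K" \<epsilon>] by (simp add: ennreal_times_divide mult.commute)
      finally have "N' (g - f) < \<epsilon>"
        using le[OF diff[of f g]] f g by (auto intro: le_less_trans)
      then show "g \<in> {f \<in> ?X. f \<in> U}" using \<epsilon>(2)[of g] g sub by auto
    qed
  qed auto
  then show ?thesis
    using sub unfolding continuously_embedded_def continuous_map_def by auto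
qed

lemma mixed_lux_norm_epow:
  assumes p: "0 < p"
  shows "lux_norm \<mu> (\<lambda>t. E2 (epow (1 / p) t)) (\<lambda>\<xi>. lux_norm \<nu> (\<lambda>t. E1 (epow (1 / p) t)) (\<lambda>x. epow p (g x \<xi>)))
    = epow p (lux_norm \<mu> E2 (\<lambda>\<xi>. lux_norm \<nu> E1 (\<lambda>x. g x \<xi>)))"
  by (subst lux_norm_epow[OF p, of \<nu> E1]) (rule lux_norm_epow[OF p, of \<mu> E2])

lemma epow_le_cmultD:
  assumes p: "0 < p" and K: "0 \<le> K" and le: "epow p a \<le> ennreal K * epow p b"
  shows "a \<le> ennreal (K powr (1 / p)) * b"
proof -
  have "a = epow (1 / p) (epow p a)" using p by (simp add: epow_epow)
  also have "\<dots> \<le> epow (1 / p) (ennreal K * epow p b)" using p le by (intro epow_mono) auto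
  also have "\<dots> = ennreal (K powr (1 / p)) * b" using p K by (simp add: epow_mult epow_epow)
  finally show ?thesis .
qed

lemma mixed_lux_norm_count_space_le:
  assumes F2: "mono F2" and s: "s1 > 0" "s2 > 0"
    and "\<And>t. E1 t \<le> 1 \<Longrightarrow> F1 (ennreal s1 * t) \<le> E1 t"
    and "\<And>t. E2 t \<le> 1 \<Longrightarrow> F2 (ennreal s2 * t) \<le> E2 t"
  shows "lux_norm (count_space A) F2 (\<lambda>\<xi>. lux_norm (count_space B) F1 (\<lambda>x. g x \<xi>))
    \<le> ennreal (1 / s1 * (1 / s2)) * lux_norm (count_space A) E2 (\<lambda>\<xi>. lux_norm (count_space B) E1 (\<lambda>x. g x \<xi>))"
proof -
  have "lux_norm (count_space A) F2 (\<lambda>\<xi>. lux_norm (count_space B) F1 (\<lambda>x. g x \<xi>))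
      \<le> lux_norm (count_space A) F2 (\<lambda>\<xi>. ennreal (1 / s1) * lux_norm (count_space B) E1 (\<lambda>x. g x \<xi>))"
    using assms by (intro lux_norm_mono_fun lux_norm_count_space_le) auto
  also have "\<dots> \<le> ennreal (1 / s1) * lux_norm (count_space A) F2 (\<lambda>\<xi>. lux_norm (count_space B) E1 (\<lambda>x. g x \<xi>))"
    using s by (intro lux_norm_cmult_le) auto
  also have "\<dots> \<le> ennreal (1 / s1) * (ennreal (1 / s2) * lux_norm (count_space A) E2 (\<lambda>\<xi>. lux_norm (count_space B) E1 (\<lambda>x. g x \<xi>)))"
    using assms by (intro mult_left_mono lux_norm_count_space_le) auto
  also have "\<dots> = ennreal (1 / s1 * (1 / s2)) * lux_norm (count_space A) E2 (\<lambda>\<xi>. lux_norm (count_space B) E1 (\<lambda>x. g x \<xi>))"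
    using s by (subst ennreal_mult) (auto simp: mult.assoc)
  finally show ?thesis .
qed

section \<open>Regularity of moderate weights\<close>

lemma moderate_weight_pos: "moderate_weight \<omega> \<Longrightarrow> 0 < \<omega> x"
  by (simp add: moderate_weight_def weight_def)

text \<open>The dominating weight \<open>v\<close> is only essentially bounded on compact sets; splitting
  \<open>y = t + (y - t)\<close> with \<open>t\<close> and \<open>y - t\<close> outside a null set bounds the quotient everywhere.\<close>

lemma moderate_weight_locally_comparable:
  fixes \<omega> :: "'a::euclidean_space \<Rightarrow> real"
  assumes "moderate_weight \<omega>"
  shows "\<exists>C>0. \<forall>x y. norm y \<le> 1 \<longrightarrow> \<omega> (x + y) \<le> C * \<omega> x"
proof -
  obtain v c where v: "weight v" and c: "c > 0" "\<And>x y. \<omega> (x + y) \<le> c * (\<omega> x * v y)"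
    using assms unfolding moderate_weight_def by blast
  have pos: "\<omega> x > 0" "v x > 0" for x
    using moderate_weight_pos[OF assms] v by (auto simp: weight_def)
  have "compact (cball (0::'a) 2)" by simp
  then obtain B where B: "AE t in lebesgue. t \<in> cball 0 2 \<longrightarrow> \<bar>v t\<bar> \<le> B"
    using v unfolding weight_def L_infinity_loc_def by blast
  define S where "S = {t \<in> cball 0 2. \<not> v t \<le> B}"
  have "negligible S"
  proof -
    have "AE t in lebesgue. t \<notin> S" using B by eventually_elim (auto simp: S_def)
    then obtain M where "M \<in> null_sets lebesgue" "S \<subseteq> M" by (auto simp: eventually_ae_filter)
    then show ?thesis by (meson negligible_iff_null_sets negligible_subset)
  qed
  have main: "\<omega> (x + y) \<le> c * c * B * B * \<omega> x" if y: "norm y \<le> 1" for x y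
  proof -
    have "negligible ((\<lambda>t. y - t) ` S)"
      using \<open>negligible S\<close> by (intro negligible_differentiable_image_negligible) (auto intro!: derivative_intros)
    with \<open>negligible S\<close> have "negligible (S \<union> (\<lambda>t. y - t) ` S)" by simp
    moreover have "\<not> negligible (ball (0::'a) 1)" by (rule open_not_negligible) auto
    ultimately have "\<not> ball 0 1 \<subseteq> S \<union> (\<lambda>t. y - t) ` S" by (metis negligible_subset)
    then obtain t where "t \<in> ball 0 1" "t \<notin> S \<union> (\<lambda>t. y - t) ` S" by blast
    then have t: "norm t < 1" "t \<notin> S" "t \<notin> (\<lambda>t. y - t) ` S" by (simp, blast, blast)
    have "y - t \<notin> S" using t(3) by (metis diff_diff_eq2 add_diff_cancel_left' image_eqI)
    moreover have "norm (y - t) \<le> 2" using y t norm_triangle_ineq4[of y t] by linarith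
    ultimately have vt: "v t \<le> B" "v (y - t) \<le> B" using t by (auto simp: S_def)
    have "\<omega> (x + y) = \<omega> ((x + t) + (y - t))" by simp
    also have "\<dots> \<le> c * (\<omega> (x + t) * v (y - t))" by (rule c)
    also have "\<dots> \<le> c * ((c * (\<omega> x * v t)) * v (y - t))"
      using c pos by (intro mult_left_mono mult_right_mono) (auto intro: less_imp_le)
    also have "\<dots> \<le> c * ((c * (\<omega> x * B)) * B)"
      using c vt pos[of x] pos(2)[of t] pos(2)[of "y - t"] by (intro mult_left_mono mult_mono) auto
    finally show ?thesis by (simp add: mult_ac)
  qed
  show ?thesis
  proof (intro exI[of _ "c * c * B * B + 1"] conjI allI impI)
    show "c * c * B * B + 1 > 0"
      using zero_le_square[of "c * B"] by (simp add: algebra_simps add_pos_nonneg add_nonneg_pos)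
    fix x y :: 'a assume "norm y \<le> 1"
    then show "\<omega> (x + y) \<le> (c * c * B * B + 1) * \<omega> x"
      using main[of y x] pos(1)[of x] by (simp add: algebra_simps)
  qed
qed

text \<open>The supremum of \<omega> over unit balls is lower semicontinuous, since its superlevel
  sets are unions of open balls; this makes it Borel although \<omega> is merely Lebesgue
  measurable. Local comparability keeps it within a constant of \<omega>.\<close>

lemma moderate_weight_borel_equivalent:
  fixes \<omega> :: "'a::euclidean_space \<Rightarrow> real"
  assumes "moderate_weight \<omega>"
  obtains \<omega>' C where "\<omega>' \<in> borel_measurable borel" "C > 0"
    "\<And>z. \<omega> z \<le> \<omega>' z" "\<And>z. \<omega>' z \<le> C * \<omega> z" "\<And>z w. dist z w < 1 \<Longrightarrow> \<omega>' z \<le> C * \<omega>' w"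
proof -
  obtain B where B: "B > 0" "\<And>x y. norm y \<le> 1 \<Longrightarrow> \<omega> (x + y) \<le> B * \<omega> x"
    using moderate_weight_locally_comparable[OF assms] by blast
  have near: "\<omega> w \<le> B * \<omega> z" if "dist z w < 1" for z w
    using B(2)[of "w - z" z] that by (simp add: dist_norm norm_minus_commute)
  define \<omega>' where "\<omega>' z = (SUP w\<in>ball z 1. \<omega> w)" for z
  have bdd: "bdd_above (\<omega> ` ball z 1)" for z
    by (rule bdd_aboveI2[of _ _ "B * \<omega> z"]) (simp add: near)
  have ge: "\<omega> z \<le> \<omega>' z" for z
    unfolding \<omega>'_def by (rule cSUP_upper[OF _ bdd]) simp
  have le: "\<omega>' z \<le> B * \<omega> z" for z
    unfolding \<omega>'_def by (rule cSUP_least) (simp_all add: near)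
  have "{z. a < \<omega>' z} = (\<Union>w\<in>{w. a < \<omega> w}. ball w 1)" for a
    unfolding \<omega>'_def by (subst less_cSUP_iff[OF _ bdd]) (auto simp: dist_commute)
  then have "open {z. a < \<omega>' z}" for a by auto
  then have meas: "\<omega>' \<in> borel_measurable borel"
    by (intro borel_measurableI_greater) simp
  \<comment> \<open>Passing from \<omega>' to \<omega> at z and then from z to w costs B twice. The
    extra summand B lets the same constant bound \<omega>' by \<omega>.\<close>
  have osc: "\<omega>' z \<le> (B * B + B) * \<omega>' w" if "dist z w < 1" for z w
  proof -
    have "\<omega>' z \<le> B * (B * \<omega> w)"
      using le[of z] near[of w z] that B by (auto simp: dist_commute intro: order_trans mult_left_mono)
    also have "\<dots> \<le> (B * B + B) * \<omega>' w"
      using ge[of w] B moderate_weight_pos[OF assms, of w]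
      by (simp add: mult.assoc[symmetric]) (intro mult_mono, auto)
    finally show ?thesis .
  qed
  show thesis
  proof (rule that[OF meas _ ge _ osc])
    show "B * B + B > 0" using B by (simp add: add_pos_pos)
    show "\<omega>' z \<le> (B * B + B) * \<omega> z" for z
      by (rule order_trans[OF le mult_right_mono])
        (use B moderate_weight_pos[OF assms, of z] in auto)
  qed
qed

section \<open>Sub-mean value properties\<close>

lemma nn_integral_lborel_translate:
  fixes f :: "'a::euclidean_space \<Rightarrow> ennreal"
  assumes [measurable]: "f \<in> borel_measurable borel"
  shows "(\<integral>\<^sup>+ x. f (t + x) \<partial>lborel) = (\<integral>\<^sup>+ x. f x \<partial>lborel)"
proof -
  have "(\<integral>\<^sup>+ x. f x \<partial>distr lborel borel ((+) t)) = (\<integral>\<^sup>+ x. f (t + x) \<partial>lborel)"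
    by (rule nn_integral_distr) auto
  then show ?thesis by (simp add: lborel_distr_plus)
qed

lemma nn_integral_lborel_pair:
  fixes f :: "'a::euclidean_space \<times> 'b::euclidean_space \<Rightarrow> ennreal"
  assumes [measurable]: "f \<in> borel_measurable borel"
  shows "(\<integral>\<^sup>+ z. f z \<partial>lborel) = (\<integral>\<^sup>+ \<xi>. \<integral>\<^sup>+ x. f (x, \<xi>) \<partial>lborel \<partial>lborel)"
    "(\<integral>\<^sup>+ z. f z \<partial>lborel) = (\<integral>\<^sup>+ x. \<integral>\<^sup>+ \<xi>. f (x, \<xi>) \<partial>lborel \<partial>lborel)"
proof -
  have *: "f \<in> borel_measurable (lborel \<Otimes>\<^sub>M lborel)" by (simp add: lborel_prod)
  show "(\<integral>\<^sup>+ z. f z \<partial>lborel) = (\<integral>\<^sup>+ \<xi>. \<integral>\<^sup>+ x. f (x, \<xi>) \<partial>lborel \<partial>lborel)"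
    using lborel_pair.nn_integral_snd[OF *] by (simp add: lborel_prod)
  show "(\<integral>\<^sup>+ z. f z \<partial>lborel) = (\<integral>\<^sup>+ x. \<integral>\<^sup>+ \<xi>. f (x, \<xi>) \<partial>lborel \<partial>lborel)"
    using lborel.nn_integral_fst[OF *] by (simp add: lborel_prod)
qed

text \<open>By Fubini a shear is a translation of the inner variable for each fixed outer
  variable.\<close>

lemma nn_integral_shear:
  fixes f :: "'a::euclidean_space \<times> 'a \<Rightarrow> ennreal"
  assumes f [measurable]: "f \<in> borel_measurable borel"
  shows "(\<integral>\<^sup>+ z. f (fst z + a *\<^sub>R snd z, snd z) \<partial>lborel) = (\<integral>\<^sup>+ z. f z \<partial>lborel)"
    "(\<integral>\<^sup>+ z. f (fst z, snd z + a *\<^sub>R fst z) \<partial>lborel) = (\<integral>\<^sup>+ z. f z \<partial>lborel)"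
proof -
  have [measurable]: "f \<in> borel_measurable (borel \<Otimes>\<^sub>M borel)" by (simp add: borel_prod)
  have m: "(\<lambda>z. f (fst z + a *\<^sub>R snd z, snd z)) \<in> borel_measurable (borel \<Otimes>\<^sub>M borel)"
      "(\<lambda>z. f (fst z, snd z + a *\<^sub>R fst z)) \<in> borel_measurable (borel \<Otimes>\<^sub>M borel)"
    by measurable
  have "(\<integral>\<^sup>+ z. f (fst z + a *\<^sub>R snd z, snd z) \<partial>lborel) = (\<integral>\<^sup>+ \<xi>. \<integral>\<^sup>+ x. f (a *\<^sub>R \<xi> + x, \<xi>) \<partial>lborel \<partial>lborel)"
    by (subst nn_integral_lborel_pair(1)) (use m in \<open>simp_all add: borel_prod add.commute\<close>)
  also have "\<dots> = (\<integral>\<^sup>+ \<xi>. \<integral>\<^sup>+ x. f (x, \<xi>) \<partial>lborel \<partial>lborel)"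
    by (intro nn_integral_cong nn_integral_lborel_translate[where f = "\<lambda>x. f (x, _)"]) measurable
  also have "\<dots> = (\<integral>\<^sup>+ z. f z \<partial>lborel)" by (rule nn_integral_lborel_pair(1)[OF f, symmetric])
  finally show "(\<integral>\<^sup>+ z. f (fst z + a *\<^sub>R snd z, snd z) \<partial>lborel) = (\<integral>\<^sup>+ z. f z \<partial>lborel)" .
  have "(\<integral>\<^sup>+ z. f (fst z, snd z + a *\<^sub>R fst z) \<partial>lborel) = (\<integral>\<^sup>+ x. \<integral>\<^sup>+ \<xi>. f (x, a *\<^sub>R x + \<xi>) \<partial>lborel \<partial>lborel)"
    by (subst nn_integral_lborel_pair(2)) (use m in \<open>simp_all add: borel_prod add.commute\<close>)
  also have "\<dots> = (\<integral>\<^sup>+ x. \<integral>\<^sup>+ \<xi>. f (x, \<xi>) \<partial>lborel \<partial>lborel)"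
    by (intro nn_integral_cong nn_integral_lborel_translate[where f = "\<lambda>\<xi>. f (_, \<xi>)"]) measurable
  also have "\<dots> = (\<integral>\<^sup>+ z. f z \<partial>lborel)" by (rule nn_integral_lborel_pair(2)[OF f, symmetric])
  finally show "(\<integral>\<^sup>+ z. f (fst z, snd z + a *\<^sub>R fst z) \<partial>lborel) = (\<integral>\<^sup>+ z. f z \<partial>lborel)" .
qed

text \<open>Multiplication by c + i s on complex vectors x + i \<xi>, that is, one rotation in all
  planes spanned by matching coordinates of x and \<xi>. With c and s as free numbers, the shear
  decomposition is pure algebra.\<close>

definition plane_rot :: "real \<Rightarrow> real \<Rightarrow> 'a::real_vector \<times> 'a \<Rightarrow> 'a \<times> 'a" where
  "plane_rot c s z = (c *\<^sub>R fst z - s *\<^sub>R snd z, s *\<^sub>R fst z + c *\<^sub>R snd z)"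

lemma plane_rot_measurable [measurable]:
  assumes [measurable]: "c \<in> borel_measurable M" "s \<in> borel_measurable M" "g \<in> M \<rightarrow>\<^sub>M borel"
  shows "(\<lambda>x. plane_rot (c x) (s x) (g x :: 'a::euclidean_space \<times> 'a)) \<in> M \<rightarrow>\<^sub>M borel"
proof -
  have [measurable]: "g \<in> M \<rightarrow>\<^sub>M borel \<Otimes>\<^sub>M borel" using assms(3) by (simp add: borel_prod)
  show ?thesis unfolding plane_rot_def borel_prod[symmetric] by measurable
qed

text \<open>A rotation is a product of three shears unless it is the reflection through the origin,
  which is the square of a quarter turn.\<close>

lemma nn_integral_plane_rot:
  fixes f :: "'a::euclidean_space \<times> 'a \<Rightarrow> ennreal"
  assumes f: "f \<in> borel_measurable borel" and cs: "c\<^sup>2 + s\<^sup>2 = 1"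
  shows "(\<integral>\<^sup>+ z. f (plane_rot c s z) \<partial>lborel) = (\<integral>\<^sup>+ z. f z \<partial>lborel)"
proof -
  have generic: "(\<integral>\<^sup>+ z. f (plane_rot c s z) \<partial>lborel) = (\<integral>\<^sup>+ z. f z \<partial>lborel)"
    if f [measurable]: "f \<in> borel_measurable borel" and cs: "c\<^sup>2 + s\<^sup>2 = 1" and "c \<noteq> -1" for f :: "'a \<times> 'a \<Rightarrow> ennreal" and c s
  proof -
    \<comment> \<open>For c and s the cosine and sine of an angle, a is minus the tangent of half
      the angle; the outer two shears use a and the middle one s.\<close>
    define a where "a = - s / (1 + c)"
    have c1: "1 + c \<noteq> 0" using \<open>c \<noteq> -1\<close> by simp
    have a1: "1 + s * a = c" "a * (1 + c) = - s"
      using c1 cs by (auto simp: a_def field_simps power2_eq_square)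
    define g where "g z = f (fst z + a *\<^sub>R snd z, snd z)" for z
    define h where "h z = g (fst z, snd z + s *\<^sub>R fst z)" for z
    have [measurable]: "f \<in> borel_measurable (borel \<Otimes>\<^sub>M borel)" by (simp add: borel_prod)
    have g [measurable]: "g \<in> borel_measurable (borel \<Otimes>\<^sub>M borel)" unfolding g_def[abs_def] by measurable
    have h: "h \<in> borel_measurable (borel \<Otimes>\<^sub>M borel)" unfolding h_def[abs_def] by measurable
    have "f (plane_rot c s z) = h (fst z + a *\<^sub>R snd z, snd z)" for z
    proof -
      obtain x \<xi> where z: "z = (x, \<xi>)" by (cases z)
      have e1: "\<xi> + s *\<^sub>R (x + a *\<^sub>R \<xi>) = s *\<^sub>R x + c *\<^sub>R \<xi>"
        unfolding a1(1)[symmetric] by (simp add: algebra_simps)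
      have "x + a *\<^sub>R \<xi> + a *\<^sub>R (s *\<^sub>R x + c *\<^sub>R \<xi>) = (1 + s * a) *\<^sub>R x + (a * (1 + c)) *\<^sub>R \<xi>"
        by (simp add: algebra_simps)
      then have e2: "x + a *\<^sub>R \<xi> + a *\<^sub>R (s *\<^sub>R x + c *\<^sub>R \<xi>) = (1 + s * a) *\<^sub>R x - s *\<^sub>R \<xi>"
        by (simp add: a1(2))
      show ?thesis using e2 by (simp add: z h_def g_def e1 plane_rot_def a1(1))
    qed
    then have "(\<integral>\<^sup>+ z. f (plane_rot c s z) \<partial>lborel) = (\<integral>\<^sup>+ z. h (fst z + a *\<^sub>R snd z, snd z) \<partial>lborel)" by simp
    also have "\<dots> = (\<integral>\<^sup>+ z. h z \<partial>lborel)" using h by (intro nn_integral_shear) (simp add: borel_prod)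
    also have "\<dots> = (\<integral>\<^sup>+ z. g z \<partial>lborel)"
      unfolding h_def using g by (intro nn_integral_shear) (simp add: borel_prod)
    also have "\<dots> = (\<integral>\<^sup>+ z. f z \<partial>lborel)" unfolding g_def by (intro nn_integral_shear) simp
    finally show ?thesis .
  qed
  show ?thesis
  proof (cases "c = -1")
    case False
    then show ?thesis using generic f cs by blast
  next
    case True
    then have "s = 0" using cs by (simp add: power2_eq_square)
    have [measurable]: "f \<in> borel_measurable borel" by (rule f)
    have "plane_rot c s z = plane_rot 0 1 (plane_rot 0 1 z)" for z :: "'a \<times> 'a"
      using True \<open>s = 0\<close> by (simp add: plane_rot_def)
    then have "(\<integral>\<^sup>+ z. f (plane_rot c s z) \<partial>lborel) = (\<integral>\<^sup>+ z. (\<lambda>w. f (plane_rot 0 1 w)) (plane_rot 0 1 z) \<partial>lborel)"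
      by simp
    also have "\<dots> = (\<integral>\<^sup>+ w. f (plane_rot 0 1 w) \<partial>lborel)" by (rule generic) auto
    also have "\<dots> = (\<integral>\<^sup>+ z. f z \<partial>lborel)" by (rule generic) auto
    finally show ?thesis .
  qed
qed

lemma norm_plane_rot:
  fixes z :: "'a::real_inner \<times> 'a"
  assumes "c\<^sup>2 + s\<^sup>2 = 1"
  shows "norm (plane_rot c s z) = norm z"
proof -
  have "(norm (plane_rot c s z))\<^sup>2 = (c\<^sup>2 + s\<^sup>2) * (norm z)\<^sup>2"
    unfolding power2_norm_eq_inner plane_rot_def inner_prod_def
    by (simp add: inner_simps power2_eq_square algebra_simps inner_commute)
  then show ?thesis using assms by simp
qed

text \<open>Integrate the circle inequality over h in the ball and exchange the integrals. For fixed
  t the substitution by the rotation of h preserves Lebesgue measure and the ball, so the integral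
  over t becomes trivial. The constant bounds the Gaussian factor for
  \<open>norm h \<le> 1\<close>.\<close>

lemma rotation_mean_imp_ball_mean:
  fixes U :: "'a::euclidean_space \<times> 'a \<Rightarrow> real"
  assumes U [measurable]: "U \<in> borel_measurable borel"
    and circ: "\<And>z h. ennreal (U z) \<le> ennreal (exp ((norm h)\<^sup>2 / 4)) *
      (\<integral>\<^sup>+ t\<in>{0..1}. ennreal (U (z + plane_rot (cos (2 * pi * t)) (- sin (2 * pi * t)) h)) \<partial>lborel)"
    and \<delta>: "0 < \<delta>" "\<delta> \<le> 1"
  shows "ennreal (U z) * emeasure lborel (ball (0 :: 'a \<times> 'a) \<delta>) \<le> ennreal (exp (1 / 4)) * (\<integral>\<^sup>+ w\<in>ball z \<delta>. ennreal (U w) \<partial>lborel)"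
proof -
  let ?R = "\<lambda>t. plane_rot (cos (2 * pi * t)) (- sin (2 * pi * t)) :: 'a \<times> 'a \<Rightarrow> _"
  let ?B = "ball (0 :: 'a \<times> 'a) \<delta>"
  have [measurable]: "?B \<in> sets borel" "ball z \<delta> \<in> sets borel" by simp_all
  have cs: "(cos (2 * pi * t))\<^sup>2 + (- sin (2 * pi * t))\<^sup>2 = 1" for t :: real by simp
  have "ennreal (U z) * emeasure lborel ?B = (\<integral>\<^sup>+ h. ennreal (U z) * indicator ?B h \<partial>lborel)"
    by (subst nn_integral_cmult_indicator) auto
  also have "\<dots> \<le> (\<integral>\<^sup>+ h. \<integral>\<^sup>+ t. ennreal (exp (1 / 4)) * (ennreal (U (z + ?R t h)) * indicator {0..1} t * indicator ?B (?R t h)) \<partial>lborel \<partial>lborel)"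
  proof (rule nn_integral_mono)
    fix h :: "'a \<times> 'a"
    \<comment> \<open>Moving the rotation into the indicator makes the integrand a function of the
      rotated point alone, ready for rotation invariance.\<close>
    have ind: "indicator ?B (?R t h) = (indicator ?B h :: ennreal)" for t
      using norm_plane_rot[OF cs, of t h] by (simp add: indicator_def)
    have "ennreal (U z) * indicator ?B h \<le> ennreal (exp (1 / 4)) *
      (\<integral>\<^sup>+ t\<in>{0..1}. ennreal (U (z + ?R t h)) \<partial>lborel) * indicator ?B h"
    proof (cases "h \<in> ?B")
      case True
      then have "norm h \<le> 1" using \<delta> by auto
      then have "exp ((norm h)\<^sup>2 / 4) \<le> exp (1 / 4)" by (simp add: power_le_one)
      then show ?thesis
        using True by (auto intro!: order_trans[OF circ[of z h]] mult_right_mono ennreal_leI)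
    qed simp
    also have "\<dots> = (\<integral>\<^sup>+ t. ennreal (exp (1 / 4)) * (ennreal (U (z + ?R t h)) * indicator {0..1} t * indicator ?B (?R t h)) \<partial>lborel)"
      unfolding ind
      by (subst nn_integral_cmult, measurable) (subst nn_integral_multc, measurable, simp add: mult.assoc)
    finally show "ennreal (U z) * indicator ?B h \<le> (\<integral>\<^sup>+ t. ennreal (exp (1 / 4)) * (ennreal (U (z + ?R t h)) * indicator {0..1} t * indicator ?B (?R t h)) \<partial>lborel)" .
  qed
  also have "\<dots> = (\<integral>\<^sup>+ t. \<integral>\<^sup>+ h. ennreal (exp (1 / 4)) * (ennreal (U (z + ?R t h)) * indicator {0..1} t * indicator ?B (?R t h)) \<partial>lborel \<partial>lborel)"
    by (rule lborel_pair.Fubini') measurable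
  also have "\<dots> = (\<integral>\<^sup>+ t. ennreal (exp (1 / 4)) * (\<integral>\<^sup>+ h. ennreal (U (z + h)) * indicator ?B h \<partial>lborel) * indicator {0..1} (t::real) \<partial>lborel)"
  proof (rule nn_integral_cong)
    fix t :: real
    have "(\<integral>\<^sup>+ h. ennreal (U (z + ?R t h)) * indicator ?B (?R t h) \<partial>lborel) = (\<integral>\<^sup>+ h. ennreal (U (z + h)) * indicator ?B h \<partial>lborel)"
      by (rule nn_integral_plane_rot[OF _ cs, where f = "\<lambda>h. ennreal (U (z + h)) * indicator ?B h"]) measurable
    then show "(\<integral>\<^sup>+ h. ennreal (exp (1 / 4)) * (ennreal (U (z + ?R t h)) * indicator {0..1} t * indicator ?B (?R t h)) \<partial>lborel)
       = ennreal (exp (1 / 4)) * (\<integral>\<^sup>+ h. ennreal (U (z + h)) * indicator ?B h \<partial>lborel) * indicator {0..1} t"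
      by (auto simp: nn_integral_cmult indicator_def)
  qed
  also have "\<dots> = ennreal (exp (1 / 4)) * (\<integral>\<^sup>+ h. ennreal (U (z + h)) * indicator ?B h \<partial>lborel)"
    by (subst nn_integral_cmult_indicator) auto
  also have "(\<integral>\<^sup>+ h. ennreal (U (z + h)) * indicator ?B h \<partial>lborel) = (\<integral>\<^sup>+ h. ennreal (U (z + h)) * indicator (ball z \<delta>) (z + h) \<partial>lborel)"
    by (intro nn_integral_cong) (simp add: indicator_def dist_norm)
  also have "\<dots> = (\<integral>\<^sup>+ w\<in>ball z \<delta>. ennreal (U w) \<partial>lborel)"
    by (rule nn_integral_lborel_translate[where f = "\<lambda>w. ennreal (U w) * indicator (ball z \<delta>) w"]) measurable
  finally show ?thesis .
qed

text \<open>An exponent-lowering argument of Fefferman and Stein: at a maximum point of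
  \<open>U(w) (1 - |w - z|)\<^bsup>m/p\<^esup>\<close> on the unit ball, \<open>U\<close> is controlled on a ball whose radius is
  half the distance to the boundary, so \<open>U\<close> can be replaced by \<open>U\<^bsup>1-p\<^esup> U\<^bsup>p\<^esup>\<close> in the mean.\<close>

lemma ball_mean_powr:
  fixes U :: "'a::euclidean_space \<Rightarrow> real"
  assumes cont: "continuous_on UNIV U" and nonneg: "\<And>z. 0 \<le> U z" and C: "C > 0"
    and p: "0 < p" "p \<le> 1"
    and mean: "\<And>z \<delta>. 0 < \<delta> \<Longrightarrow> \<delta> \<le> 1 \<Longrightarrow>
      ennreal (U z) * ennreal (\<delta> powr m) \<le> ennreal C * (\<integral>\<^sup>+ w\<in>ball z \<delta>. ennreal (U w) \<partial>lborel)"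
    and m: "m > 0"
  shows "ennreal (U z powr p) \<le> ennreal (C * 2 powr (m / p)) * (\<integral>\<^sup>+ w\<in>ball z 1. ennreal (U w powr p) \<partial>lborel)"
proof -
  have [measurable]: "U \<in> borel_measurable borel"
    using cont by (rule borel_measurable_continuous_onI)
  have [measurable]: "ball z 1 \<in> sets borel" by simp
  define \<rho> where "\<rho> w = max 0 (1 - dist z w)" for w
  \<comment> \<open>With this exponent k (1 - p) = k - m, so all powers of \<delta> cancel at the
    end.\<close>
  define k where "k = m / p"
  have k: "k > 0" "k * p = m" using m p by (auto simp: k_def)
  define h where "h w = U w * \<rho> w powr k" for w
  have "\<exists>w\<in>cball z 1. \<forall>y\<in>cball z 1. h y \<le> h w"
  proof (rule continuous_attains_sup)
    have "continuous_on (cball z 1) (\<lambda>w. \<rho> w powr k)"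
      unfolding \<rho>_def using k by (intro continuous_on_powr' continuous_intros) auto
    then show "continuous_on (cball z 1) h"
      unfolding h_def by (intro continuous_on_mult continuous_on_subset[OF cont]) auto
  qed auto
  then obtain w where w: "w \<in> cball z 1" "\<And>y. y \<in> cball z 1 \<Longrightarrow> h y \<le> h w" by blast
  define M where "M = h w"
  have Uz: "U z \<le> M" using w(2)[of z] by (simp add: h_def \<rho>_def M_def)
  define J where "J = (\<integral>\<^sup>+ y\<in>ball z 1. ennreal (U y powr p) \<partial>lborel)"
  show ?thesis
  proof (cases "M > 0")
    case False
    then have "U z = 0" using Uz nonneg[of z] by simp
    then show ?thesis by simp
  next
    case True
    then have "\<rho> w \<noteq> 0" by (auto simp: M_def h_def)
    then have "\<rho> w > 0" by (simp add: \<rho>_def)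
    define \<delta> where "\<delta> = \<rho> w / 2"
    have \<delta>: "0 < \<delta>" "\<delta> \<le> 1" using \<open>\<rho> w > 0\<close> zero_le_dist[of z w] by (auto simp: \<delta>_def \<rho>_def simp del: zero_le_dist)
    have rw: "1 - dist z w = 2 * \<delta>" using \<open>\<rho> w > 0\<close> by (auto simp: \<delta>_def \<rho>_def)
    \<comment> \<open>On the ball of radius \<delta> around w the distance to the unit sphere around
      z is still at least \<delta>, so maximality of M gives U \<le> S there.\<close>
    define S where "S = M / \<delta> powr k"
    have "S > 0" using True \<delta> by (simp add: S_def)
    have U_le: "U y \<le> S" "y \<in> ball z 1" if y: "y \<in> ball w \<delta>" for y
    proof -
      have "dist z y \<le> dist z w + dist w y" by (rule dist_triangle)
      then have d: "\<delta> \<le> 1 - dist z y" using rw y by simp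
      then show "y \<in> ball z 1" using \<delta> by simp
      then have "h y \<le> M" unfolding M_def by (intro w(2)) auto
      moreover have "U y * \<delta> powr k \<le> h y"
        unfolding h_def \<rho>_def using d \<delta> k nonneg[of y] by (intro mult_left_mono powr_mono2) auto
      ultimately show "U y \<le> S" using \<delta> by (simp add: S_def field_simps)
    qed
    have "ennreal (U w) * ennreal (\<delta> powr m) \<le> ennreal C * (\<integral>\<^sup>+ y\<in>ball w \<delta>. ennreal (U y) \<partial>lborel)"
      by (rule mean[OF \<delta>])
    also have "(\<integral>\<^sup>+ y\<in>ball w \<delta>. ennreal (U y) \<partial>lborel)
        \<le> (\<integral>\<^sup>+ y. ennreal (S powr (1 - p)) * (ennreal (U y powr p) * indicator (ball z 1) y) \<partial>lborel)"
    proof (rule nn_integral_mono)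
      fix y
      show "ennreal (U y) * indicator (ball w \<delta>) y
          \<le> ennreal (S powr (1 - p)) * (ennreal (U y powr p) * indicator (ball z 1) y)"
      proof (cases "y \<in> ball w \<delta>")
        case True
        have "U y = U y powr (1 - p) * U y powr p"
          using nonneg[of y] by (simp flip: powr_add)
        also have "\<dots> \<le> S powr (1 - p) * U y powr p"
          using U_le(1)[OF True] nonneg[of y] p by (intro mult_right_mono powr_mono2) auto
        finally show ?thesis
          using True U_le(2)[OF True] \<open>S > 0\<close> by (simp add: ennreal_leI flip: ennreal_mult)
      qed simp
    qed
    also have "\<dots> = ennreal (S powr (1 - p)) * J"
      unfolding J_def by (rule nn_integral_cmult) measurable
    finally have le: "ennreal (U w) * ennreal (\<delta> powr m) \<le> ennreal C * (ennreal (S powr (1 - p)) * J)"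
      by (simp add: mult_left_mono)
    show ?thesis
    proof (cases J)
      case top
      then show ?thesis using C by (simp add: J_def ennreal_mult_top)
    next
      case (real j)
      have le': "U w * \<delta> powr m \<le> C * (S powr (1 - p) * j)"
        using le C real nonneg[of w] by (simp add: ennreal_le_iff flip: ennreal_mult)
      have Uw: "U w = M / (2 * \<delta>) powr k"
        using \<delta> rw by (simp add: M_def h_def \<rho>_def)
      have "M = U w * (2 * \<delta>) powr k" using Uw \<delta> by simp
      \<comment> \<open>The factor \<open>M powr (p - 1)\<close> is split off to cancel the
        \<open>M powr (1 - p)\<close> contained in \<open>S powr (1 - p)\<close>; the doubled radius
        leaves the factor \<open>2 powr k\<close>.\<close>
      then have "M powr p = M powr (p - 1) * (U w * (2 * \<delta>) powr k)"
        using True powr_diff[of M p 1] by (metis less_imp_le nonzero_eq_divide_eq order_less_irrefl powr_one)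
      also have "M powr (p - 1) * (U w * (2 * \<delta>) powr k)
          = M powr (p - 1) * 2 powr k * \<delta> powr (k - m) * (U w * \<delta> powr m)"
        using \<delta> by (simp add: powr_mult powr_diff)
      also have "\<dots> \<le> M powr (p - 1) * 2 powr k * \<delta> powr (k - m) * (C * (S powr (1 - p) * j))"
        by (intro mult_left_mono le') auto
      also have "S powr (1 - p) = M powr (1 - p) * \<delta> powr (m - k)"
      proof -
        have "k * (1 - p) = k - m" using k by (simp add: algebra_simps)
        then have "(\<delta> powr k) powr (1 - p) = \<delta> powr (k - m)" by (simp add: powr_powr)
        then show ?thesis
          using True \<delta> unfolding S_def by (simp add: powr_divide powr_diff)
      qed
      also have "M powr (p - 1) * 2 powr k * \<delta> powr (k - m) * (C * (M powr (1 - p) * \<delta> powr (m - k) * j))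
          = (M powr (p - 1) * M powr (1 - p)) * (\<delta> powr (k - m) * \<delta> powr (m - k)) * (C * 2 powr k * j)"
        by (simp add: mult_ac)
      also have "\<dots> = C * 2 powr k * j"
        using True \<delta> by (simp flip: powr_add)
      finally have "M powr p \<le> C * 2 powr k * j" .
      moreover have "U z powr p \<le> M powr p" using Uz nonneg[of z] p by (intro powr_mono2) auto
      ultimately have "ennreal (U z powr p) \<le> ennreal (C * 2 powr k * j)" by (intro ennreal_leI) simp
      also have "\<dots> = ennreal (C * 2 powr k) * J" using C real by (simp add: ennreal_mult)
      finally show ?thesis by (simp add: J_def k_def)
    qed
  qed
qed

text \<open>Cauchy's integral formula on the unit circle. Other centres and radii are reached by
  restricting to a complex line u -> z + u h.\<close>

lemma entire_norm_le_circle_mean: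
  assumes g: "g holomorphic_on UNIV"
  shows "ennreal (norm (g 0)) \<le> (\<integral>\<^sup>+ t\<in>{0..1}. ennreal (norm (g (cis (2 * pi * t)))) \<partial>lborel)"
proof -
  define G where "G t = g (cis (2 * pi * t))" for t
  have circ: "circlepath 0 1 t = cis (2 * pi * t)" for t
    unfolding circlepath cis_conv_exp by (simp add: algebra_simps)
  have "((\<lambda>u. g u / (u - 0)) has_contour_integral (2 * of_real pi * \<i> * g 0)) (circlepath 0 1)"
    by (rule Cauchy_integral_circlepath_simple) (auto intro: holomorphic_on_subset[OF g])
  then have "((\<lambda>t. 2 * of_real pi * \<i> * G t) has_integral (2 * of_real pi * \<i> * g 0)) {0..1}"
    unfolding has_contour_integral_def
  proof (rule has_integral_eq[rotated])
    fix t :: real assume "t \<in> {0..1}"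
    then have "vector_derivative (circlepath 0 1) (at t within {0..1}) = 2 * of_real pi * \<i> * circlepath 0 1 t"
      by (subst vector_derivative_circlepath01) (simp_all, simp add: circlepath)
    then show "g (circlepath 0 1 t) / (circlepath 0 1 t - 0) * vector_derivative (circlepath 0 1) (at t within {0..1})
        = 2 * of_real pi * \<i> * G t"
      by (simp only: circ G_def) simp
  qed
  then have "((\<lambda>t. 1 / (2 * of_real pi * \<i>) * (2 * of_real pi * \<i> * G t)) has_integral
      (1 / (2 * of_real pi * \<i>) * (2 * of_real pi * \<i> * g 0))) {0..1}"
    by (rule has_integral_mult_right)
  moreover have "1 / (2 * of_real pi * \<i>) * (2 * of_real pi * \<i> * u) = u" for u :: complex by simp
  ultimately have int: "(G has_integral g 0) {0..1}" by (simp only:)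
  have "continuous_on UNIV g" using g by (rule holomorphic_on_imp_continuous_on)
  then have "continuous_on {0..1} G"
    unfolding G_def cis_conv_exp by (rule continuous_on_compose2[of UNIV g]) (intro continuous_intros, simp)
  then have si: "set_integrable lborel {0..1} G"
    unfolding set_integrable_def using borel_integrable_compact[of "{0..1::real}" G] by simp
  have "(LINT t:{0..1}|lborel. G t) = g 0"
    using set_borel_integral_eq_integral(2)[OF si] int by (simp add: integral_unique)
  then have "ennreal (norm (g 0)) \<le> (\<integral>\<^sup>+ t. ennreal (norm (indicator {0..1} t *\<^sub>R G t)) \<partial>lborel)"
    using integral_norm_bound_ennreal[OF si[unfolded set_integrable_def]]
    by (simp add: set_lebesgue_integral_def)
  also have "\<dots> = (\<integral>\<^sup>+ t\<in>{0..1}. ennreal (norm (G t)) \<partial>lborel)"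
    by (intro nn_integral_cong) (auto simp: indicator_def)
  finally show ?thesis by (simp add: G_def)
qed

section \<open>Hermite functions and the Bargmann transform\<close>

text \<open>Up to the sign (-1)^n these are the physicists' Hermite polynomials, as they arise from
  differentiating exp(-s^2).\<close>

primrec gauss_deriv_poly :: "nat \<Rightarrow> real poly" where
  "gauss_deriv_poly 0 = 1"
| "gauss_deriv_poly (Suc n) = pderiv (gauss_deriv_poly n) - [:0, 2:] * gauss_deriv_poly n"

lemma gauss_deriv_poly_deriv:
  "((\<lambda>s. poly (gauss_deriv_poly n) s * exp (- s\<^sup>2)) has_real_derivative
     poly (gauss_deriv_poly (Suc n)) s * exp (- s\<^sup>2)) (at s)"
  by (auto intro!: derivative_eq_intros simp: algebra_simps)

lemma higher_deriv_gauss: "(deriv ^^ n) (\<lambda>s::real. exp (- s\<^sup>2)) = (\<lambda>s. poly (gauss_deriv_poly n) s * exp (- s\<^sup>2))"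
proof (induction n)
  case (Suc n)
  show ?case
    using DERIV_imp_deriv[OF gauss_deriv_poly_deriv[of n]] by (simp add: Suc fun_eq_iff)
qed simp

text \<open>The integrand of the two-sided Laplace transform of the n-th derivative of exp(-y^2).
  Hermite coefficients of shifted and modulated Gaussians are such transforms, up to a
  factor.\<close>

definition gauss_laplace_fun :: "nat \<Rightarrow> complex \<Rightarrow> real \<Rightarrow> complex" where
  "gauss_laplace_fun n w y = exp (w * of_real y) * of_real (poly (gauss_deriv_poly n) y * exp (- y\<^sup>2))"

text \<open>Completing the square: half of the Gaussian exponent absorbs the exponential, the other
  half remains for decay.\<close>

lemma norm_gauss_laplace_fun_le:
  "norm (gauss_laplace_fun n w y) \<le> exp ((Re w)\<^sup>2 / 2) * \<bar>poly (gauss_deriv_poly n) y * exp (- y\<^sup>2 / 2)\<bar>"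
proof -
  have "Re w * y - y\<^sup>2 \<le> (Re w)\<^sup>2 / 2 - y\<^sup>2 / 2"
    using zero_le_power2[of "Re w - y"] by (simp add: power2_diff)
  then have "exp (Re w * y) * exp (- y\<^sup>2) \<le> exp ((Re w)\<^sup>2 / 2) * exp (- y\<^sup>2 / 2)"
    by (simp flip: exp_add)
  then have "\<bar>poly (gauss_deriv_poly n) y\<bar> * (exp (Re w * y) * exp (- y\<^sup>2))
      \<le> \<bar>poly (gauss_deriv_poly n) y\<bar> * (exp ((Re w)\<^sup>2 / 2) * exp (- y\<^sup>2 / 2))"
    by (rule mult_left_mono) simp
  then show ?thesis
    by (simp add: gauss_laplace_fun_def norm_mult abs_mult mult_ac)
qed

lemma integrable_poly_gauss: "integrable lborel (\<lambda>y::real. poly q y * exp (- y\<^sup>2 / 2))"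
proof -
  have "integrable lborel (\<lambda>y. \<Sum>k\<le>degree q. sqrt (2 * pi) * coeff q k * (std_normal_density y * y ^ k))"
    by (intro Bochner_Integration.integrable_sum integrable_mult_right integrable_std_normal_moment)
  moreover have "(\<Sum>k\<le>degree q. sqrt (2 * pi) * coeff q k * (std_normal_density y * y ^ k)) = poly q y * exp (- y\<^sup>2 / 2)" for y
    by (simp add: poly_altdef std_normal_density_def sum_distrib_left mult_ac)
  ultimately show ?thesis by simp
qed

lemma continuous_gauss_laplace_fun: "isCont (gauss_laplace_fun n w) y"
  unfolding gauss_laplace_fun_def by (intro continuous_intros)

lemma integrable_gauss_laplace_fun: "integrable lborel (gauss_laplace_fun n w)"
proof (rule Bochner_Integration.integrable_bound)
  show "integrable lborel (\<lambda>y. exp ((Re w)\<^sup>2 / 2) * (poly (gauss_deriv_poly n) y * exp (- y\<^sup>2 / 2)))"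
    by (intro integrable_mult_right integrable_poly_gauss)
  have "gauss_laplace_fun n w \<in> borel_measurable borel"
    by (intro borel_measurable_continuous_onI continuous_at_imp_continuous_on ballI continuous_gauss_laplace_fun)
  then show "gauss_laplace_fun n w \<in> borel_measurable lborel" by simp
  show "AE y in lborel. norm (gauss_laplace_fun n w y)
      \<le> norm (exp ((Re w)\<^sup>2 / 2) * (poly (gauss_deriv_poly n) y * exp (- y\<^sup>2 / 2)))"
    using norm_gauss_laplace_fun_le[of n w] by (simp add: abs_mult)
qed

lemma gauss_laplace_fun_tendsto_0:
  assumes F: "F = at_top \<or> F = at_bot"
  shows "(gauss_laplace_fun n w \<longlongrightarrow> 0) F"
proof -
  have "((\<lambda>y::real. y ^ k * exp (- y\<^sup>2 / 2)) \<longlongrightarrow> 0) at_top" for k by real_asymp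
  moreover have "((\<lambda>y::real. y ^ k * exp (- y\<^sup>2 / 2)) \<longlongrightarrow> 0) at_bot" for k by real_asymp
  ultimately have "((\<lambda>y::real. y ^ k * exp (- y\<^sup>2 / 2)) \<longlongrightarrow> 0) F" for k using F by auto
  then have "((\<lambda>y. \<Sum>k\<le>degree q. coeff q k * (y ^ k * exp (- y\<^sup>2 / 2))) \<longlongrightarrow> (\<Sum>k\<le>degree q. coeff q k * 0)) F" for q
    by (intro tendsto_intros)
  then have "((\<lambda>y. poly q y * exp (- y\<^sup>2 / 2)) \<longlongrightarrow> 0) F" for q
    by (simp add: poly_altdef sum_distrib_right mult.assoc)
  from tendsto_mult_right_zero[OF tendsto_rabs_zero[OF this]]
  have "((\<lambda>y. exp ((Re w)\<^sup>2 / 2) * \<bar>poly (gauss_deriv_poly n) y * exp (- y\<^sup>2 / 2)\<bar>) \<longlongrightarrow> 0) F" .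
  then show ?thesis
    by (rule Lim_null_comparison[rotated]) (intro always_eventually allI norm_gauss_laplace_fun_le)
qed

lemma gauss_laplace_fun_deriv:
  "(gauss_laplace_fun n w has_vector_derivative w * gauss_laplace_fun n w y + gauss_laplace_fun (Suc n) w y) (at y)"
proof -
  have 1: "((\<lambda>y. complex_of_real (poly (gauss_deriv_poly n) y * exp (- y\<^sup>2))) has_vector_derivative
      complex_of_real (poly (gauss_deriv_poly (Suc n)) y * exp (- y\<^sup>2))) (at y)"
    by (rule has_vector_derivative_of_real) (rule gauss_deriv_poly_deriv)
  have "((\<lambda>z. exp (w * z)) has_field_derivative w * exp (w * of_real y)) (at (of_real y))"
    by (auto intro!: derivative_eq_intros)
  then have 2: "((\<lambda>y. exp (w * complex_of_real y)) has_vector_derivative w * exp (w * of_real y)) (at y)"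
    by (rule has_vector_derivative_real_field)
  show ?thesis
    unfolding gauss_laplace_fun_def
    using has_vector_derivative_mult[OF 2 1] by (simp add: algebra_simps)
qed

text \<open>Integration by parts: the derivative of the integrand of order n is w times itself plus
  the one of order n + 1, and its integral vanishes because the integrand decays at both
  ends.\<close>

lemma integral_gauss_laplace_fun_Suc:
  "(LINT y|lborel. gauss_laplace_fun (Suc n) w y) = - w * (LINT y|lborel. gauss_laplace_fun n w y)"
proof -
  let ?F' = "\<lambda>y. w * gauss_laplace_fun n w y + gauss_laplace_fun (Suc n) w y"
  have int: "integrable lborel ?F'"
    by (intro Bochner_Integration.integrable_add integrable_mult_right integrable_gauss_laplace_fun)
  have "(LBINT y=-\<infinity>..\<infinity>. ?F' y) = 0 - 0"
  proof (rule interval_integral_FTC_integrable)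
    show "((gauss_laplace_fun n w \<circ> real_of_ereal) \<longlongrightarrow> 0) (at_right (-\<infinity>))"
      using gauss_laplace_fun_tendsto_0[of at_bot n w] by (simp add: ereal_tendsto_simps)
    show "((gauss_laplace_fun n w \<circ> real_of_ereal) \<longlongrightarrow> 0) (at_left \<infinity>)"
      using gauss_laplace_fun_tendsto_0[of at_top n w] by (simp add: ereal_tendsto_simps)
    show "set_integrable lborel (einterval (-\<infinity>) \<infinity>) ?F'"
      using int by (simp add: set_integrable_def)
    show "isCont ?F' y" for y by (intro continuous_intros continuous_gauss_laplace_fun)
  qed (auto intro: gauss_laplace_fun_deriv)
  then have "(LINT y|lborel. ?F' y) = 0"
    by (simp add: interval_lebesgue_integral_def set_lebesgue_integral_def)
  moreover have "(LINT y|lborel. ?F' y) = w * (LINT y|lborel. gauss_laplace_fun n w y) + (LINT y|lborel. gauss_laplace_fun (Suc n) w y)"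
    by (simp add: integrable_gauss_laplace_fun)
  ultimately show ?thesis by (simp add: eq_neg_iff_add_eq_0 add.commute)
qed

text \<open>After an affine substitution the real part of w only shifts the Gaussian, and the
  imaginary part turns the integral into the characteristic function of the standard normal
  distribution.\<close>

lemma integral_gauss_laplace_fun_0:
  "(LINT y|lborel. gauss_laplace_fun 0 w y) = complex_of_real (sqrt pi) * exp (w\<^sup>2 / 4)"
proof -
  define a b where "a = Re w" and "b = Im w"
  have w: "w = of_real a + \<i> * of_real b" by (simp add: a_def b_def complex_eq_iff)
  \<comment> \<open>The density exp(-y^2) has standard deviation 1 / sqrt 2, and multiplication by
    exp(a y) moves its centre to a / 2; \<open>?k\<close> collects what does not depend on
    x.\<close>
  let ?c = "1 / sqrt 2 :: real" and ?k = "sqrt (2 * pi) * exp (of_real (a\<^sup>2 / 4) + \<i> * of_real (a * b / 2)) :: complex"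
  have eq: "gauss_laplace_fun 0 w (a / 2 + ?c * x) = ?k * (std_normal_density x *\<^sub>R iexp (b * ?c * x))" for x
  proof -
    let ?y = "a / 2 + ?c * x"
    have c2: "(?c * x)\<^sup>2 = x\<^sup>2 / 2" by (simp add: power_mult_distrib power_divide)
    have re: "a * ?y - ?y\<^sup>2 = a\<^sup>2 / 4 - x\<^sup>2 / 2"
      using c2 by (simp add: power2_eq_square algebra_simps)
    have "gauss_laplace_fun 0 w ?y = exp (w * of_real ?y + of_real (- ?y\<^sup>2))"
      by (simp only: gauss_laplace_fun_def gauss_deriv_poly.simps poly_1 mult_1 exp_add exp_of_real)
    also have "w * of_real ?y + of_real (- ?y\<^sup>2) = of_real (a * ?y - ?y\<^sup>2) + \<i> * of_real (b * ?y)"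
      by (simp add: w algebra_simps add_divide_distrib)
    also have "\<dots> = (of_real (a\<^sup>2 / 4) + \<i> * of_real (a * b / 2)) + (of_real (- x\<^sup>2 / 2) + \<i> * of_real (b * ?c * x))"
      unfolding re by (simp add: complex_eq_iff algebra_simps)
    also have "exp \<dots> = exp (of_real (a\<^sup>2 / 4) + \<i> * of_real (a * b / 2)) * (of_real (exp (- x\<^sup>2 / 2)) * iexp (b * ?c * x))"
      by (simp only: exp_add exp_of_real)
    also have "complex_of_real (exp (- x\<^sup>2 / 2)) = sqrt (2 * pi) * of_real (std_normal_density x)"
      by (simp add: std_normal_density_def)
    finally show ?thesis by (simp add: scaleR_conv_of_real mult_ac)
  qed
  have "(LINT x|lborel. std_normal_density x *\<^sub>R iexp (t * x)) = exp (of_real (- t\<^sup>2 / 2))" for t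
  proof -
    have "(LINT x|lborel. std_normal_density x *\<^sub>R iexp (t * x)) = char std_normal_distribution t"
      unfolding char_def by (subst integral_density) (auto intro: normal_density_nonneg)
    then show ?thesis by (simp only: char_std_normal_distribution exp_of_real)
  qed
  note std = this[of "b * ?c"]
  have "(LINT y|lborel. gauss_laplace_fun 0 w y) = \<bar>?c\<bar> *\<^sub>R (LINT x|lborel. gauss_laplace_fun 0 w (a / 2 + ?c * x))"
    by (rule lborel_integral_real_affine) simp
  also have "\<dots> = ?c *\<^sub>R (?k * exp (of_real (- (b * ?c)\<^sup>2 / 2)))"
    unfolding eq by (subst integral_mult_right_zero) (simp only: std abs_of_nonneg, simp)
  also have "\<dots> = complex_of_real (?c * sqrt (2 * pi)) * exp (of_real (a\<^sup>2 / 4) + \<i> * of_real (a * b / 2) + of_real (- (b * ?c)\<^sup>2 / 2))"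
    by (simp only: scaleR_conv_of_real exp_add of_real_mult mult_ac)
  also have "?c * sqrt (2 * pi) = sqrt pi" by (simp add: real_sqrt_mult)
  also have "of_real (a\<^sup>2 / 4) + \<i> * of_real (a * b / 2) + of_real (- (b * ?c)\<^sup>2 / 2) = w\<^sup>2 / 4"
    by (simp add: w complex_eq_iff power2_eq_square field_simps)
  finally show ?thesis by simp
qed

lemma integral_gauss_laplace_fun:
  "(LINT y|lborel. gauss_laplace_fun n w y) = (- w) ^ n * (complex_of_real (sqrt pi) * exp (w\<^sup>2 / 4))"
  by (induction n) (simp_all add: integral_gauss_laplace_fun_0 integral_gauss_laplace_fun_Suc mult.assoc)

section \<open>Hermite coefficients of shifted Gaussians\<close>

lemma norm_vec_squared: "(norm (v :: real ^ 'd))\<^sup>2 = (\<Sum>i\<in>UNIV. (v $ i)\<^sup>2)"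
  by (simp add: norm_vec_def L2_set_def sum_nonneg)

text \<open>Lebesgue measure is a product over the abstract basis, the integrand a product over
  coordinates; the bijection i -> \<open>axis i 1\<close> matches the two index sets.\<close>

lemma integral_prod_vec:
  fixes f :: "'d::finite \<Rightarrow> real \<Rightarrow> complex"
  assumes int: "\<And>i. integrable lborel (f i)"
  shows "(LINT y|lborel. (\<Prod>i\<in>UNIV. f i ((y :: real ^ 'd) $ i))) = (\<Prod>i\<in>UNIV. (LINT t|lborel. f i t))"
proof -
  let ?ax = "\<lambda>i. axis i 1 :: real ^ 'd"
  have inj: "inj ?ax" by (auto simp: inj_on_def axis_eq_axis)
  have Basis: "Basis = ?ax ` UNIV" by (auto simp: Basis_vec_def)
  define ix where "ix = inv ?ax"
  have ix: "ix (?ax i) = i" for i unfolding ix_def by (rule inv_f_f[OF inj])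
  have prodB: "(\<Prod>b\<in>Basis. h (ix b) b) = (\<Prod>i\<in>UNIV. h i (?ax i))" for h :: "'d \<Rightarrow> real ^ 'd \<Rightarrow> complex"
    unfolding Basis using inj by (subst prod.reindex) (auto simp: ix)
  have [measurable]: "f i \<in> borel_measurable borel" for i
    using borel_measurable_integrable[OF int[of i]] by simp
  interpret product_sigma_finite "\<lambda>_ :: real ^ 'd. lborel :: real measure" ..
  have "(LINT y|lborel. (\<Prod>i\<in>UNIV. f i ((y :: real ^ 'd) $ i))) = (LINT y|lborel. (\<Prod>b\<in>Basis. f (ix b) (y \<bullet> b)))"
    by (simp add: prodB[of "\<lambda>i b. f i (_ \<bullet> b)"] inner_axis)
  also have "\<dots> = (LINT y|Pi\<^sub>M Basis (\<lambda>_. lborel). (\<Prod>b\<in>Basis. f (ix b) (y b)))"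
    by (subst lborel_eq, subst integral_distr) (auto simp: inner_sum_left_Basis cong: prod.cong)
  also have "\<dots> = (\<Prod>b\<in>Basis. (LINT t|lborel. f (ix b) t))"
    by (rule product_integral_prod) (auto intro: int)
  also have "\<dots> = (\<Prod>i\<in>UNIV. (LINT t|lborel. f i t))"
    by (rule prodB[of "\<lambda>i b. LINT t|lborel. f i t"])
  finally show ?thesis .
qed

text \<open>The factor exp(t^2 / 2) of the Hermite function cancels the quadratic part of the
  shifted Gaussian. What remains is exp(-x^2 / 2) times the Laplace integrand at w = x + i \<xi>,
  and the sign in the Rodrigues formula turns (-w)^n into w^n.\<close>

lemma hermite_fun1_shifted_gauss:
  fixes x \<xi> :: real and n :: nat
  defines "w \<equiv> Complex x \<xi>"
  defines "g \<equiv> \<lambda>t. exp (\<i> * complex_of_real (t * \<xi>)) * complex_of_real (pi powr (- 1 / 4) * exp (- (t - x)\<^sup>2 / 2)) *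
      complex_of_real (hermite_fun1 n t)"
  shows "integrable lborel g"
    "(LINT t|lborel. g t) = w ^ n / complex_of_real (sqrt (2 ^ n * fact n)) * exp (w\<^sup>2 / 4 - of_real (x\<^sup>2 / 2))"
proof -
  define c where "c = (- 1) ^ n / sqrt (2 ^ n * fact n)"
  have pi_half: "pi powr (- 1 / 4) * pi powr (- 1 / 4) = 1 / sqrt pi"
  proof -
    have "pi powr (- 1 / 4) * pi powr (- 1 / 4) = pi powr (- (1 / 2))" by (subst powr_add[symmetric]) simp
    then show ?thesis by (simp only: powr_minus_divide) (simp add: powr_half_sqrt)
  qed
  have eq: "g = (\<lambda>t. complex_of_real (c * exp (- x\<^sup>2 / 2) / sqrt pi) * gauss_laplace_fun n w t)"
  proof
    fix t :: real
    have sq: "exp (- (t - x)\<^sup>2 / 2) * exp (t\<^sup>2 / 2) = exp (- x\<^sup>2 / 2) * exp (x * t)"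
    proof -
      have "- (t - x)\<^sup>2 / 2 + t\<^sup>2 / 2 = - x\<^sup>2 / 2 + x * t" by (simp add: power2_eq_square field_simps)
      then show ?thesis by (simp only: exp_add[symmetric])
    qed
    have ex: "exp (w * of_real t) = of_real (exp (x * t)) * exp (\<i> * complex_of_real (t * \<xi>))"
    proof -
      have "w * of_real t = of_real (x * t) + \<i> * complex_of_real (t * \<xi>)" by (simp add: w_def complex_eq_iff)
      then show ?thesis by (simp only: exp_add exp_of_real)
    qed
    have "pi powr (- 1 / 4) * exp (- (t - x)\<^sup>2 / 2) * hermite_fun1 n t
        = (pi powr (- 1 / 4) * pi powr (- 1 / 4)) * c * (exp (- (t - x)\<^sup>2 / 2) * exp (t\<^sup>2 / 2)) * (poly (gauss_deriv_poly n) t * exp (- t\<^sup>2))"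
      by (simp add: hermite_fun1_def higher_deriv_gauss c_def)
    also have "\<dots> = (c * exp (- x\<^sup>2 / 2) / sqrt pi) * (exp (x * t) * (poly (gauss_deriv_poly n) t * exp (- t\<^sup>2)))"
      unfolding sq pi_half by simp
    finally have real_eq: "pi powr (- 1 / 4) * exp (- (t - x)\<^sup>2 / 2) * hermite_fun1 n t
        = (c * exp (- x\<^sup>2 / 2) / sqrt pi) * (exp (x * t) * (poly (gauss_deriv_poly n) t * exp (- t\<^sup>2)))" .
    have "g t = exp (\<i> * complex_of_real (t * \<xi>)) * complex_of_real (pi powr (- 1 / 4) * exp (- (t - x)\<^sup>2 / 2) * hermite_fun1 n t)"
      unfolding g_def by (subst of_real_mult[of _ "hermite_fun1 n t"]) (rule mult.assoc)
    also note real_eq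
    finally show "g t = complex_of_real (c * exp (- x\<^sup>2 / 2) / sqrt pi) * gauss_laplace_fun n w t"
      unfolding gauss_laplace_fun_def ex by (simp only: of_real_mult mult_ac)
  qed
  show "integrable lborel g"
    unfolding eq by (intro integrable_mult_right integrable_gauss_laplace_fun)
  have "(LINT t|lborel. g t) = complex_of_real (c * exp (- x\<^sup>2 / 2) / sqrt pi) * ((- w) ^ n * (complex_of_real (sqrt pi) * exp (w\<^sup>2 / 4)))"
    unfolding eq by (simp add: integral_gauss_laplace_fun)
  also have "\<dots> = complex_of_real c * (- w) ^ n * (exp (w\<^sup>2 / 4) * of_real (exp (- x\<^sup>2 / 2)))"
    by simp
  also have "complex_of_real c * (- w) ^ n = ((- 1) * (- w)) ^ n / complex_of_real (sqrt (2 ^ n * fact n))"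
    unfolding power_mult_distrib by (simp add: c_def)
  also have "(- 1) * (- w) = w" by simp
  also have "exp (w\<^sup>2 / 4) * of_real (exp (- x\<^sup>2 / 2)) = exp (w\<^sup>2 / 4 - of_real (x\<^sup>2 / 2))"
  proof -
    have "w\<^sup>2 / 4 - complex_of_real (x\<^sup>2 / 2) = w\<^sup>2 / 4 + complex_of_real (- x\<^sup>2 / 2)" by simp
    then show ?thesis by (simp only: exp_add exp_of_real)
  qed
  finally show "(LINT t|lborel. g t) = w ^ n / complex_of_real (sqrt (2 ^ n * fact n)) * exp (w\<^sup>2 / 4 - of_real (x\<^sup>2 / 2))" .
qed

lemma hermite_coeff_shifted_gauss:
  fixes x \<xi> :: "real ^ 'd"
  shows "hermite_coeff (\<lambda>y. exp (\<i> * complex_of_real (y \<bullet> \<xi>)) * complex_of_real (gauss_window (y - x))) \<alpha>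
    = (\<Prod>i\<in>UNIV. Complex (x $ i) (\<xi> $ i) ^ (\<alpha> $ i) / complex_of_real (sqrt (2 ^ (\<alpha> $ i) * fact (\<alpha> $ i))) *
        exp ((Complex (x $ i) (\<xi> $ i))\<^sup>2 / 4 - of_real ((x $ i)\<^sup>2 / 2)))"
proof -
  define g where "g i t = exp (\<i> * complex_of_real (t * \<xi> $ i)) * complex_of_real (pi powr (- 1 / 4) * exp (- (t - x $ i)\<^sup>2 / 2)) *
      complex_of_real (hermite_fun1 (\<alpha> $ i) t)" for i t
  have g: "integrable lborel (g i)" for i
    unfolding g_def by (rule hermite_fun1_shifted_gauss)
  have [measurable]: "g i \<in> borel_measurable borel" for i
    using borel_measurable_integrable[OF g[of i]] by simp
  have eq: "exp (\<i> * complex_of_real (y \<bullet> \<xi>)) * complex_of_real (gauss_window (y - x)) * complex_of_real (hermite_fun \<alpha> y)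
      = (\<Prod>i\<in>UNIV. g i (y $ i))" for y :: "real ^ 'd"
  proof -
    have 1: "exp (\<i> * complex_of_real (y \<bullet> \<xi>)) = (\<Prod>i\<in>UNIV. exp (\<i> * complex_of_real (y $ i * \<xi> $ i)))"
      by (simp add: inner_vec_def sum_distrib_left exp_sum)
    have 2: "gauss_window (y - x) = (\<Prod>i\<in>UNIV. pi powr (- 1 / 4) * exp (- (y $ i - x $ i)\<^sup>2 / 2))"
    proof -
      have "pi powr (- real CARD('d) / 4) = (pi powr (- 1 / 4)) ^ CARD('d)"
        by (simp add: powr_power)
      moreover have "exp (- (norm (y - x))\<^sup>2 / 2) = (\<Prod>i\<in>UNIV. exp (- (y $ i - x $ i)\<^sup>2 / 2))"
        by (simp add: norm_vec_squared sum_negf[symmetric] sum_divide_distrib exp_sum[symmetric])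
      ultimately show ?thesis by (simp add: gauss_window_def prod.distrib)
    qed
    show ?thesis
      unfolding 1 2 hermite_fun_def g_def by (simp only: of_real_prod prod.distrib of_real_mult)
  qed
  have m: "(\<lambda>y. \<Prod>i\<in>UNIV. g i ((y :: real ^ 'd) $ i)) \<in> borel_measurable lborel"
    by (intro borel_measurable_prod) measurable
  have "hermite_coeff (\<lambda>y. exp (\<i> * complex_of_real (y \<bullet> \<xi>)) * complex_of_real (gauss_window (y - x))) \<alpha>
      = (LINT y|lborel. (\<Prod>i\<in>UNIV. g i (y $ i)))"
    unfolding hermite_coeff_def eq by (rule integral_completion[OF m])
  also have "\<dots> = (\<Prod>i\<in>UNIV. (LINT t|lborel. g i t))" by (rule integral_prod_vec[OF g])
  also have "\<dots> = (\<Prod>i\<in>UNIV. Complex (x $ i) (\<xi> $ i) ^ (\<alpha> $ i) / complex_of_real (sqrt (2 ^ (\<alpha> $ i) * fact (\<alpha> $ i))) *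
        exp ((Complex (x $ i) (\<xi> $ i))\<^sup>2 / 4 - of_real ((x $ i)\<^sup>2 / 2)))"
    unfolding g_def by (simp only: hermite_fun1_shifted_gauss(2))
  finally show ?thesis .
qed

text \<open>The Bargmann transform of \<open>f\<close> at \<open>\<zeta> / sqrt 2\<close>.\<close>

definition bargmann_term :: "(nat ^ 'd \<Rightarrow> complex) \<Rightarrow> ('d \<Rightarrow> complex) \<Rightarrow> nat ^ 'd \<Rightarrow> complex" where
  "bargmann_term f \<zeta> \<alpha> = f \<alpha> * (\<Prod>i\<in>UNIV. \<zeta> i ^ (\<alpha> $ i) / complex_of_real (sqrt (2 ^ (\<alpha> $ i) * fact (\<alpha> $ i))))"

definition bargmann :: "(nat ^ 'd \<Rightarrow> complex) \<Rightarrow> ('d \<Rightarrow> complex) \<Rightarrow> complex" where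
  "bargmann f \<zeta> = (\<Sum>\<^sub>\<infinity>\<alpha>. bargmann_term f \<zeta> \<alpha>)"

text \<open>The pairing conjugates the coefficients, so x - i \<xi> enters the Bargmann series. The
  exponential factors do not depend on \<alpha> and leave the sum; since Re (w^2) = x^2 - \<xi>^2,
  their modulus is the Gaussian in (x, \<xi>).\<close>

lemma norm_stft:
  fixes x \<xi> :: "real ^ 'd"
  shows "norm (stft f (x, \<xi>)) = (2 * pi) powr (- real CARD('d) / 2) * exp (- (norm (x, \<xi>))\<^sup>2 / 4) *
    norm (bargmann f (\<lambda>i. Complex (x $ i) (- \<xi> $ i)))"
proof -
  define G where "G = (\<Prod>i\<in>UNIV. exp (cnj ((Complex (x $ i) (\<xi> $ i))\<^sup>2 / 4 - of_real ((x $ i)\<^sup>2 / 2))))"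
  have "hermite_pairing f (\<lambda>y. exp (\<i> * complex_of_real (y \<bullet> \<xi>)) * complex_of_real (gauss_window (y - x)))
      = (\<Sum>\<^sub>\<infinity>\<alpha>. bargmann_term f (\<lambda>i. Complex (x $ i) (- \<xi> $ i)) \<alpha> * G)"
    unfolding hermite_pairing_def hermite_coeff_shifted_gauss
  proof (rule infsum_cong)
    fix \<alpha> :: "nat ^ 'd"
    have [simp]: "cnj (Complex a b) = Complex a (- b)" for a b by (simp add: complex_eq_iff)
    show "f \<alpha> * cnj (\<Prod>i\<in>UNIV. Complex (x $ i) (\<xi> $ i) ^ (\<alpha> $ i) / complex_of_real (sqrt (2 ^ (\<alpha> $ i) * fact (\<alpha> $ i))) *
        exp ((Complex (x $ i) (\<xi> $ i))\<^sup>2 / 4 - of_real ((x $ i)\<^sup>2 / 2)))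
      = bargmann_term f (\<lambda>i. Complex (x $ i) (- \<xi> $ i)) \<alpha> * G"
      unfolding bargmann_term_def G_def
      by (simp only: cnj_prod complex_cnj_mult complex_cnj_divide complex_cnj_power exp_cnj
          complex_cnj_complex_of_real prod.distrib mult.assoc \<open>\<And>a b. cnj (Complex a b) = Complex a (- b)\<close>)
  qed
  also have "\<dots> = bargmann f (\<lambda>i. Complex (x $ i) (- \<xi> $ i)) * G"
    unfolding bargmann_def by (rule infsum_cmult_left')
  finally have pair: "hermite_pairing f (\<lambda>y. exp (\<i> * complex_of_real (y \<bullet> \<xi>)) * complex_of_real (gauss_window (y - x)))
      = bargmann f (\<lambda>i. Complex (x $ i) (- \<xi> $ i)) * G" .
  have "norm G = (\<Prod>i\<in>UNIV. exp (- ((x $ i)\<^sup>2 + (\<xi> $ i)\<^sup>2) / 4))"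
    unfolding G_def prod_norm[symmetric]
    by (intro prod.cong refl) (simp add: power2_eq_square field_simps)
  also have "\<dots> = exp (- (norm (x, \<xi>))\<^sup>2 / 4)"
  proof -
    have "(norm (x, \<xi>))\<^sup>2 = (norm x)\<^sup>2 + (norm \<xi>)\<^sup>2" by (simp add: norm_Pair)
    also have "\<dots> = (\<Sum>i\<in>UNIV. (x $ i)\<^sup>2 + (\<xi> $ i)\<^sup>2)" by (simp add: norm_vec_squared sum.distrib)
    finally have "- (norm (x, \<xi>))\<^sup>2 / 4 = (\<Sum>i\<in>UNIV. - ((x $ i)\<^sup>2 + (\<xi> $ i)\<^sup>2) / 4)"
      by (simp only: sum_negf[symmetric] sum_divide_distrib)
    then show ?thesis by (simp only: exp_sum[OF finite])
  qed
  finally show ?thesis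
    by (simp add: stft_def pair norm_mult)
qed

section \<open>Convergence and holomorphy of the Bargmann series\<close>

lemma sqrt_prod: "sqrt (\<Prod>i\<in>A. f i) = (\<Prod>i\<in>A. sqrt (f i))"
  by (induction A rule: infinite_finite_induct) (auto simp: real_sqrt_mult)

lemma sum_prod_vec_Collect:
  fixes g :: "nat \<Rightarrow> real"
  assumes S: "finite S"
  shows "finite {\<alpha> :: nat ^ 'd. \<forall>i. \<alpha> $ i \<in> S}"
    "(\<Sum>\<alpha>\<in>{\<alpha> :: nat ^ 'd. \<forall>i. \<alpha> $ i \<in> S}. \<Prod>i\<in>UNIV. g (\<alpha> $ i)) = (\<Sum>k\<in>S. g k) ^ CARD('d)"
proof -
  let ?A = "{\<alpha> :: nat ^ 'd. \<forall>i. \<alpha> $ i \<in> S}"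
  have bij: "bij_betw vec_nth ?A (PiE UNIV (\<lambda>_. S))"
    by (rule bij_betw_byWitness[where f' = vec_lambda]) (auto simp: vec_lambda_inverse)
  show "finite ?A" using bij S by (simp add: bij_betw_finite finite_PiE)
  have "(\<Sum>\<alpha>\<in>?A. \<Prod>i\<in>UNIV. g (\<alpha> $ i)) = (\<Sum>h\<in>PiE UNIV (\<lambda>_. S). \<Prod>i\<in>(UNIV::'d set). g (h i))"
    by (rule sum.reindex_bij_betw[OF bij])
  also have "\<dots> = (\<Prod>i\<in>(UNIV::'d set). \<Sum>k\<in>S. g k)"
    using S by (subst prod_sum_PiE) auto
  finally show "(\<Sum>\<alpha>\<in>?A. \<Prod>i\<in>UNIV. g (\<alpha> $ i)) = (\<Sum>k\<in>S. g k) ^ CARD('d)" by simp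
qed

text \<open>A finite set of multi-indices lies in a box, and the sum over the box is a product of
  partial geometric sums, each at most 2.\<close>

lemma summable_power_mi_length: "(\<lambda>\<alpha> :: nat ^ 'd. (1 / 2 :: real) ^ mi_length \<alpha>) summable_on UNIV"
proof (rule nonneg_bdd_above_summable_on)
  show "bdd_above (sum (\<lambda>\<alpha> :: nat ^ 'd. (1 / 2 :: real) ^ mi_length \<alpha>) ` {F. F \<subseteq> UNIV \<and> finite F})"
  proof (rule bdd_aboveI2)
    fix F :: "(nat ^ 'd) set" assume "F \<in> {F. F \<subseteq> UNIV \<and> finite F}"
    then have F: "finite F" by simp
    define S where "S = (\<Union>\<alpha>\<in>F. range (\<lambda>i. \<alpha> $ i))"
    have S: "finite S" using F by (simp add: S_def)
    have "sum (\<lambda>\<alpha> :: nat ^ 'd. (1 / 2 :: real) ^ mi_length \<alpha>) F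
        \<le> sum (\<lambda>\<alpha>. (1 / 2) ^ mi_length \<alpha>) {\<alpha> :: nat ^ 'd. \<forall>i. \<alpha> $ i \<in> S}"
    proof (rule sum_mono2)
      show "finite {\<alpha> :: nat ^ 'd. \<forall>i. \<alpha> $ i \<in> S}" by (rule sum_prod_vec_Collect(1)[OF S])
    qed (auto simp: S_def)
    also have "\<dots> = (\<Sum>k\<in>S. (1 / 2 :: real) ^ k) ^ CARD('d)"
      using sum_prod_vec_Collect(2)[OF S, of "\<lambda>k. (1 / 2) ^ k"] by (simp add: mi_length_def power_sum)
    also have "\<dots> \<le> 2 ^ CARD('d)"
    proof (intro power_mono sum_nonneg)
      have "(\<Sum>k\<in>S. (1 / 2 :: real) ^ k) \<le> (\<Sum>k. (1 / 2) ^ k)"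
        using S by (intro sum_le_suminf) auto
      then show "(\<Sum>k\<in>S. (1 / 2 :: real) ^ k) \<le> 2" by (simp add: suminf_geometric)
    qed auto
    finally show "sum (\<lambda>\<alpha> :: nat ^ 'd. (1 / 2 :: real) ^ mi_length \<alpha>) F \<le> 2 ^ CARD('d)" .
  qed
qed simp

text \<open>The square root of \<alpha>! allowed in f cancels against the denominators of the
  series. As r is free in the definition of \<open>H_flat_dual\<close>, it can be matched to R,
  which leaves a geometric majorant for the Weierstrass test.\<close>

lemma bargmann_uniform_limit:
  fixes f :: "nat ^ 'd \<Rightarrow> complex"
  assumes f: "f \<in> H_flat_dual" and bound: "\<And>y i. y \<in> Y \<Longrightarrow> norm (\<zeta> y i) \<le> R"
  shows "uniform_limit Y (\<lambda>A y. \<Sum>\<alpha>\<in>A. bargmann_term f (\<zeta> y) \<alpha>) (\<lambda>y. bargmann f (\<zeta> y)) (finite_subsets_at_top UNIV)"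
proof -
  \<comment> \<open>Chosen for r \<bar>R\<bar> \<le> 1 / 2; the added 1 avoids division by zero when
    R = 0.\<close>
  define r where "r = 1 / (2 * (\<bar>R\<bar> + 1))"
  have r: "r > 0" "r * \<bar>R\<bar> \<le> 1 / 2" by (auto simp: r_def field_simps)
  then obtain C where C: "C > 0" "\<And>\<alpha>. norm (f \<alpha>) \<le> C * (r ^ mi_length \<alpha> * sqrt (mi_fact \<alpha>))"
    using f unfolding H_flat_dual_def by blast
  show ?thesis
    unfolding bargmann_def
  proof (rule Weierstrass_m_test_general)
    show "(\<lambda>\<alpha>. C * (1 / 2) ^ mi_length \<alpha>) summable_on (UNIV :: (nat ^ 'd) set)"
      by (intro summable_on_cmult_right summable_power_mi_length)
    fix \<alpha> :: "nat ^ 'd" and y assume y: "y \<in> Y"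
    have fact_pos: "mi_fact \<alpha> > 0" unfolding mi_fact_def by (intro prod_pos) auto
    have "norm (\<Prod>i\<in>UNIV. \<zeta> y i ^ (\<alpha> $ i) / complex_of_real (sqrt (2 ^ (\<alpha> $ i) * fact (\<alpha> $ i))))
        \<le> (\<Prod>i\<in>UNIV. \<bar>R\<bar> ^ (\<alpha> $ i) / sqrt (fact (\<alpha> $ i)))"
      unfolding prod_norm[symmetric]
    proof (intro prod_mono conjI)
      fix i
      have le: "norm (\<zeta> y i) \<le> \<bar>R\<bar>" using bound[OF y, of i] by simp
      have "1 * fact (\<alpha> $ i) \<le> 2 ^ (\<alpha> $ i) * (fact (\<alpha> $ i) :: real)"
        by (intro mult_right_mono) auto
      then have "sqrt (fact (\<alpha> $ i)) \<le> sqrt (2 ^ (\<alpha> $ i) * fact (\<alpha> $ i))" by simp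
      then show "norm (\<zeta> y i ^ (\<alpha> $ i) / complex_of_real (sqrt (2 ^ (\<alpha> $ i) * fact (\<alpha> $ i)))) \<le> \<bar>R\<bar> ^ (\<alpha> $ i) / sqrt (fact (\<alpha> $ i))"
        using le unfolding norm_divide norm_power
        by (intro frac_le power_mono) (auto simp: abs_mult)
    qed simp
    also have "\<dots> = \<bar>R\<bar> ^ mi_length \<alpha> / sqrt (mi_fact \<alpha>)"
      by (simp add: mi_length_def mi_fact_def prod_dividef power_sum sqrt_prod)
    finally have "norm (bargmann_term f (\<zeta> y) \<alpha>) \<le> (C * (r ^ mi_length \<alpha> * sqrt (mi_fact \<alpha>))) * (\<bar>R\<bar> ^ mi_length \<alpha> / sqrt (mi_fact \<alpha>))"
      unfolding bargmann_term_def norm_mult using C fact_pos r by (intro mult_mono) auto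
    also have "\<dots> = C * (r * \<bar>R\<bar>) ^ mi_length \<alpha>"
      using fact_pos by (simp add: power_mult_distrib)
    also have "\<dots> \<le> C * (1 / 2) ^ mi_length \<alpha>"
      using C r by (intro mult_left_mono power_mono) auto
    finally show "norm (bargmann_term f (\<zeta> y) \<alpha>) \<le> C * (1 / 2) ^ mi_length \<alpha>" .
  qed
qed

text \<open>On every disc the partial sums are polynomials in u that converge uniformly.\<close>

lemma bargmann_entire_on_line:
  fixes f :: "nat ^ 'd \<Rightarrow> complex"
  assumes f: "f \<in> H_flat_dual"
  shows "(\<lambda>u. bargmann f (\<lambda>i. \<zeta> i + u * \<eta> i)) holomorphic_on UNIV"
proof -
  have "(\<lambda>u. bargmann f (\<lambda>i. \<zeta> i + u * \<eta> i)) holomorphic_on ball 0 r" if r: "r > 0" for r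
  proof -
    define R where "R = (\<Sum>i\<in>UNIV. norm (\<zeta> i) + r * norm (\<eta> i))"
    have "norm (\<zeta> i + u * \<eta> i) \<le> R" if "u \<in> cball 0 r" for u i
    proof -
      have "norm (\<zeta> i + u * \<eta> i) \<le> norm (\<zeta> i) + r * norm (\<eta> i)"
        using that by (intro norm_triangle_le) (auto simp: norm_mult intro!: add_mono mult_right_mono)
      also have "\<dots> \<le> R"
        unfolding R_def using r by (intro member_le_sum) auto
      finally show ?thesis .
    qed
    from bargmann_uniform_limit[OF f, where Y = "cball 0 r" and \<zeta> = "\<lambda>u i. \<zeta> i + u * \<eta> i", OF this]
    have ul: "uniform_limit (cball 0 r) (\<lambda>A u. \<Sum>\<alpha>\<in>A. bargmann_term f (\<lambda>i. \<zeta> i + u * \<eta> i) \<alpha>)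
        (\<lambda>u. bargmann f (\<lambda>i. \<zeta> i + u * \<eta> i)) (finite_subsets_at_top UNIV)" .
    have hol: "(\<lambda>u. \<Sum>\<alpha>\<in>A. bargmann_term f (\<lambda>i. \<zeta> i + u * \<eta> i) \<alpha>) holomorphic_on T" for A T
      unfolding bargmann_term_def by (intro holomorphic_intros) auto
    show ?thesis
    proof (rule holomorphic_uniform_limit[OF _ ul])
      show "eventually (\<lambda>A. continuous_on (cball 0 r) (\<lambda>u. \<Sum>\<alpha>\<in>A. bargmann_term f (\<lambda>i. \<zeta> i + u * \<eta> i) \<alpha>) \<and>
          (\<lambda>u. \<Sum>\<alpha>\<in>A. bargmann_term f (\<lambda>i. \<zeta> i + u * \<eta> i) \<alpha>) holomorphic_on ball 0 r) (finite_subsets_at_top UNIV)"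
        using hol by (intro always_eventually allI conjI holomorphic_on_imp_continuous_on)
    qed auto
  qed
  then have "(\<lambda>u. bargmann f (\<lambda>i. \<zeta> i + u * \<eta> i)) field_differentiable at z" for z
    using add_nonneg_pos[OF norm_ge_zero zero_less_one, of z]
    by (intro holomorphic_on_imp_differentiable_at[of _ "ball 0 (norm z + 1)"]) auto
  then show ?thesis by (simp add: holomorphic_on_def field_differentiable_at_within)
qed

text \<open>The isometric identification of phase space with complex vectors x - i \<xi>, in which
  the Bargmann series of the transform is holomorphic.\<close>

abbreviation complex_coords :: "(real ^ 'd) \<times> (real ^ 'd) \<Rightarrow> 'd \<Rightarrow> complex" where
  "complex_coords z \<equiv> \<lambda>i. Complex (fst z $ i) (- snd z $ i)"

lemma norm_complex_coords_le: "norm (complex_coords z i) \<le> norm z"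
proof -
  have "(fst z $ i)\<^sup>2 + (snd z $ i)\<^sup>2 \<le> (norm (fst z))\<^sup>2 + (norm (snd z))\<^sup>2"
    unfolding norm_vec_squared by (intro add_mono member_le_sum) auto
  then show ?thesis
    by (cases z) (simp add: norm_Pair cmod_def)
qed

lemma norm_squared_complex_coords: "(norm z)\<^sup>2 = (\<Sum>i\<in>UNIV. (norm (complex_coords z i))\<^sup>2)"
  by (cases z) (simp add: norm_Pair norm_vec_squared cmod_power2 sum.distrib sum_nonneg add_nonneg_nonneg)

lemma continuous_norm_stft:
  fixes f :: "nat ^ 'd \<Rightarrow> complex"
  assumes f: "f \<in> H_flat_dual"
  shows "continuous_on UNIV (\<lambda>z. norm (stft f z))"
proof -
  have "continuous_on (ball 0 R) (\<lambda>z. bargmann f (complex_coords z))" for R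
  proof (rule uniform_limit_theorem)
    show "uniform_limit (ball 0 R) (\<lambda>A z. \<Sum>\<alpha>\<in>A. bargmann_term f (complex_coords z) \<alpha>)
        (\<lambda>z. bargmann f (complex_coords z)) (finite_subsets_at_top UNIV)"
    proof (rule bargmann_uniform_limit[OF f])
      fix z :: "(real ^ 'd) \<times> (real ^ 'd)" and i assume "z \<in> ball 0 R"
      then show "norm (complex_coords z i) \<le> R"
        using norm_complex_coords_le[of z i] by (meson mem_ball_0 less_imp_le order_trans)
    qed
    have "continuous_on (ball 0 R) (\<lambda>z. \<Sum>\<alpha>\<in>A. bargmann_term f (complex_coords z) \<alpha>)" for A
      unfolding bargmann_term_def Complex_eq by (intro continuous_intros) simp
    then show "\<forall>\<^sub>F A in finite_subsets_at_top UNIV. continuous_on (ball 0 R) (\<lambda>z. \<Sum>\<alpha>\<in>A. bargmann_term f (complex_coords z) \<alpha>)"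
      by simp
  qed simp
  then have "isCont (\<lambda>z. bargmann f (complex_coords z)) z" for z
    by (rule continuous_on_interior[of "ball 0 (norm z + 1)"]) (auto intro: add_nonneg_pos)
  then have "continuous_on UNIV (\<lambda>z. bargmann f (complex_coords z))"
    by (simp add: continuous_at_imp_continuous_on)
  moreover have "norm (stft f z) = (2 * pi) powr (- real CARD('d) / 2) * exp (- (norm z)\<^sup>2 / 4) * norm (bargmann f (complex_coords z))" for z :: "(real ^ 'd) \<times> (real ^ 'd)"
    using norm_stft[of f "fst z" "snd z"] by simp
  ultimately show ?thesis by (simp only:) (intro continuous_intros, simp)
qed

text \<open>The Gaussian factor spoils holomorphy, but on a circle around z it expands as |z + c
  h|^2 = |z|^2 + 2 Re (c s) + |h|^2. The cross term is the real part of a linear function and is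
  absorbed into a holomorphic exponential; the last term is constant on the circle and accounts for
  exp(|h|^2 / 4).\<close>

lemma norm_stft_le_rotation_mean:
  fixes z h :: "(real ^ 'd) \<times> (real ^ 'd)"
  assumes f: "f \<in> H_flat_dual"
  shows "ennreal (norm (stft f z)) \<le> ennreal (exp ((norm h)\<^sup>2 / 4)) *
      (\<integral>\<^sup>+ t\<in>{0..1}. ennreal (norm (stft f (z + plane_rot (cos (2 * pi * t)) (- sin (2 * pi * t)) h))) \<partial>lborel)"
proof -
  define R where "R t = plane_rot (cos (2 * pi * t)) (- sin (2 * pi * t)) h" for t
  define k where "k = (2 * pi) powr (- real CARD('d) / 2)"
  have stft: "norm (stft f w) = k * exp (- (norm w)\<^sup>2 / 4) * norm (bargmann f (complex_coords w))" for w
    using norm_stft[of f "fst w" "snd w"] by (simp add: k_def)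
  have k: "k > 0" by (simp add: k_def)
  define s where "s = (\<Sum>i\<in>UNIV. complex_coords h i * cnj (complex_coords z i))"
  \<comment> \<open>The exponential reproduces the cross term -Re (u s) / 2 of the Gaussian exponent
    and equals 1 at u = 0.\<close>
  define g where "g u = bargmann f (\<lambda>i. complex_coords z i + u * complex_coords h i) * exp (- (u * s) / 2)" for u
  have "g holomorphic_on UNIV"
    unfolding g_def by (intro holomorphic_intros bargmann_entire_on_line f) auto
  from entire_norm_le_circle_mean[OF this]
  have circ: "ennreal (norm (g 0)) \<le> (\<integral>\<^sup>+ t\<in>{0..1}. ennreal (norm (g (cis (2 * pi * t)))) \<partial>lborel)" .
  have g0: "norm (stft f z) = k * exp (- (norm z)\<^sup>2 / 4) * norm (g 0)"
    by (simp add: stft g_def)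
  have gt: "k * exp (- (norm z)\<^sup>2 / 4) * norm (g (cis (2 * pi * t))) = exp ((norm h)\<^sup>2 / 4) * norm (stft f (z + R t))" for t
  proof -
    define c where "c = cis (2 * pi * t)"
    \<comment> \<open>The negated sine makes the rotation act as multiplication by
      \<open>cis\<close> in the conjugated coordinates.\<close>
    have coords: "complex_coords (z + R t) i = complex_coords z i + c * complex_coords h i" for i
      by (simp add: complex_eq_iff R_def plane_rot_def c_def algebra_simps)
    have "(norm (z + R t))\<^sup>2 = (\<Sum>i\<in>UNIV. (norm (complex_coords z i))\<^sup>2 + 2 * Re (c * (complex_coords h i * cnj (complex_coords z i))) + (norm (complex_coords h i))\<^sup>2)"
      unfolding norm_squared_complex_coords
    proof (rule sum.cong)
      fix i
      have add: "(norm (a + d))\<^sup>2 = (norm a)\<^sup>2 + 2 * Re (d * cnj a) + (norm d)\<^sup>2" for a d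
        unfolding cmod_power2 by (simp add: power2_eq_square algebra_simps)
      have "norm c = 1" by (simp add: c_def)
      then have "(norm (a + c * b))\<^sup>2 = (norm a)\<^sup>2 + 2 * Re (c * (b * cnj a)) + (norm b)\<^sup>2" for a b
        unfolding add[of a "c * b"] by (simp only: norm_mult mult_1 mult.assoc)
      then show "(norm (complex_coords (z + R t) i))\<^sup>2 = (norm (complex_coords z i))\<^sup>2 + 2 * Re (c * (complex_coords h i * cnj (complex_coords z i))) + (norm (complex_coords h i))\<^sup>2"
        unfolding coords by blast
    qed simp
    also have "\<dots> = (norm z)\<^sup>2 + 2 * Re (c * s) + (norm h)\<^sup>2"
      unfolding norm_squared_complex_coords s_def
      by (simp only: sum.distrib sum_distrib_left[symmetric] Re_sum[symmetric])
    finally have sum: "(norm (z + R t))\<^sup>2 = (norm z)\<^sup>2 + 2 * Re (c * s) + (norm h)\<^sup>2" .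
    have "Re (- u / 2) = - Re u / 2" for u by simp
    from sum this[of "c * s"] have sq: "- (norm z)\<^sup>2 / 4 + Re (- (c * s) / 2) = (norm h)\<^sup>2 / 4 + - (norm (z + R t))\<^sup>2 / 4"
      by linarith
    have "exp (- (norm z)\<^sup>2 / 4) * norm (exp (- (c * s) / 2)) = exp ((norm h)\<^sup>2 / 4) * exp (- (norm (z + R t))\<^sup>2 / 4)"
      unfolding norm_exp_eq_Re exp_add[symmetric] sq ..
    then have "k * (exp (- (norm z)\<^sup>2 / 4) * norm (exp (- (c * s) / 2))) * norm (bargmann f (complex_coords (z + R t)))
        = k * (exp ((norm h)\<^sup>2 / 4) * exp (- (norm (z + R t))\<^sup>2 / 4)) * norm (bargmann f (complex_coords (z + R t)))"
      by (simp only:)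
    then show ?thesis
      unfolding stft g_def c_def[symmetric] coords[symmetric] norm_mult by (simp only: mult_ac)
  qed
  have "ennreal (norm (stft f z)) = ennreal (k * exp (- (norm z)\<^sup>2 / 4)) * ennreal (norm (g 0))"
    unfolding g0 using k by (subst ennreal_mult) auto
  also have "\<dots> \<le> ennreal (k * exp (- (norm z)\<^sup>2 / 4)) * (\<integral>\<^sup>+ t\<in>{0..1}. ennreal (norm (g (cis (2 * pi * t)))) \<partial>lborel)"
    by (intro mult_left_mono circ) simp
  also have "\<dots> = (\<integral>\<^sup>+ t. ennreal (k * exp (- (norm z)\<^sup>2 / 4)) * (ennreal (norm (g (cis (2 * pi * t)))) * indicator {0..1} t) \<partial>lborel)"
  proof (rule nn_integral_cmult[symmetric])
    have "continuous_on UNIV g"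
      using \<open>g holomorphic_on UNIV\<close> by (rule holomorphic_on_imp_continuous_on)
    then have "continuous_on UNIV (\<lambda>t. g (cis (2 * pi * t)))"
      unfolding cis_conv_exp by (rule continuous_on_compose2[of UNIV g]) (intro continuous_intros, simp)
    then have "continuous_on UNIV (\<lambda>t. norm (g (cis (2 * pi * t))))" by (rule continuous_on_norm)
    then have [measurable]: "(\<lambda>t. norm (g (cis (2 * pi * t)))) \<in> borel_measurable borel"
      by (rule borel_measurable_continuous_onI)
    show "(\<lambda>t. ennreal (norm (g (cis (2 * pi * t)))) * indicator {0..1} t) \<in> borel_measurable lborel"
      by measurable
  qed
  also have "\<dots> = (\<integral>\<^sup>+ t. ennreal (exp ((norm h)\<^sup>2 / 4)) * (ennreal (norm (stft f (z + R t))) * indicator {0..1} t) \<partial>lborel)"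
  proof (rule nn_integral_cong)
    fix t
    have "ennreal (k * exp (- (norm z)\<^sup>2 / 4)) * ennreal (norm (g (cis (2 * pi * t)))) = ennreal (exp ((norm h)\<^sup>2 / 4)) * ennreal (norm (stft f (z + R t)))"
    proof -
      have "ennreal (k * exp (- (norm z)\<^sup>2 / 4)) * ennreal (norm (g (cis (2 * pi * t)))) = ennreal (k * exp (- (norm z)\<^sup>2 / 4) * norm (g (cis (2 * pi * t))))"
        using k by (intro ennreal_mult[symmetric]) auto
      also have "\<dots> = ennreal (exp ((norm h)\<^sup>2 / 4)) * ennreal (norm (stft f (z + R t)))"
        unfolding gt by (rule ennreal_mult) auto
      finally show ?thesis .
    qed
    then show "ennreal (k * exp (- (norm z)\<^sup>2 / 4)) * (ennreal (norm (g (cis (2 * pi * t)))) * indicator {0..1} t)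
        = ennreal (exp ((norm h)\<^sup>2 / 4)) * (ennreal (norm (stft f (z + R t))) * indicator {0..1} t)"
      by (simp only: mult.assoc[symmetric])
  qed
  also have "\<dots> = ennreal (exp ((norm h)\<^sup>2 / 4)) * (\<integral>\<^sup>+ t\<in>{0..1}. ennreal (norm (stft f (z + R t))) \<partial>lborel)"
  proof (rule nn_integral_cmult)
    have [measurable]: "(\<lambda>z. norm (stft f z)) \<in> borel_measurable borel"
      by (rule borel_measurable_continuous_onI[OF continuous_norm_stft[OF f]])
    have "R \<in> borel_measurable borel" unfolding R_def[abs_def] by measurable
    then have [measurable]: "(\<lambda>t. z + R t) \<in> borel_measurable borel" by simp
    show "(\<lambda>t. ennreal (norm (stft f (z + R t))) * indicator {0..1} t) \<in> borel_measurable lborel"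
      by measurable
  qed
  finally show ?thesis by (simp add: R_def)
qed

section \<open>Embedding of modulation spaces\<close>

lemma norm_stft_powr_mean:
  assumes p: "0 < p" "p \<le> 1"
  obtains C where "C > 0" "\<And>f :: nat ^ 'd \<Rightarrow> complex. \<And>z. f \<in> H_flat_dual \<Longrightarrow>
    ennreal (norm (stft f z) powr p) \<le> ennreal C * (\<integral>\<^sup>+ w\<in>ball z 1. ennreal (norm (stft f w) powr p) \<partial>lborel)"
proof -
  let ?m = "DIM((real ^ 'd) \<times> (real ^ 'd))"
  define V where "V = unit_ball_vol (real ?m)"
  have V: "V > 0" by (simp add: V_def)
  \<comment> \<open>The numerator comes from the averaged circle inequality; V, the volume of the
    unit ball, turns the volume of a ball of radius \<delta> into a pure power of \<delta>.\<close>
  define C where "C = exp (1 / 4) / V"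
  have C: "C > 0" using V by (simp add: C_def)
  have "ennreal (norm (stft f z) powr p) \<le> ennreal (C * 2 powr (real ?m / p)) * (\<integral>\<^sup>+ w\<in>ball z 1. ennreal (norm (stft f w) powr p) \<partial>lborel)"
    if f: "f \<in> H_flat_dual" for f :: "nat ^ 'd \<Rightarrow> complex" and z
  proof (rule ball_mean_powr[OF continuous_norm_stft[OF f] norm_ge_zero C p])
    show "0 < real ?m" by simp
    fix z and \<delta> :: real assume \<delta>: "0 < \<delta>" "\<delta> \<le> 1"
    have "ennreal (norm (stft f z)) * emeasure lborel (ball (0 :: (real ^ 'd) \<times> (real ^ 'd)) \<delta>)
        \<le> ennreal (exp (1 / 4)) * (\<integral>\<^sup>+ w\<in>ball z \<delta>. ennreal (norm (stft f w)) \<partial>lborel)"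
      by (rule rotation_mean_imp_ball_mean[OF borel_measurable_continuous_onI[OF continuous_norm_stft[OF f]] norm_stft_le_rotation_mean[OF f] \<delta>])
    then have le: "ennreal (norm (stft f z)) * ennreal (V * \<delta> ^ ?m)
        \<le> ennreal (exp (1 / 4)) * (\<integral>\<^sup>+ w\<in>ball z \<delta>. ennreal (norm (stft f w)) \<partial>lborel)"
      using \<delta> by (simp only: emeasure_ball V_def less_imp_le)
    have "ennreal (norm (stft f z)) * ennreal (\<delta> powr real ?m) = ennreal (1 / V) * (ennreal (norm (stft f z)) * ennreal (V * \<delta> ^ ?m))"
      unfolding powr_realpow[OF \<delta>(1)] using V \<delta> by (simp flip: ennreal_mult)
    also have "\<dots> \<le> ennreal (1 / V) * (ennreal (exp (1 / 4)) * (\<integral>\<^sup>+ w\<in>ball z \<delta>. ennreal (norm (stft f w)) \<partial>lborel))"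
      by (intro mult_left_mono le) simp
    also have "\<dots> = ennreal C * (\<integral>\<^sup>+ w\<in>ball z \<delta>. ennreal (norm (stft f w)) \<partial>lborel)"
      using V by (simp add: C_def mult.assoc[symmetric] flip: ennreal_mult)
    finally show "ennreal (norm (stft f z)) * ennreal (\<delta> powr real ?m) \<le> ennreal C * (\<integral>\<^sup>+ w\<in>ball z \<delta>. ennreal (norm (stft f w)) \<partial>lborel)" .
  qed
  moreover have "C * 2 powr (real ?m / p) > 0" using C by simp
  ultimately show thesis using that by blast
qed

text \<open>On the unit ball around (x, \<xi>) the weight at the centre is at most B times the
  weight at w, so it can be moved under the integral. The ball lies in the product of the unit balls
  around x and \<xi>, which yields the iterated form required by the mixed norm estimate.\<close>

lemma weighted_stft_powr_mean:
  fixes \<omega>' :: "(real ^ 'd) \<times> (real ^ 'd) \<Rightarrow> real"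
  assumes p: "0 < p" "p \<le> 1" and B: "B > 0" and pos: "\<And>z. \<omega>' z > 0"
    and meas [measurable]: "\<omega>' \<in> borel_measurable borel"
    and osc: "\<And>z w. dist z w < 1 \<Longrightarrow> \<omega>' z \<le> B * \<omega>' w"
  obtains C where "C > 0" "\<And>f x \<xi>. f \<in> H_flat_dual \<Longrightarrow>
    ennreal ((norm (stft f (x, \<xi>)) * \<omega>' (x, \<xi>)) powr p) \<le> ennreal C *
      (\<integral>\<^sup>+ \<eta>. near_ind \<xi> \<eta> * (\<integral>\<^sup>+ y. near_ind x y * ennreal ((norm (stft f (y, \<eta>)) * \<omega>' (y, \<eta>)) powr p) \<partial>lborel) \<partial>lborel)"
proof -
  obtain C where C: "C > 0" "\<And>f :: nat ^ 'd \<Rightarrow> complex. \<And>z. f \<in> H_flat_dual \<Longrightarrow>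
    ennreal (norm (stft f z) powr p) \<le> ennreal C * (\<integral>\<^sup>+ w\<in>ball z 1. ennreal (norm (stft f w) powr p) \<partial>lborel)"
    using norm_stft_powr_mean[OF p] by blast
  have "ennreal ((norm (stft f (x, \<xi>)) * \<omega>' (x, \<xi>)) powr p) \<le> ennreal (C * B powr p) *
      (\<integral>\<^sup>+ \<eta>. near_ind \<xi> \<eta> * (\<integral>\<^sup>+ y. near_ind x y * ennreal ((norm (stft f (y, \<eta>)) * \<omega>' (y, \<eta>)) powr p) \<partial>lborel) \<partial>lborel)"
    if f: "f \<in> H_flat_dual" for f x \<xi>
  proof -
    have [measurable]: "(\<lambda>z. norm (stft f z)) \<in> borel_measurable borel"
      by (rule borel_measurable_continuous_onI[OF continuous_norm_stft[OF f]])
    have [measurable]: "(\<lambda>z. norm (stft f z)) \<in> borel_measurable (borel \<Otimes>\<^sub>M borel)"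
      "\<omega>' \<in> borel_measurable (borel \<Otimes>\<^sub>M borel)"
      by (simp_all add: borel_prod)
    define v where "v z = (norm (stft f z) * \<omega>' z) powr p" for z
    have v_borel [measurable]: "v \<in> borel_measurable borel" unfolding v_def by measurable
    have v_pair [measurable]: "v \<in> borel_measurable (borel \<Otimes>\<^sub>M borel)" using v_borel by (simp add: borel_prod)
    have [measurable]: "ball (x, \<xi>) 1 \<in> sets borel" by simp
    have "ennreal (v (x, \<xi>)) = ennreal (\<omega>' (x, \<xi>) powr p) * ennreal (norm (stft f (x, \<xi>)) powr p)"
      unfolding v_def using pos[of "(x, \<xi>)"] by (simp add: powr_mult mult.commute flip: ennreal_mult)
    also have "\<dots> \<le> ennreal (\<omega>' (x, \<xi>) powr p) * (ennreal C * (\<integral>\<^sup>+ w\<in>ball (x, \<xi>) 1. ennreal (norm (stft f w) powr p) \<partial>lborel))"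
      by (intro mult_left_mono C(2)[OF f]) simp
    also have "\<dots> = (\<integral>\<^sup>+ w. ennreal (C * \<omega>' (x, \<xi>) powr p) * (ennreal (norm (stft f w) powr p) * indicator (ball (x, \<xi>) 1) w) \<partial>lborel)"
      using C(1) by (subst nn_integral_cmult) (auto simp: ennreal_mult mult_ac)
    also have "\<dots> \<le> (\<integral>\<^sup>+ w. ennreal (C * B powr p) * (near_ind \<xi> (snd w) * (near_ind x (fst w) * ennreal (v w))) \<partial>lborel)"
    proof (rule nn_integral_mono)
      fix w :: "(real ^ 'd) \<times> (real ^ 'd)"
      show "ennreal (C * \<omega>' (x, \<xi>) powr p) * (ennreal (norm (stft f w) powr p) * indicator (ball (x, \<xi>) 1) w)
          \<le> ennreal (C * B powr p) * (near_ind \<xi> (snd w) * (near_ind x (fst w) * ennreal (v w)))"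
      proof (cases "w \<in> ball (x, \<xi>) 1")
        case True
        then have d: "dist (x, \<xi>) w < 1" by simp
        have near: "near_ind \<xi> (snd w) = 1" "near_ind x (fst w) = 1"
          using dist_snd_le[of "(x, \<xi>)" w] dist_fst_le[of "(x, \<xi>)" w] d by (auto simp: near_ind_def)
        have "\<omega>' (x, \<xi>) powr p \<le> (B * \<omega>' w) powr p"
          using osc[OF d] pos[of "(x, \<xi>)"] p by (intro powr_mono2) auto
        also have "\<dots> = B powr p * \<omega>' w powr p" using B pos[of w] by (simp add: powr_mult)
        finally have "C * \<omega>' (x, \<xi>) powr p * norm (stft f w) powr p \<le> C * (B powr p * \<omega>' w powr p) * norm (stft f w) powr p"
          using C(1) by (intro mult_left_mono mult_right_mono) auto
        also have "\<dots> = C * B powr p * v w" using pos[of w] by (simp add: v_def powr_mult)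
        finally show ?thesis
          using True near C(1) by (simp add: ennreal_leI v_def flip: ennreal_mult)
      qed simp
    qed
    also have "\<dots> = ennreal (C * B powr p) * (\<integral>\<^sup>+ w. near_ind \<xi> (snd w) * (near_ind x (fst w) * ennreal (v w)) \<partial>lborel)"
      by (rule nn_integral_cmult) (simp, unfold borel_prod[symmetric], measurable)
    also have "(\<integral>\<^sup>+ w. near_ind \<xi> (snd w) * (near_ind x (fst w) * ennreal (v w)) \<partial>lborel)
        = (\<integral>\<^sup>+ \<eta>. near_ind \<xi> \<eta> * (\<integral>\<^sup>+ y. near_ind x y * ennreal (v (y, \<eta>)) \<partial>lborel) \<partial>lborel)"
    proof -
      have "(\<lambda>w. near_ind \<xi> (snd w) * (near_ind x (fst w) * ennreal (v w))) \<in> borel_measurable borel"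
        unfolding borel_prod[symmetric] by measurable
      from nn_integral_lborel_pair(1)[OF this]
      show ?thesis by (simp add: nn_integral_cmult)
    qed
    finally show ?thesis by (simp only: v_def)
  qed
  moreover have "C * B powr p > 0" using C(1) B by simp
  ultimately show thesis using that by blast
qed

text \<open>Replaces the Lebesgue measure of the definition by \<open>lborel\<close>, for which the
  Borel measurability and Fubini arguments are carried out.\<close>

lemma lux_norm_completion: "lux_norm (completion M) E g = lux_norm M E g"
  by (simp add: lux_norm_def nn_integral_completion)

lemma modulation_norm_eq_lux_norm:
  "modulation_norm \<Phi>1 \<Phi>2 \<omega> f = lux_norm lborel (ext_young \<Phi>2) (\<lambda>\<xi>.
     lux_norm lborel (ext_young \<Phi>1) (\<lambda>x. ennreal (norm (stft f (x, \<xi>)) * \<omega> (x, \<xi>))))"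
  by (simp add: modulation_norm_def mixed_orlicz_norm_def orlicz_norm_eq_lux_norm lux_norm_completion)

lemma modulation_norm_weight_mono:
  assumes \<Phi>: "mono (ext_young \<Phi>1)" "mono (ext_young \<Phi>2)"
    and C: "C > 0" and le: "\<And>z. \<omega> z \<le> C * \<omega>' z"
  shows "modulation_norm \<Phi>1 \<Phi>2 \<omega> f \<le> ennreal C * modulation_norm \<Phi>1 \<Phi>2 \<omega>' f"
proof -
  have "modulation_norm \<Phi>1 \<Phi>2 \<omega> f \<le> lux_norm lborel (ext_young \<Phi>2) (\<lambda>\<xi>.
      ennreal C * lux_norm lborel (ext_young \<Phi>1) (\<lambda>x. ennreal (norm (stft f (x, \<xi>)) * \<omega>' (x, \<xi>))))"
    unfolding modulation_norm_eq_lux_norm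
  proof (rule lux_norm_mono_fun[OF \<Phi>(2)])
    fix \<xi>
    have "ennreal (norm (stft f (x, \<xi>)) * \<omega> (x, \<xi>)) \<le> ennreal C * ennreal (norm (stft f (x, \<xi>)) * \<omega>' (x, \<xi>))" for x
    proof -
      have "norm (stft f (x, \<xi>)) * \<omega> (x, \<xi>) \<le> C * (norm (stft f (x, \<xi>)) * \<omega>' (x, \<xi>))"
        using mult_left_mono[OF le[of "(x, \<xi>)"], of "norm (stft f (x, \<xi>))"] by (simp add: mult_ac)
      then show ?thesis using C by (subst ennreal_mult'[symmetric]) (auto intro: ennreal_leI)
    qed
    then have "lux_norm lborel (ext_young \<Phi>1) (\<lambda>x. ennreal (norm (stft f (x, \<xi>)) * \<omega> (x, \<xi>)))
        \<le> lux_norm lborel (ext_young \<Phi>1) (\<lambda>x. ennreal C * ennreal (norm (stft f (x, \<xi>)) * \<omega>' (x, \<xi>)))"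
      by (intro lux_norm_mono_fun[OF \<Phi>(1)])
    also have "\<dots> \<le> ennreal C * lux_norm lborel (ext_young \<Phi>1) (\<lambda>x. ennreal (norm (stft f (x, \<xi>)) * \<omega>' (x, \<xi>)))"
      by (rule lux_norm_cmult_le[OF C])
    finally show "lux_norm lborel (ext_young \<Phi>1) (\<lambda>x. ennreal (norm (stft f (x, \<xi>)) * \<omega> (x, \<xi>)))
        \<le> ennreal C * lux_norm lborel (ext_young \<Phi>1) (\<lambda>x. ennreal (norm (stft f (x, \<xi>)) * \<omega>' (x, \<xi>)))" .
  qed
  also have "\<dots> \<le> ennreal C * modulation_norm \<Phi>1 \<Phi>2 \<omega>' f"
    unfolding modulation_norm_eq_lux_norm by (rule lux_norm_cmult_le[OF C])
  finally show ?thesis .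
qed

lemma H_flat_dual_diff:
  assumes f: "f \<in> H_flat_dual" and g: "g \<in> H_flat_dual"
  shows "g - f \<in> H_flat_dual"
  unfolding H_flat_dual_def
proof (intro CollectI allI impI)
  fix r :: real assume r: "r > 0"
  obtain C where C: "C > 0" "\<And>\<alpha>. norm (f \<alpha>) \<le> C * (r ^ mi_length \<alpha> * sqrt (mi_fact \<alpha>))"
    using f r unfolding H_flat_dual_def by blast
  obtain D where D: "D > 0" "\<And>\<alpha>. norm (g \<alpha>) \<le> D * (r ^ mi_length \<alpha> * sqrt (mi_fact \<alpha>))"
    using g r unfolding H_flat_dual_def by blast
  show "\<exists>C>0. \<forall>\<alpha>. norm ((g - f) \<alpha>) \<le> C * (r ^ mi_length \<alpha> * sqrt (mi_fact \<alpha>))"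
  proof (intro exI[of _ "D + C"] conjI allI)
    fix \<alpha>
    show "norm ((g - f) \<alpha>) \<le> (D + C) * (r ^ mi_length \<alpha> * sqrt (mi_fact \<alpha>))"
      using norm_triangle_ineq4[of "g \<alpha>" "f \<alpha>"] C(2)[of \<alpha>] D(2)[of \<alpha>]
      by (simp add: distrib_right)
  qed (use C D in simp)
qed

lemma quasi_young_compare:
  assumes \<Phi>: "quasi_young_of_order r \<Phi>" and \<Psi>: "quasi_young \<Psi>" and p: "0 < p" "p \<le> r"
    and lim: "\<exists>L<\<infinity>. ((\<lambda>t. \<Psi> t / \<Phi> t) \<longlongrightarrow> L) (at_right 0)" and b: "b < \<infinity>"
  obtains s where "s > 0" "\<And>t. ext_young \<Phi> (epow (1 / p) t) \<le> b \<Longrightarrow>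
    ext_young \<Psi> (epow (1 / p) (ennreal s * t)) \<le> ext_young \<Phi> (epow (1 / p) t)"
proof -
  obtain r' where r': "quasi_young_of_order r' \<Psi>" using \<Psi> by (auto simp: quasi_young_def)
  obtain L t0 where L: "L < \<infinity>" "t0 > 0"
    "\<And>t. t \<le> t0 \<Longrightarrow> ext_young \<Psi> (epow (1 / p) t) \<le> L * ext_young \<Phi> (epow (1 / p) t)"
    using quasi_young_compare_near_zero[OF r' p(1) lim] by blast
  show thesis
    using star_gauge_compare[OF star_gauge_quasi_young[OF \<Phi> p] b L(1,2),
        of "\<lambda>t. ext_young \<Psi> (epow (1 / p) t)", OF L(3)] that
    by blast
qed

lemma quasi_young_mono: "quasi_young \<Phi> \<Longrightarrow> mono (ext_young \<Phi>)"
  using quasi_young_of_order_mono by (auto simp: quasi_young_def)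

lemma quasi_young_zero: "quasi_young \<Phi> \<Longrightarrow> ext_young \<Phi> 0 = 0"
  using quasi_young_of_order_zero by (auto simp: quasi_young_def ext_young_def)

lemma mono_ext_young_epow: "quasi_young \<Phi> \<Longrightarrow> 0 < p \<Longrightarrow> mono (\<lambda>t. ext_young \<Phi> (epow (1 / p) t))"
  by (intro monoI monoD[OF quasi_young_mono] epow_mono) auto

text \<open>With p at most both orders of the \<Phi>'s, the gauges are compared at level 1, the
  bound that counting measure provides at every point; the constant for p-th powers is then raised
  to 1 / p.\<close>

lemma ell_norm_le:
  assumes \<Phi>: "quasi_young \<Phi>1" "quasi_young \<Phi>2" and \<Psi>: "quasi_young \<Psi>1" "quasi_young \<Psi>2"
    and lim: "\<exists>L<\<infinity>. ((\<lambda>t. \<Psi>1 t / \<Phi>1 t) \<longlongrightarrow> L) (at_right 0)"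
      "\<exists>L<\<infinity>. ((\<lambda>t. \<Psi>2 t / \<Phi>2 t) \<longlongrightarrow> L) (at_right 0)"
  obtains K where "K > 0" "\<And>a. ell_norm \<Psi>1 \<Psi>2 \<omega> a \<le> ennreal K * ell_norm \<Phi>1 \<Phi>2 \<omega> a"
proof -
  obtain r1 r2 where r: "quasi_young_of_order r1 \<Phi>1" "quasi_young_of_order r2 \<Phi>2"
    using \<Phi> by (auto simp: quasi_young_def)
  define p where "p = min r1 r2"
  have p: "0 < p" "p \<le> r1" "p \<le> r2" using r by (auto simp: p_def quasi_young_of_order_def)
  have one: "(1::ennreal) < \<infinity>" by simp
  obtain s1 where s1: "s1 > 0" "\<And>t. ext_young \<Phi>1 (epow (1 / p) t) \<le> 1 \<Longrightarrow>
      ext_young \<Psi>1 (epow (1 / p) (ennreal s1 * t)) \<le> ext_young \<Phi>1 (epow (1 / p) t)"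
    using quasi_young_compare[OF r(1) \<Psi>(1) p(1,2) lim(1) one] by blast
  obtain s2 where s2: "s2 > 0" "\<And>t. ext_young \<Phi>2 (epow (1 / p) t) \<le> 1 \<Longrightarrow>
      ext_young \<Psi>2 (epow (1 / p) (ennreal s2 * t)) \<le> ext_young \<Phi>2 (epow (1 / p) t)"
    using quasi_young_compare[OF r(2) \<Psi>(2) p(1,3) lim(2) one] by blast
  let ?E1 = "\<lambda>t. ext_young \<Phi>1 (epow (1 / p) t)" and ?F1 = "\<lambda>t. ext_young \<Psi>1 (epow (1 / p) t)"
    and ?E2 = "\<lambda>t. ext_young \<Phi>2 (epow (1 / p) t)" and ?F2 = "\<lambda>t. ext_young \<Psi>2 (epow (1 / p) t)"
  define K where "K = 1 / s1 * (1 / s2)"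
  have K: "K > 0" using s1 s2 by (simp add: K_def)
  have "ell_norm \<Psi>1 \<Psi>2 \<omega> a \<le> ennreal (K powr (1 / p)) * ell_norm \<Phi>1 \<Phi>2 \<omega> a" for a
  proof (rule epow_le_cmultD[OF p(1)])
    show "epow p (ell_norm \<Psi>1 \<Psi>2 \<omega> a) \<le> ennreal K * epow p (ell_norm \<Phi>1 \<Phi>2 \<omega> a)"
      unfolding ell_norm_def mixed_orlicz_norm_def orlicz_norm_eq_lux_norm mixed_lux_norm_epow[OF p(1), symmetric] K_def
      by (rule mixed_lux_norm_count_space_le[where ?E1.0 = ?E1 and ?F1.0 = ?F1 and ?E2.0 = ?E2 and ?F2.0 = ?F2])
        (fact mono_ext_young_epow[OF \<Psi>(2) p(1)] s1 s2)+
  qed (use K in simp)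
  then show thesis using that[of "K powr (1 / p)"] K by simp
qed

text \<open>The mixed estimate is applied to the p-th power of the transform weighted by the Borel
  majorant \<omega>'. Undoing the power gives \<open>K powr (1 / p)\<close>; returning to \<omega>
  costs nothing on the \<Psi> side, where \<omega> \<le> \<omega>', and the factor B on the \<Phi>
  side.\<close>

lemma modulation_norm_le:
  fixes \<omega> :: "(real ^ 'd) \<times> (real ^ 'd) \<Rightarrow> real"
  assumes \<omega>: "moderate_weight \<omega>"
    and \<Phi>: "quasi_young \<Phi>1" "quasi_young \<Phi>2" and \<Psi>: "quasi_young \<Psi>1" "quasi_young \<Psi>2"
    and lim: "\<exists>L<\<infinity>. ((\<lambda>t. \<Psi>1 t / \<Phi>1 t) \<longlongrightarrow> L) (at_right 0)"
      "\<exists>L<\<infinity>. ((\<lambda>t. \<Psi>2 t / \<Phi>2 t) \<longlongrightarrow> L) (at_right 0)"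
  obtains K where "K > 0" "\<And>f. f \<in> H_flat_dual \<Longrightarrow>
    modulation_norm \<Psi>1 \<Psi>2 \<omega> f \<le> ennreal K * modulation_norm \<Phi>1 \<Phi>2 \<omega> f"
proof -
  obtain r1 r2 where r: "quasi_young_of_order r1 \<Phi>1" "quasi_young_of_order r2 \<Phi>2"
    using \<Phi> by (auto simp: quasi_young_def)
  define p where "p = min r1 r2"
  have p: "0 < p" "p \<le> r1" "p \<le> r2" "p \<le> 1" using r by (auto simp: p_def quasi_young_of_order_def)
  \<comment> \<open>The pointwise level that Jensen over a unit ball yields for both gauges.\<close>
  define b where "b = 1 / unit_vol TYPE(real ^ 'd)"
  have b: "b < \<infinity>"
    using unit_vol_bounds[where 'a="real ^ 'd"] by (simp add: b_def less_top[symmetric] ennreal_divide_eq_top_iff)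
  obtain s1 where s1: "s1 > 0" "\<And>t. ext_young \<Phi>1 (epow (1 / p) t) \<le> b \<Longrightarrow>
      ext_young \<Psi>1 (epow (1 / p) (ennreal s1 * t)) \<le> ext_young \<Phi>1 (epow (1 / p) t)"
    using quasi_young_compare[OF r(1) \<Psi>(1) p(1,2) lim(1) b] by blast
  obtain s2 where s2: "s2 > 0" "\<And>t. ext_young \<Phi>2 (epow (1 / p) t) \<le> b \<Longrightarrow>
      ext_young \<Psi>2 (epow (1 / p) (ennreal s2 * t)) \<le> ext_young \<Phi>2 (epow (1 / p) t)"
    using quasi_young_compare[OF r(2) \<Psi>(2) p(1,3) lim(2) b] by blast
  obtain \<omega>' B where \<omega>': "\<omega>' \<in> borel_measurable borel" "B > 0"
    "\<And>z. \<omega> z \<le> \<omega>' z" "\<And>z. \<omega>' z \<le> B * \<omega> z" "\<And>z w. dist z w < 1 \<Longrightarrow> \<omega>' z \<le> B * \<omega>' w"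
    using moderate_weight_borel_equivalent[OF \<omega>] by blast
  have pos: "\<omega>' z > 0" for z
    using moderate_weight_pos[OF \<omega>, of z] \<omega>'(3)[of z] by linarith
  obtain C where C: "C > 0" "\<And>f x \<xi>. f \<in> H_flat_dual \<Longrightarrow>
    ennreal ((norm (stft f (x, \<xi>)) * \<omega>' (x, \<xi>)) powr p) \<le> ennreal C *
      (\<integral>\<^sup>+ \<eta>. near_ind \<xi> \<eta> * (\<integral>\<^sup>+ y. near_ind x y * ennreal ((norm (stft f (y, \<eta>)) * \<omega>' (y, \<eta>)) powr p) \<partial>lborel) \<partial>lborel)"
    using weighted_stft_powr_mean[OF p(1,4) \<omega>'(2) pos \<omega>'(1,5)] by blast
  let ?\<mu> = "measure lborel (ball (0 :: real ^ 'd) 1)"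
  let ?E1 = "\<lambda>t. ext_young \<Phi>1 (epow (1 / p) t)" and ?F1 = "\<lambda>t. ext_young \<Psi>1 (epow (1 / p) t)"
    and ?E2 = "\<lambda>t. ext_young \<Phi>2 (epow (1 / p) t)" and ?F2 = "\<lambda>t. ext_young \<Psi>2 (epow (1 / p) t)"
  define K where "K = 4 * C * ?\<mu> / s1 * (2 * ?\<mu> / s2)"
  have K: "K > 0" using C(1) s1(1) s2(1) content_ball_pos[of 1 "0 :: real ^ 'd"] by (simp add: K_def)
  have main: "modulation_norm \<Psi>1 \<Psi>2 \<omega>' f \<le> ennreal (K powr (1 / p)) * modulation_norm \<Phi>1 \<Phi>2 \<omega>' f"
    if f: "f \<in> H_flat_dual" for f
  proof (rule epow_le_cmultD[OF p(1)])
    define v where "v x \<xi> = (norm (stft f (x, \<xi>)) * \<omega>' (x, \<xi>)) powr p" for x \<xi>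
    have [measurable]: "(\<lambda>z. norm (stft f z)) \<in> borel_measurable (borel \<Otimes>\<^sub>M borel)"
      "\<omega>' \<in> borel_measurable (borel \<Otimes>\<^sub>M borel)"
      using borel_measurable_continuous_onI[OF continuous_norm_stft[OF f]] \<omega>'(1) by (simp_all add: borel_prod)
    have meas: "case_prod v \<in> borel_measurable (borel \<Otimes>\<^sub>M borel)"
      unfolding v_def[abs_def] by (simp add: case_prod_unfold)
    have epow_v: "epow p (ennreal (norm (stft f (x, \<xi>)) * \<omega>' (x, \<xi>))) = ennreal (v x \<xi>)" for x \<xi>
      using pos[of "(x, \<xi>)"] by (simp add: v_def)
    have "lux_norm lborel ?F2 (\<lambda>\<xi>. lux_norm lborel ?F1 (\<lambda>x. ennreal (v x \<xi>)))
        \<le> ennreal K * lux_norm lborel ?E2 (\<lambda>\<xi>. lux_norm lborel ?E1 (\<lambda>x. ennreal (v x \<xi>)))"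
      unfolding K_def
    proof (rule mixed_lux_norm_le[where ?E1.0 = ?E1 and ?F1.0 = ?F1 and ?E2.0 = ?E2 and ?F2.0 = ?F2 and v = v])
      show "star_gauge ?E1" by (rule star_gauge_quasi_young[OF r(1) p(1,2)])
      show "star_gauge ?E2" by (rule star_gauge_quasi_young[OF r(2) p(1,3)])
      show "mono ?F2" by (rule mono_ext_young_epow[OF \<Psi>(2) p(1)])
      show "ext_young \<Psi>1 (epow (1 / p) 0) = 0" using quasi_young_zero[OF \<Psi>(1)] by simp
      show "0 \<le> v x \<xi>" for x \<xi> by (simp add: v_def)
      show "ennreal (v x \<xi>) \<le> ennreal C * (\<integral>\<^sup>+ \<eta>. near_ind \<xi> \<eta> * (\<integral>\<^sup>+ y. near_ind x y * ennreal (v y \<eta>) \<partial>lborel) \<partial>lborel)" for x \<xi>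
        unfolding v_def by (rule C(2)[OF f])
    qed (fact meas C(1) s1[unfolded b_def] s2[unfolded b_def])+
    then show "epow p (modulation_norm \<Psi>1 \<Psi>2 \<omega>' f) \<le> ennreal K * epow p (modulation_norm \<Phi>1 \<Phi>2 \<omega>' f)"
      unfolding modulation_norm_eq_lux_norm mixed_lux_norm_epow[OF p(1), symmetric] epow_v .
  qed (use K in simp)
  have "modulation_norm \<Psi>1 \<Psi>2 \<omega> f \<le> ennreal (K powr (1 / p) * B) * modulation_norm \<Phi>1 \<Phi>2 \<omega> f"
    if f: "f \<in> H_flat_dual" for f
  proof -
    have "modulation_norm \<Psi>1 \<Psi>2 \<omega> f \<le> ennreal 1 * modulation_norm \<Psi>1 \<Psi>2 \<omega>' f"
      using \<omega>'(3) by (intro modulation_norm_weight_mono quasi_young_mono \<Psi>) auto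
    also have "\<dots> \<le> ennreal (K powr (1 / p)) * modulation_norm \<Phi>1 \<Phi>2 \<omega>' f"
      using main[OF f] by simp
    also have "\<dots> \<le> ennreal (K powr (1 / p)) * (ennreal B * modulation_norm \<Phi>1 \<Phi>2 \<omega> f)"
      by (intro mult_left_mono modulation_norm_weight_mono quasi_young_mono \<Phi> \<omega>'(2,4)) auto
    also have "\<dots> = ennreal (K powr (1 / p) * B) * modulation_norm \<Phi>1 \<Phi>2 \<omega> f"
      using \<omega>'(2) by (simp add: ennreal_mult mult.assoc)
    finally show ?thesis .
  qed
  then show thesis using that[of "K powr (1 / p) * B"] K \<omega>'(2) by simp
qed

theorem theorem4p10:
  fixes \<omega> :: "(real ^ 'd) \<times> (real ^ 'd) \<Rightarrow> real"
    and \<Phi>1 \<Phi>2 \<Psi>1 \<Psi>2 :: "real \<Rightarrow> ennreal"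
  assumes "moderate_weight \<omega>"
    and "quasi_young \<Phi>1" "quasi_young \<Phi>2" "quasi_young \<Psi>1" "quasi_young \<Psi>2"
    and "\<exists>L<\<infinity>. ((\<lambda>t. \<Psi>1 t / \<Phi>1 t) \<longlongrightarrow> L) (at_right 0)"
    and "\<exists>L<\<infinity>. ((\<lambda>t. \<Psi>2 t / \<Phi>2 t) \<longlongrightarrow> L) (at_right 0)"
  shows "continuously_embedded
           (ell_space \<Phi>1 \<Phi>2 \<omega>) (ell_norm \<Phi>1 \<Phi>2 \<omega>)
           (ell_space \<Psi>1 \<Psi>2 \<omega>) (ell_norm \<Psi>1 \<Psi>2 \<omega>)
       \<and> continuously_embedded
           (modulation_space \<Phi>1 \<Phi>2 \<omega>) (modulation_norm \<Phi>1 \<Phi>2 \<omega>)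
           (modulation_space \<Psi>1 \<Psi>2 \<omega>) (modulation_norm \<Psi>1 \<Psi>2 \<omega>)"
proof
  obtain K where K: "K > 0" "\<And>a. ell_norm \<Psi>1 \<Psi>2 \<omega> a \<le> ennreal K * ell_norm \<Phi>1 \<Phi>2 \<omega> a"
    using ell_norm_le[OF assms(2-7)] by blast
  \<comment> \<open>All sequences form the ambient set, so closure under differences is
    automatic.\<close>
  show "continuously_embedded
           (ell_space \<Phi>1 \<Phi>2 \<omega>) (ell_norm \<Phi>1 \<Phi>2 \<omega>)
           (ell_space \<Psi>1 \<Psi>2 \<omega>) (ell_norm \<Psi>1 \<Psi>2 \<omega>)"
    using continuously_embeddedI[OF K(1), of UNIV "ell_norm \<Psi>1 \<Psi>2 \<omega>" "ell_norm \<Phi>1 \<Phi>2 \<omega>"] K(2)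
    by (simp add: ell_space_def)
next
  obtain K where K: "K > 0" "\<And>f. f \<in> H_flat_dual \<Longrightarrow>
      modulation_norm \<Psi>1 \<Psi>2 \<omega> f \<le> ennreal K * modulation_norm \<Phi>1 \<Phi>2 \<omega> f"
    using modulation_norm_le[OF assms] by blast
  show "continuously_embedded
           (modulation_space \<Phi>1 \<Phi>2 \<omega>) (modulation_norm \<Phi>1 \<Phi>2 \<omega>)
           (modulation_space \<Psi>1 \<Psi>2 \<omega>) (modulation_norm \<Psi>1 \<Psi>2 \<omega>)"
    unfolding modulation_space_def by (rule continuously_embeddedI[OF K(1) H_flat_dual_diff K(2)])
qed

end
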